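(* Let $R$ be a valuation ring and let $M$ be a polyserial and countably generated $R$-module. Then any two pure-composition series of $M$ are isomorphic.
   Context: All rings are commutative with unity and all modules are unital. A module is uniserial if its submodules are linearly ordered by inclusion; a valuation ring is a ring which is uniserial as a module over itself (zero divisors are allowed). A submodule $F$ of $E$ is pure if the exact sequence $0\to F\to E\to E/F\to 0$ remains exact when tensored with any $R$-module. A module $M$ is polyserial if it has a pure-composition series $0=M_0\subset M_1\subset\dots\subset M_n=M$ (strict inclusions, each $M_k$ a pure submodule of $M$) where $M_k/M_{k-1}$ is uniserial for each $k$, $1\le k\le n$. In the claim, pure-composition series are understood to have uniserial factors. Two such series $0=M_0\subset\dots\subset M_n=M$ and $0=M'_0\subset\dots\subset M'_m=M$ are isomorphic if $m=n$ and there is a permutation $\sigma$ of $\{1,\dots,n\}$ with $M_k/M_{k-1}\cong M'_{\sigma(k)}/M'_{\sigma(k)-1}$ for each $k$. *)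

theory Defs
  imports "HOL-Algebra.Algebra"
begin

section \<open>Homomorphisms and quotients of modules\<close>

definition module_hom ::
  "('a, 'r) ring_scheme \<Rightarrow> ('a, 'b, 'm) module_scheme \<Rightarrow> ('a, 'c, 'n) module_scheme \<Rightarrow> ('b \<Rightarrow> 'c) set" where
  "module_hom R M N =
     {f \<in> hom (add_monoid M) (add_monoid N).
        \<forall>r\<in>carrier R. \<forall>x\<in>carrier M. f (r \<odot>\<^bsub>M\<^esub> x) = r \<odot>\<^bsub>N\<^esub> f x}"

definition module_isomorphic ::
  "('a, 'r) ring_scheme \<Rightarrow> ('a, 'b, 'm) module_scheme \<Rightarrow> ('a, 'c, 'n) module_scheme \<Rightarrow> bool" where
  "module_isomorphic R M N \<longleftrightarrow> (\<exists>f\<in>module_hom R M N. bij_betw f (carrier M) (carrier N))"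

text \<open>
  The record type of modules extends that of rings; the multiplication and the unit
  of a module are irrelevant and left unspecified.
\<close>

definition quotient_module ::
  "('a, 'b, 'm) module_scheme \<Rightarrow> 'b set \<Rightarrow> ('a, 'b set) module" where
  "quotient_module M H =
     \<lparr>carrier = a_rcosets\<^bsub>M\<^esub> H, monoid.mult = undefined, monoid.one = undefined,
      ring.zero = H, ring.add = (\<lambda>A B. A <+>\<^bsub>M\<^esub> B), smult = (\<lambda>r A. \<Union>x\<in>A. H +>\<^bsub>M\<^esub> (r \<odot>\<^bsub>M\<^esub> x))\<rparr>"


section \<open>Tensor products\<close>

text \<open>
  Only the underlying abelian group of the tensor product is needed, since exactness does
  not depend on the scalar multiplication. It is the free abelian group on pairs modulo the
  usual relations; the generator \<open>frag_of (x, n)\<close> represents the elementary tensor of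
  \<open>x\<close> and \<open>n\<close>.
\<close>

definition tensor_gens ::
  "('a, 'r) ring_scheme \<Rightarrow> ('a, 'b, 'm) module_scheme \<Rightarrow> ('a, 'c, 'n) module_scheme
     \<Rightarrow> (('b \<times> 'c) \<Rightarrow>\<^sub>0 int) set" where
  "tensor_gens R M N =
     {frag_of (x \<oplus>\<^bsub>M\<^esub> y, n) - frag_of (x, n) - frag_of (y, n) | x y n.
        x \<in> carrier M \<and> y \<in> carrier M \<and> n \<in> carrier N} \<union>
     {frag_of (x, n \<oplus>\<^bsub>N\<^esub> n') - frag_of (x, n) - frag_of (x, n') | x n n'.
        x \<in> carrier M \<and> n \<in> carrier N \<and> n' \<in> carrier N} \<union>
     {frag_of (r \<odot>\<^bsub>M\<^esub> x, n) - frag_of (x, r \<odot>\<^bsub>N\<^esub> n) | r x n.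
        r \<in> carrier R \<and> x \<in> carrier M \<and> n \<in> carrier N}"

definition tensor_rels ::
  "('a, 'r) ring_scheme \<Rightarrow> ('a, 'b, 'm) module_scheme \<Rightarrow> ('a, 'c, 'n) module_scheme
     \<Rightarrow> (('b \<times> 'c) \<Rightarrow>\<^sub>0 int) set" where
  "tensor_rels R M N =
     generate (free_Abelian_group (carrier M \<times> carrier N)) (tensor_gens R M N)"

definition tensor_product ::
  "('a, 'r) ring_scheme \<Rightarrow> ('a, 'b, 'm) module_scheme \<Rightarrow> ('a, 'c, 'n) module_scheme
     \<Rightarrow> (('b \<times> 'c) \<Rightarrow>\<^sub>0 int) set monoid" where
  "tensor_product R M N =
     free_Abelian_group (carrier M \<times> carrier N) Mod tensor_rels R M N"

definition frag_map2 ::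
  "('b \<Rightarrow> 'b2) \<Rightarrow> ('c \<Rightarrow> 'c2) \<Rightarrow> (('b \<times> 'c) \<Rightarrow>\<^sub>0 int) \<Rightarrow> (('b2 \<times> 'c2) \<Rightarrow>\<^sub>0 int)" where
  "frag_map2 f g = frag_extend (\<lambda>(x, n). frag_of (f x, g n))"

text \<open>
  For a homomorphism \<open>f\<close> from \<open>M\<close> to \<open>M'\<close>, the map from the tensor product of
  \<open>M\<close> and \<open>N\<close> to that of \<open>M'\<close> and \<open>N\<close> induced by \<open>f\<close> and the identity of \<open>N\<close>.
\<close>

definition tensor_map ::
  "('a, 'r) ring_scheme \<Rightarrow> ('a, 'b2, 'm2) module_scheme \<Rightarrow> ('a, 'c, 'n) module_scheme
     \<Rightarrow> ('b \<Rightarrow> 'b2) \<Rightarrow> (('b \<times> 'c) \<Rightarrow>\<^sub>0 int) set \<Rightarrow> (('b2 \<times> 'c) \<Rightarrow>\<^sub>0 int) set" where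
  "tensor_map R M' N f C =
     (\<Union>c\<in>C. tensor_rels R M' N
        #>\<^bsub>free_Abelian_group (carrier M' \<times> carrier N)\<^esub> frag_map2 f id c)"


section \<open>Purity\<close>

text \<open>
  The library's \<open>exact_seq\<close> requires all groups to live on the same type.
\<close>

definition short_exact ::
  "('a, 'l) monoid_scheme \<Rightarrow> ('b, 'm) monoid_scheme \<Rightarrow> ('c, 'n) monoid_scheme
     \<Rightarrow> ('a \<Rightarrow> 'b) \<Rightarrow> ('b \<Rightarrow> 'c) \<Rightarrow> bool" where
  "short_exact A B C f g \<longleftrightarrow>
     group A \<and> group B \<and> group C \<and> f \<in> mon A B \<and> g \<in> epi B C \<and>
     kernel B C g = f ` carrier A"

definition tensor_exact ::
  "('a, 'r) ring_scheme \<Rightarrow> ('a, 'b, 'm) module_scheme \<Rightarrow> 'b set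
     \<Rightarrow> ('a, 'c, 'n) module_scheme \<Rightarrow> bool" where
  "tensor_exact R M F N \<longleftrightarrow>
     short_exact
       (tensor_product R (M\<lparr>carrier := F\<rparr>) N)
       (tensor_product R M N)
       (tensor_product R (quotient_module M F) N)
       (tensor_map R M N id)
       (tensor_map R (quotient_module M F) N (\<lambda>x. F +>\<^bsub>M\<^esub> x))"

text \<open>
  HOL cannot quantify over modules on all types inside a definition, so the test modules
  live on one fixed type that contains an isomorphic copy of every countably generated
  \<open>R\<close>-module. This is no restriction: by \<open>pure_submodule_tensor_exact\<close> below, the sequence
  then remains exact when tensored with an \<open>R\<close>-module on any type whatsoever.
\<close>

definition pure_submodule ::
  "('a, 'r) ring_scheme \<Rightarrow> ('a, 'b, 'm) module_scheme \<Rightarrow> 'b set \<Rightarrow> bool" where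
  "pure_submodule R M F \<longleftrightarrow>
     submodule F R M \<and>
     (\<forall>N :: ('a, (nat \<Rightarrow> 'a) set) module. module R N \<longrightarrow> tensor_exact R M F N)"


section \<open>Uniserial modules and pure-composition series\<close>

definition uniserial :: "('a, 'r) ring_scheme \<Rightarrow> ('a, 'b, 'm) module_scheme \<Rightarrow> bool" where
  "uniserial R M \<longleftrightarrow>
     module R M \<and>
     (\<forall>A B. submodule A R M \<longrightarrow> submodule B R M \<longrightarrow> A \<subseteq> B \<or> B \<subseteq> A)"

definition regular_module :: "('a, 'r) ring_scheme \<Rightarrow> ('a, 'a) module" where
  "regular_module R =
     \<lparr>carrier = carrier R, monoid.mult = monoid.mult R, monoid.one = monoid.one R,
      ring.zero = ring.zero R, ring.add = ring.add R, smult = monoid.mult R\<rparr>"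

definition valuation_ring :: "('a, 'r) ring_scheme \<Rightarrow> bool" where
  "valuation_ring R \<longleftrightarrow> cring R \<and> uniserial R (regular_module R)"

definition submodule_generated ::
  "('a, 'r) ring_scheme \<Rightarrow> ('a, 'b, 'm) module_scheme \<Rightarrow> 'b set \<Rightarrow> 'b set" where
  "submodule_generated R M S = \<Inter> {H. submodule H R M \<and> S \<subseteq> H}"

definition countably_generated ::
  "('a, 'r) ring_scheme \<Rightarrow> ('a, 'b, 'm) module_scheme \<Rightarrow> bool" where
  "countably_generated R M \<longleftrightarrow>
     (\<exists>S. countable S \<and> S \<subseteq> carrier M \<and> submodule_generated R M S = carrier M)"

definition series_factor ::
  "('a, 'b, 'm) module_scheme \<Rightarrow> (nat \<Rightarrow> 'b set) \<Rightarrow> nat \<Rightarrow> ('a, 'b set) module" where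
  "series_factor M S k = quotient_module (M\<lparr>carrier := S k\<rparr>) (S (k - 1))"

text \<open>
  A series of length \<open>n\<close> is a function on the natural numbers of which only the values
  at \<open>0, \<dots>, n\<close> matter. The factors are required to be uniserial.
\<close>

definition pure_composition_series ::
  "('a, 'r) ring_scheme \<Rightarrow> ('a, 'b, 'm) module_scheme \<Rightarrow> (nat \<Rightarrow> 'b set) \<Rightarrow> nat \<Rightarrow> bool" where
  "pure_composition_series R M S n \<longleftrightarrow>
     S 0 = {\<zero>\<^bsub>M\<^esub>} \<and> S n = carrier M \<and>
     (\<forall>k\<le>n. pure_submodule R M (S k)) \<and>
     (\<forall>k\<in>{1..n}. S (k - 1) \<subset> S k \<and> uniserial R (series_factor M S k))"

definition polyserial :: "('a, 'r) ring_scheme \<Rightarrow> ('a, 'b, 'm) module_scheme \<Rightarrow> bool" where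
  "polyserial R M \<longleftrightarrow> module R M \<and> (\<exists>S n. pure_composition_series R M S n)"

definition isomorphic_series ::
  "('a, 'r) ring_scheme \<Rightarrow> ('a, 'b, 'm) module_scheme \<Rightarrow> (nat \<Rightarrow> 'b set) \<Rightarrow> nat
     \<Rightarrow> (nat \<Rightarrow> 'b set) \<Rightarrow> nat \<Rightarrow> bool" where
  "isomorphic_series R M S n T m \<longleftrightarrow>
     m = n \<and>
     (\<exists>\<sigma>. \<sigma> permutes {1..n} \<and>
        (\<forall>k\<in>{1..n}. module_isomorphic R (series_factor M S k) (series_factor M T (\<sigma> k))))"


section \<open>Purity does not depend on the type of the test modules\<close>

lemma free_coset_eq_iff:
  assumes "subgroup H (free_Abelian_group S)" "Poly_Mapping.keys c \<subseteq> S" "Poly_Mapping.keys d \<subseteq> S"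
  shows "H #>\<^bsub>free_Abelian_group S\<^esub> c = H #>\<^bsub>free_Abelian_group S\<^esub> d \<longleftrightarrow> c - d \<in> H"
proof -
  interpret comm_group "free_Abelian_group S" by (rule abelian_free_Abelian_group)
  interpret H: subgroup H "free_Abelian_group S" by fact
  have mem: "x \<in> H #>\<^bsub>free_Abelian_group S\<^esub> y \<longleftrightarrow> x - y \<in> H" for x y
    by (auto simp: r_coset_def) (metis diff_add_cancel)
  show ?thesis
  proof
    assume "H #>\<^bsub>free_Abelian_group S\<^esub> c = H #>\<^bsub>free_Abelian_group S\<^esub> d"
    moreover have "c \<in> H #>\<^bsub>free_Abelian_group S\<^esub> c"
      using mem H.one_closed by simp
    ultimately show "c - d \<in> H" using mem by simp
  next
    assume "c - d \<in> H"
    then have "c \<in> H #>\<^bsub>free_Abelian_group S\<^esub> d" by (simp add: mem)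
    then show "H #>\<^bsub>free_Abelian_group S\<^esub> c = H #>\<^bsub>free_Abelian_group S\<^esub> d"
      using repr_independence[of c H d] assms by simp
  qed
qed

lemma module_homD:
  assumes "f \<in> module_hom R M N"
  shows "x \<in> carrier M \<Longrightarrow> f x \<in> carrier N"
    and "\<lbrakk>x \<in> carrier M; y \<in> carrier M\<rbrakk> \<Longrightarrow> f (x \<oplus>\<^bsub>M\<^esub> y) = f x \<oplus>\<^bsub>N\<^esub> f y"
    and "\<lbrakk>r \<in> carrier R; x \<in> carrier M\<rbrakk> \<Longrightarrow> f (r \<odot>\<^bsub>M\<^esub> x) = r \<odot>\<^bsub>N\<^esub> f x"
  using assms by (auto simp: module_hom_def hom_def)

lemma module_homI:
  assumes "\<And>x. x \<in> carrier M \<Longrightarrow> f x \<in> carrier N"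
    and "\<And>x y. \<lbrakk>x \<in> carrier M; y \<in> carrier M\<rbrakk> \<Longrightarrow> f (x \<oplus>\<^bsub>M\<^esub> y) = f x \<oplus>\<^bsub>N\<^esub> f y"
    and "\<And>r x. \<lbrakk>r \<in> carrier R; x \<in> carrier M\<rbrakk> \<Longrightarrow> f (r \<odot>\<^bsub>M\<^esub> x) = r \<odot>\<^bsub>N\<^esub> f x"
  shows "f \<in> module_hom R M N"
  using assms by (auto simp: module_hom_def hom_def)

lemma id_module_hom: "id \<in> module_hom R M M"
  by (auto intro: module_homI)

lemma keys_diff2:
  assumes "Poly_Mapping.keys a \<subseteq> S" "Poly_Mapping.keys b \<subseteq> S"
  shows "Poly_Mapping.keys (a - b) \<subseteq> S"
  using keys_diff[of a b] assms by blast

lemma tensor_gens_keys: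
  assumes "module R M" "module R N"
  shows "tensor_gens R M N \<subseteq> {c. Poly_Mapping.keys c \<subseteq> carrier M \<times> carrier N}"
proof -
  interpret M: module R M by fact
  interpret N: module R N by fact
  show ?thesis
    unfolding tensor_gens_def
    by (intro Un_least subsetI; elim CollectE exE conjE; hypsubst;
        unfold mem_Collect_eq; intro keys_diff2) (simp_all add: keys_frag_of)
qed

lemma tensor_rels_subgroup:
  assumes "module R M" "module R N"
  shows "subgroup (tensor_rels R M N) (free_Abelian_group (carrier M \<times> carrier N))"
  unfolding tensor_rels_def
  by (rule group.generate_is_subgroup)
     (use tensor_gens_keys[OF assms] in \<open>auto simp: subset_iff\<close>)

lemma tensor_rels_normal:
  assumes "module R M" "module R N"
  shows "tensor_rels R M N \<lhd> free_Abelian_group (carrier M \<times> carrier N)"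
  using tensor_rels_subgroup[OF assms] comm_group.subgroup_imp_normal abelian_free_Abelian_group
  by blast

lemma tensor_rels_closed:
  assumes "module R M" "module R N"
  shows "c \<in> tensor_rels R M N \<Longrightarrow> Poly_Mapping.keys c \<subseteq> carrier M \<times> carrier N"
    and "0 \<in> tensor_rels R M N"
    and "c \<in> tensor_rels R M N \<Longrightarrow> - c \<in> tensor_rels R M N"
    and "\<lbrakk>c \<in> tensor_rels R M N; d \<in> tensor_rels R M N\<rbrakk> \<Longrightarrow> c + d \<in> tensor_rels R M N"
    and "\<lbrakk>c \<in> tensor_rels R M N; d \<in> tensor_rels R M N\<rbrakk> \<Longrightarrow> c - d \<in> tensor_rels R M N"
    and "c \<in> tensor_gens R M N \<Longrightarrow> c \<in> tensor_rels R M N"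
proof -
  note sg = tensor_rels_subgroup[OF assms]
  show k: "c \<in> tensor_rels R M N \<Longrightarrow> Poly_Mapping.keys c \<subseteq> carrier M \<times> carrier N" for c
    using subgroup.subset[OF sg] by (auto simp: free_Abelian_group_def)
  show "0 \<in> tensor_rels R M N"
    using subgroup.one_closed[OF sg] by simp
  show m: "c \<in> tensor_rels R M N \<Longrightarrow> - c \<in> tensor_rels R M N" for c
    using subgroup.m_inv_closed[OF sg] k by fastforce
  show a: "\<lbrakk>c \<in> tensor_rels R M N; d \<in> tensor_rels R M N\<rbrakk> \<Longrightarrow> c + d \<in> tensor_rels R M N" for c d
    using subgroup.m_closed[OF sg] by fastforce
  show "\<lbrakk>c \<in> tensor_rels R M N; d \<in> tensor_rels R M N\<rbrakk> \<Longrightarrow> c - d \<in> tensor_rels R M N"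
    using a[of c "-d"] m[of d] by simp
  show "c \<in> tensor_gens R M N \<Longrightarrow> c \<in> tensor_rels R M N"
    unfolding tensor_rels_def by (rule generate.incl)
qed

lemma tensor_rels_induct:
  assumes "module R M" "module R N" "c \<in> tensor_rels R M N"
    and "P 0" "\<And>g. g \<in> tensor_gens R M N \<Longrightarrow> P g"
    and "\<And>g. g \<in> tensor_gens R M N \<Longrightarrow> P (- g)"
    and "\<And>a b. \<lbrakk>P a; P b\<rbrakk> \<Longrightarrow> P (a + b)"
  shows "P c"
  using assms(3) unfolding tensor_rels_def
proof (induction rule: generate.induct)
  case (inv h)
  then show ?case using tensor_gens_keys[OF assms(1,2)] assms(6) by auto
qed (use assms in auto)

lemma frag_map2_simps [simp]:
  "frag_map2 f g 0 = 0"
  "frag_map2 f g (frag_of (x, n)) = frag_of (f x, g n)"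
  "frag_map2 f g (a + b) = frag_map2 f g a + frag_map2 f g b"
  "frag_map2 f g (a - b) = frag_map2 f g a - frag_map2 f g b"
  "frag_map2 f g (- a) = - frag_map2 f g a"
  by (simp_all add: frag_map2_def frag_extend_add frag_extend_diff frag_extend_minus)

lemma frag_map2_rels:
  assumes "module R M" "module R N" "module R M'" "module R N'"
    and f: "f \<in> module_hom R M M'" and g: "g \<in> module_hom R N N'"
    and c: "c \<in> tensor_rels R M N"
  shows "frag_map2 f g c \<in> tensor_rels R M' N'"
proof -
  have gen: "frag_map2 f g h \<in> tensor_gens R M' N'" if "h \<in> tensor_gens R M N" for h
    using that unfolding tensor_gens_def
    apply (elim UnE CollectE exE conjE)
    subgoal for x y n
      by (rule UnI1, rule UnI1, rule CollectI, rule exI[of _ "f x"], rule exI[of _ "f y"],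
          rule exI[of _ "g n"]) (simp add: module_homD[OF f] module_homD[OF g])
    subgoal for x n n'
      by (rule UnI1, rule UnI2, rule CollectI, rule exI[of _ "f x"], rule exI[of _ "g n"],
          rule exI[of _ "g n'"]) (simp add: module_homD[OF f] module_homD[OF g])
    subgoal for r x n
      by (rule UnI2, rule CollectI, rule exI[of _ r], rule exI[of _ "f x"],
          rule exI[of _ "g n"]) (simp add: module_homD[OF f] module_homD[OF g])
    done
  show ?thesis
    by (rule tensor_rels_induct[OF assms(1,2) c])
       (auto simp: tensor_rels_closed[OF assms(3,4)] gen)
qed

lemma frag_map2_keys:
  assumes "Poly_Mapping.keys c \<subseteq> A \<times> B" "\<And>x. x \<in> A \<Longrightarrow> f x \<in> A'" "\<And>n. n \<in> B \<Longrightarrow> g n \<in> B'"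
  shows "Poly_Mapping.keys (frag_map2 f g c) \<subseteq> A' \<times> B'"
  unfolding frag_map2_def
  by (rule order_trans[OF keys_frag_extend]) (use assms in \<open>auto simp: keys_frag_of\<close>)

lemma frag_map2_comp:
  "frag_map2 f g (frag_map2 f' g' c) = frag_map2 (f \<circ> f') (g \<circ> g') c"
proof (rule frag_induction[of c UNIV])
  show "frag_map2 f g (frag_map2 f' g' (frag_of x)) = frag_map2 (f \<circ> f') (g \<circ> g') (frag_of x)"
    for x by (cases x) simp
qed auto

lemma frag_map2_cong:
  assumes "Poly_Mapping.keys c \<subseteq> A \<times> B" "\<And>x. x \<in> A \<Longrightarrow> f x = f' x" "\<And>n. n \<in> B \<Longrightarrow> g n = g' n"
  shows "frag_map2 f g c = frag_map2 f' g' c"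
  unfolding frag_map2_def by (rule frag_extend_eq) (use assms in auto)

lemma frag_map2_id: "frag_map2 id id c = c"
proof -
  have "frag_map2 id id c = frag_extend frag_of c"
    unfolding frag_map2_def by (rule frag_extend_eq) auto
  then show ?thesis using frag_expansion[of c] by simp
qed

lemma submodule_carrier_module:
  assumes "module R M" "submodule F R M"
  shows "module R (M\<lparr>carrier := F\<rparr>)"
  using submodule.submodule_is_module[OF assms(2,1)] .

lemma incl_module_hom:
  assumes "module R M" "submodule F R M"
  shows "id \<in> module_hom R (M\<lparr>carrier := F\<rparr>) M"
  using module.submoduleE[OF assms] by (auto intro!: module_homI)

lemma
  assumes M: "module R M" and F: "submodule F R M"
  shows quotient_module_module: "module R (quotient_module M F)"
    and quotient_module_proj: "(\<lambda>x. F +>\<^bsub>M\<^esub> x) \<in> module_hom R M (quotient_module M F)"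
    and quotient_module_surj: "(\<lambda>x. F +>\<^bsub>M\<^esub> x) ` carrier M = carrier (quotient_module M F)"
proof -
  interpret M: module R M by fact
  interpret F: submodule F R M by fact
  note FE = M.submoduleE[OF F]
  interpret F: abelian_subgroup F M
    using M.a_comm_group F.subgroup_axioms
    by (intro abelian_subgroupI3 additive_subgroup.intro M.abelian_group_axioms)
  let ?Q = "quotient_module M F" and ?p = "\<lambda>x. F +>\<^bsub>M\<^esub> x"
  show surj: "?p ` carrier M = carrier ?Q"
    by (auto simp: quotient_module_def A_RCOSETS_def RCOSETS_def a_r_coset_def)
  have add: "?p x \<oplus>\<^bsub>?Q\<^esub> ?p y = ?p (x \<oplus>\<^bsub>M\<^esub> y)" if "x \<in> carrier M" "y \<in> carrier M" for x y
    using that by (simp add: quotient_module_def F.a_rcos_sum)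
  have eq: "?p x = ?p y" if "x \<in> ?p y" "y \<in> carrier M" for x y
    using F.a_repr_independence'[of x y] that by simp
  have smult: "r \<odot>\<^bsub>?Q\<^esub> ?p x = ?p (r \<odot>\<^bsub>M\<^esub> x)" if "r \<in> carrier R" "x \<in> carrier M" for r x
  proof -
    have "?p (r \<odot>\<^bsub>M\<^esub> z) = ?p (r \<odot>\<^bsub>M\<^esub> x)" if z: "z \<in> ?p x" for z
    proof -
      obtain h where h: "h \<in> F" "z = h \<oplus>\<^bsub>M\<^esub> x"
        using z by (auto simp: a_r_coset_def r_coset_def)
      then have "r \<odot>\<^bsub>M\<^esub> z = (r \<odot>\<^bsub>M\<^esub> h) \<oplus>\<^bsub>M\<^esub> (r \<odot>\<^bsub>M\<^esub> x)"
        using \<open>r \<in> carrier R\<close> \<open>x \<in> carrier M\<close> FE(1) by (auto intro!: M.smult_r_distr)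
      then have "r \<odot>\<^bsub>M\<^esub> z \<in> ?p (r \<odot>\<^bsub>M\<^esub> x)"
        using FE(4)[OF \<open>r \<in> carrier R\<close> h(1)] by (auto simp: a_r_coset_def r_coset_def)
      then show ?thesis using eq \<open>r \<in> carrier R\<close> \<open>x \<in> carrier M\<close> by simp
    qed
    moreover have "x \<in> ?p x" using F.a_rcos_self[OF \<open>x \<in> carrier M\<close>] .
    ultimately have "(\<Union>z\<in>?p x. ?p (r \<odot>\<^bsub>M\<^esub> z)) = ?p (r \<odot>\<^bsub>M\<^esub> x)" by blast
    then show ?thesis by (simp add: quotient_module_def)
  qed
  have zero: "\<zero>\<^bsub>?Q\<^esub> = ?p \<zero>\<^bsub>M\<^esub>"
    using M.add.coset_join2[OF M.zero_closed submodule.axioms(1)[OF F]] subgroup.one_closed[OF submodule.axioms(1)[OF F]]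
    by (simp add: quotient_module_def a_r_coset_def)
  have closed: "?p x \<in> carrier ?Q" if "x \<in> carrier M" for x using surj that by auto
  have "abelian_group ?Q"
  proof (rule abelian_groupI)
    fix x assume "x \<in> carrier ?Q"
    then obtain x' where "x = ?p x'" "x' \<in> carrier M" using surj by blast
    then show "\<exists>y\<in>carrier ?Q. y \<oplus>\<^bsub>?Q\<^esub> x = \<zero>\<^bsub>?Q\<^esub>"
      by (intro bexI[of _ "?p (\<ominus>\<^bsub>M\<^esub> x')"]) (auto simp: add zero closed M.l_neg)
  qed (auto simp flip: surj simp: add zero closed M.a_ac)
  then show "module R ?Q"
  proof (intro moduleI)
    show "cring R" by unfold_locales
  qed (auto simp flip: surj simp: add smult zero closed M.smult_l_distr M.smult_r_distr M.smult_assoc1)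
  show "?p \<in> module_hom R M ?Q"
    by (rule module_homI) (simp_all add: add smult closed)
qed

lemma
  assumes "module R M" "module R N" "module R M'" and f: "f \<in> module_hom R M M'"
  shows tensor_map_coset: "Poly_Mapping.keys c \<subseteq> carrier M \<times> carrier N \<Longrightarrow>
      tensor_map R M' N f (tensor_rels R M N #>\<^bsub>free_Abelian_group (carrier M \<times> carrier N)\<^esub> c) =
      tensor_rels R M' N #>\<^bsub>free_Abelian_group (carrier M' \<times> carrier N)\<^esub> frag_map2 f id c"
    and tensor_map_hom: "tensor_map R M' N f \<in> hom (tensor_product R M N) (tensor_product R M' N)"
proof -
  let ?G = "free_Abelian_group (carrier M \<times> carrier N)" and ?H = "tensor_rels R M N"
  let ?G' = "free_Abelian_group (carrier M' \<times> carrier N)" and ?H' = "tensor_rels R M' N"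
  have keys: "Poly_Mapping.keys (frag_map2 f id c) \<subseteq> carrier M' \<times> carrier N"
    if "Poly_Mapping.keys c \<subseteq> carrier M \<times> carrier N" for c
    by (rule frag_map2_keys[OF that]) (auto simp: module_homD[OF f])
  show coset: "tensor_map R M' N f (?H #>\<^bsub>?G\<^esub> c) = ?H' #>\<^bsub>?G'\<^esub> frag_map2 f id c"
    if c: "Poly_Mapping.keys c \<subseteq> carrier M \<times> carrier N" for c
  proof -
    have "?H' #>\<^bsub>?G'\<^esub> frag_map2 f id d = ?H' #>\<^bsub>?G'\<^esub> frag_map2 f id c"
      if d: "d \<in> ?H #>\<^bsub>?G\<^esub> c" for d
    proof -
      obtain h where h: "h \<in> ?H" "d = h + c" using d by (auto simp: r_coset_def)
      have kh: "Poly_Mapping.keys h \<subseteq> carrier M \<times> carrier N"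
        using tensor_rels_closed(1)[OF assms(1,2) h(1)] .
      have kd: "Poly_Mapping.keys d \<subseteq> carrier M \<times> carrier N"
        using h(2) kh c keys_add[of h c] by blast
      show ?thesis
        unfolding free_coset_eq_iff[OF tensor_rels_subgroup[OF assms(3,2)] keys[OF kd] keys[OF c]]
        using frag_map2_rels[OF assms(1,2,3,2) f id_module_hom h(1)] h(2) by simp
    qed
    moreover have "c \<in> ?H #>\<^bsub>?G\<^esub> c"
      using tensor_rels_closed(2)[OF assms(1,2)] by (force simp: r_coset_def)
    ultimately show ?thesis unfolding tensor_map_def by blast
  qed
  show "tensor_map R M' N f \<in> hom (tensor_product R M N) (tensor_product R M' N)"
  proof (rule homI)
    fix A assume "A \<in> carrier (tensor_product R M N)"
    then obtain a where a: "Poly_Mapping.keys a \<subseteq> carrier M \<times> carrier N" "A = ?H #>\<^bsub>?G\<^esub> a"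
      by (auto simp: tensor_product_def FactGroup_def RCOSETS_def)
    then show "tensor_map R M' N f A \<in> carrier (tensor_product R M' N)"
      using keys[OF a(1)] by (auto simp: tensor_product_def FactGroup_def RCOSETS_def coset)
    fix B assume "B \<in> carrier (tensor_product R M N)"
    then obtain b where b: "Poly_Mapping.keys b \<subseteq> carrier M \<times> carrier N" "B = ?H #>\<^bsub>?G\<^esub> b"
      by (auto simp: tensor_product_def FactGroup_def RCOSETS_def)
    have ab: "Poly_Mapping.keys (a + b) \<subseteq> carrier M \<times> carrier N"
      using a(1) b(1) keys_add[of a b] by blast
    have 1: "A \<otimes>\<^bsub>tensor_product R M N\<^esub> B = ?H #>\<^bsub>?G\<^esub> (a + b)"
      using normal.rcos_sum[OF tensor_rels_normal[OF assms(1,2)], of a b] a b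
      by (simp add: tensor_product_def FactGroup_def)
    have 2: "tensor_map R M' N f A \<otimes>\<^bsub>tensor_product R M' N\<^esub> tensor_map R M' N f B
        = ?H' #>\<^bsub>?G'\<^esub> (frag_map2 f id a + frag_map2 f id b)"
      using normal.rcos_sum[OF tensor_rels_normal[OF assms(3,2)], of "frag_map2 f id a" "frag_map2 f id b"]
        a b keys by (simp add: tensor_product_def FactGroup_def coset)
    show "tensor_map R M' N f (A \<otimes>\<^bsub>tensor_product R M N\<^esub> B) =
      tensor_map R M' N f A \<otimes>\<^bsub>tensor_product R M' N\<^esub> tensor_map R M' N f B"
      unfolding 1 2 coset[OF ab] by simp
  qed
qed

lemma tensor_product_group:
  assumes "module R M" "module R N"
  shows "group (tensor_product R M N)"
  unfolding tensor_product_def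
  by (rule normal.factorgroup_is_group[OF tensor_rels_normal[OF assms]])

lemma carrier_tensor_product:
  "carrier (tensor_product R M N) =
     (\<lambda>c. tensor_rels R M N #>\<^bsub>free_Abelian_group (carrier M \<times> carrier N)\<^esub> c)
       ` {c. Poly_Mapping.keys c \<subseteq> carrier M \<times> carrier N}"
  by (auto simp: tensor_product_def FactGroup_def RCOSETS_def)

lemma tensor_exact_iff:
  assumes M: "module R M" and F: "submodule F R M" and N: "module R N"
  shows "tensor_exact R M F N \<longleftrightarrow>
    (\<forall>c. Poly_Mapping.keys c \<subseteq> F \<times> carrier N \<longrightarrow> c \<in> tensor_rels R M N \<longrightarrow>
       c \<in> tensor_rels R (M\<lparr>carrier := F\<rparr>) N) \<and>
    (\<forall>d. Poly_Mapping.keys d \<subseteq> carrier M \<times> carrier N \<longrightarrow>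
       frag_map2 (\<lambda>x. F +>\<^bsub>M\<^esub> x) id d \<in> tensor_rels R (quotient_module M F) N \<longrightarrow>
       (\<exists>c. Poly_Mapping.keys c \<subseteq> F \<times> carrier N \<and> d - c \<in> tensor_rels R M N))"
    (is "_ \<longleftrightarrow> ?inj \<and> ?ker")
proof -
  let ?F = "M\<lparr>carrier := F\<rparr>" and ?Q = "quotient_module M F" and ?p = "\<lambda>x. F +>\<^bsub>M\<^esub> x"
  note FM = submodule_carrier_module[OF M F] and QM = quotient_module_module[OF M F]
  note FE = module.submoduleE[OF M F]
  note ih = incl_module_hom[OF M F] and ph = quotient_module_proj[OF M F]
  let ?i = "tensor_map R M N id" and ?q = "tensor_map R ?Q N ?p"
  let ?TF = "tensor_product R ?F N" and ?TM = "tensor_product R M N" and ?TQ = "tensor_product R ?Q N"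
  let ?cF = "\<lambda>c. tensor_rels R ?F N #>\<^bsub>free_Abelian_group (F \<times> carrier N)\<^esub> c"
  let ?cM = "\<lambda>c. tensor_rels R M N #>\<^bsub>free_Abelian_group (carrier M \<times> carrier N)\<^esub> c"
  let ?cQ = "\<lambda>c. tensor_rels R ?Q N #>\<^bsub>free_Abelian_group (carrier ?Q \<times> carrier N)\<^esub> c"
  let ?kF = "\<lambda>c. Poly_Mapping.keys c \<subseteq> F \<times> carrier N"
  let ?kM = "\<lambda>c. Poly_Mapping.keys c \<subseteq> carrier M \<times> carrier N"
  let ?kQ = "\<lambda>c. Poly_Mapping.keys c \<subseteq> carrier ?Q \<times> carrier N"
  have kFM: "?kM c" if "?kF c" for c using that FE(1) by blast
  have kMQ: "?kQ (frag_map2 ?p id c)" if "?kM c" for c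
    by (rule frag_map2_keys[OF that]) (auto simp: module_homD[OF ph])
  have cF: "carrier ?TF = ?cF ` Collect ?kF" and cM: "carrier ?TM = ?cM ` Collect ?kM"
    and cQ: "carrier ?TQ = ?cQ ` Collect ?kQ"
    using carrier_tensor_product[of R ?F N] carrier_tensor_product[of R M N]
      carrier_tensor_product[of R ?Q N] by simp_all
  have i: "?i (?cF c) = ?cM c" if "?kF c" for c
    using tensor_map_coset[OF FM N M ih] that by (simp add: frag_map2_id)
  have q: "?q (?cM c) = ?cQ (frag_map2 ?p id c)" if "?kM c" for c
    using tensor_map_coset[OF M N QM ph] that by simp
  have eqF: "?cF c = ?cF d \<longleftrightarrow> c - d \<in> tensor_rels R ?F N" if "?kF c" "?kF d" for c d
    using free_coset_eq_iff[OF tensor_rels_subgroup[OF FM N]] that by simp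
  have eqM: "?cM c = ?cM d \<longleftrightarrow> c - d \<in> tensor_rels R M N" if "?kM c" "?kM d" for c d
    using free_coset_eq_iff[OF tensor_rels_subgroup[OF M N]] that by simp
  have eqQ: "?cQ c = ?cQ d \<longleftrightarrow> c - d \<in> tensor_rels R ?Q N" if "?kQ c" "?kQ d" for c d
    using free_coset_eq_iff[OF tensor_rels_subgroup[OF QM N]] that by simp
  have oneQ: "\<one>\<^bsub>?TQ\<^esub> = ?cQ 0"
  proof -
    interpret subgroup "tensor_rels R ?Q N" "free_Abelian_group (carrier ?Q \<times> carrier N)"
      by (rule tensor_rels_subgroup[OF QM N])
    have "?cQ 0 = tensor_rels R ?Q N"
      by (auto simp: r_coset_def)
    then show ?thesis by (simp add: tensor_product_def FactGroup_def)
  qed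
  have p0: "frag_map2 ?p id c \<in> tensor_rels R ?Q N" if c: "?kF c" for c
    using c
  proof (induction c rule: frag_induction)
    case (one a)
    then obtain x n where a: "a = (x, n)" "x \<in> F" "n \<in> carrier N" by blast
    interpret M: module R M by fact
    interpret Q: module R ?Q by (rule QM)
    have xM: "x \<in> carrier M" using a FE(1) by blast
    have pz: "?p x = \<zero>\<^bsub>?Q\<^esub>"
      using M.add.coset_join2[OF xM submodule.axioms(1)[OF F] a(2)]
      by (simp add: quotient_module_def a_r_coset_def)
    let ?g = "frag_of (\<zero>\<^bsub>?Q\<^esub> \<oplus>\<^bsub>?Q\<^esub> \<zero>\<^bsub>?Q\<^esub>, n) - frag_of (\<zero>\<^bsub>?Q\<^esub>, n) - frag_of (\<zero>\<^bsub>?Q\<^esub>, n)"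
    have "?g \<in> tensor_gens R ?Q N"
      unfolding tensor_gens_def using a(3) Q.M.zero_closed by blast
    then have "- ?g \<in> tensor_rels R ?Q N"
      by (intro tensor_rels_closed(3)[OF QM N] tensor_rels_closed(6)[OF QM N])
    then show ?case using a by (simp add: pz)
  qed (use tensor_rels_closed[OF QM N] in auto)
  have inj: "inj_on ?i (carrier ?TF) \<longleftrightarrow> ?inj"
  proof
    assume L: "inj_on ?i (carrier ?TF)"
    show ?inj
    proof (intro allI impI)
      fix c assume c: "?kF c" "c \<in> tensor_rels R M N"
      have "?i (?cF c) = ?i (?cF 0)"
        using c eqM[of c 0] kFM[OF c(1)] by (simp add: i)
      moreover have "?cF c \<in> carrier ?TF" "?cF 0 \<in> carrier ?TF"
        unfolding cF by (rule imageI, use c(1) in simp)+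
      ultimately have "?cF c = ?cF 0" by (rule inj_onD[OF L])
      then show "c \<in> tensor_rels R ?F N" using eqF[of c 0] c(1) by simp
    qed
  next
    assume R: ?inj
    show "inj_on ?i (carrier ?TF)"
    proof (rule inj_onI, unfold cF, elim imageE, unfold mem_Collect_eq, clarify)
      fix c d assume kc: "?kF c" and kd: "?kF d" and e: "?i (?cF c) = ?i (?cF d)"
      have "c - d \<in> tensor_rels R M N"
        using e i[OF kc] i[OF kd] eqM[OF kFM[OF kc] kFM[OF kd]] by simp
      moreover have "?kF (c - d)" using kc kd by (rule keys_diff2)
      ultimately have "c - d \<in> tensor_rels R ?F N" using R by blast
      then show "?cF c = ?cF d" using eqF[OF kc kd] by simp
    qed
  qed
  have surj: "?q ` carrier ?TM = carrier ?TQ"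
  proof -
    have "\<exists>d. ?kM d \<and> frag_map2 ?p id d = c" if "?kQ c" for c
      using that
    proof (induction c rule: frag_induction)
      case (one a)
      then obtain x n where "a = (?p x, n)" "x \<in> carrier M" "n \<in> carrier N"
        using quotient_module_surj[OF M F] by (cases a) blast
      then show ?case by (intro exI[of _ "frag_of (x, n)"]) (simp add: keys_frag_of)
    next
      case zero show ?case by (rule exI[of _ 0]) simp
    next
      case (diff a b)
      then show ?case using keys_diff2 frag_map2_simps(4) by metis
    qed
    then have lift: "\<exists>d. ?kM d \<and> frag_map2 ?p id d = c" if "?kQ c" for c using that by blast
    show ?thesis
    proof
      show "?q ` carrier ?TM \<subseteq> carrier ?TQ"
      proof (rule image_subsetI)
        fix K assume "K \<in> carrier ?TM"
        then obtain d where "?kM d" "K = ?cM d" unfolding cM by blast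
        then show "?q K \<in> carrier ?TQ" unfolding cQ by (simp only: q) (use kMQ in blast)
      qed
      show "carrier ?TQ \<subseteq> ?q ` carrier ?TM"
      proof
        fix K assume "K \<in> carrier ?TQ"
        then obtain c where "?kQ c" "K = ?cQ c" unfolding cQ by blast
        then obtain d where "?kM d" "K = ?q (?cM d)" using lift q by metis
        then show "K \<in> ?q ` carrier ?TM" unfolding cM by blast
      qed
    qed
  qed
  have ker: "kernel ?TM ?TQ ?q = ?i ` carrier ?TF \<longleftrightarrow> ?ker"
  proof -
    have mem_ker: "?cM d \<in> kernel ?TM ?TQ ?q \<longleftrightarrow> frag_map2 ?p id d \<in> tensor_rels R ?Q N"
      if d: "?kM d" for d
    proof -
      have "?cM d \<in> carrier ?TM" unfolding cM by (rule imageI) (use d in simp)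
      then have "?cM d \<in> kernel ?TM ?TQ ?q \<longleftrightarrow> ?cQ (frag_map2 ?p id d) = ?cQ 0"
        unfolding kernel_def oneQ q[OF d, symmetric] by simp
      also have "\<dots> \<longleftrightarrow> frag_map2 ?p id d \<in> tensor_rels R ?Q N"
        using eqQ[of "frag_map2 ?p id d" 0] kMQ[OF d] by simp
      finally show ?thesis .
    qed
    have sub: "?i ` carrier ?TF \<subseteq> kernel ?TM ?TQ ?q"
    proof (rule image_subsetI)
      fix K assume "K \<in> carrier ?TF"
      then obtain c where c: "?kF c" "K = ?cF c" unfolding cF by blast
      show "?i K \<in> kernel ?TM ?TQ ?q"
        unfolding c(2) i[OF c(1)] mem_ker[OF kFM[OF c(1)]] by (rule p0[OF c(1)])
    qed
    have mem_im: "?cM d \<in> ?i ` carrier ?TF \<longleftrightarrow> (\<exists>c. ?kF c \<and> d - c \<in> tensor_rels R M N)"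
      if d: "?kM d" for d
    proof
      assume "?cM d \<in> ?i ` carrier ?TF"
      then obtain c where c: "?kF c" "?cM d = ?i (?cF c)" unfolding cF by blast
      then have "?cM d = ?cM c" by (simp only: i)
      then show "\<exists>c. ?kF c \<and> d - c \<in> tensor_rels R M N"
        using eqM[OF d kFM[OF c(1)]] c(1) by blast
    next
      assume "\<exists>c. ?kF c \<and> d - c \<in> tensor_rels R M N"
      then obtain c where c: "?kF c" "d - c \<in> tensor_rels R M N" by blast
      have "?cM d = ?i (?cF c)"
        unfolding i[OF c(1)] eqM[OF d kFM[OF c(1)]] by (rule c(2))
      moreover have "?cF c \<in> carrier ?TF" unfolding cF by (rule imageI) (use c in simp)
      ultimately show "?cM d \<in> ?i ` carrier ?TF" by (rule image_eqI)
    qed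
    show ?thesis
    proof
      assume L: "kernel ?TM ?TQ ?q = ?i ` carrier ?TF"
      show ?ker
      proof (intro allI impI)
        fix d assume d: "?kM d" "frag_map2 ?p id d \<in> tensor_rels R ?Q N"
        have "?cM d \<in> ?i ` carrier ?TF"
          unfolding L[symmetric] by (rule iffD2[OF mem_ker[OF d(1)] d(2)])
        then show "\<exists>c. ?kF c \<and> d - c \<in> tensor_rels R M N"
          by (rule iffD1[OF mem_im[OF d(1)]])
      qed
    next
      assume R: ?ker
      show "kernel ?TM ?TQ ?q = ?i ` carrier ?TF"
      proof (rule equalityI[OF subsetI sub])
        fix K assume K: "K \<in> kernel ?TM ?TQ ?q"
        then have "K \<in> carrier ?TM" by (simp add: kernel_def)
        then obtain d where d: "?kM d" "K = ?cM d" unfolding cM by blast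
        have "frag_map2 ?p id d \<in> tensor_rels R ?Q N"
          using K unfolding d(2) mem_ker[OF d(1)] .
        with R d(1) have "\<exists>c. ?kF c \<and> d - c \<in> tensor_rels R M N" by blast
        then show "K \<in> ?i ` carrier ?TF" unfolding d(2) mem_im[OF d(1)] .
      qed
    qed
  qed
  show ?thesis
    unfolding tensor_exact_def short_exact_def mon_def epi_def
    using inj surj ker tensor_map_hom[OF FM N M ih] tensor_map_hom[OF M N QM ph]
      tensor_product_group[OF FM N] tensor_product_group[OF M N] tensor_product_group[OF QM N]
    by (simp only: mem_Collect_eq simp_thms)
qed

lemma tensor_rels_finite:
  assumes M: "module R M" and N: "module R N" and c: "c \<in> tensor_rels R M N"
  shows "\<exists>A. finite A \<and> A \<subseteq> carrier N \<and>
    (\<forall>H. submodule H R N \<longrightarrow> A \<subseteq> H \<longrightarrow> c \<in> tensor_rels R M (N\<lparr>carrier := H\<rparr>))"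
    (is "?P c")
proof (rule tensor_rels_induct[OF M N c])
  note cl = tensor_rels_closed[OF M submodule_carrier_module[OF N]]
  show "?P 0" using cl(2) by blast
  have gen: "\<exists>A. finite A \<and> A \<subseteq> carrier N \<and>
    (\<forall>H. submodule H R N \<longrightarrow> A \<subseteq> H \<longrightarrow> g \<in> tensor_gens R M (N\<lparr>carrier := H\<rparr>))"
    if "g \<in> tensor_gens R M N" for g
    using that unfolding tensor_gens_def
    apply (elim UnE CollectE exE conjE)
    subgoal for x y n by (rule exI[of _ "{n}"]) auto
    subgoal for x n n' by (rule exI[of _ "{n, n'}"]) auto
    subgoal for r x n by (rule exI[of _ "{n}"]) auto
    done
  show "?P g" if "g \<in> tensor_gens R M N" for g
    using gen[OF that] cl(6) by meson
  show "?P (- g)" if "g \<in> tensor_gens R M N" for g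
    using gen[OF that] cl(6) cl(3) by meson
  show "?P (a + b)" if a: "?P a" and b: "?P b" for a b
  proof -
    obtain A B where "finite A" "A \<subseteq> carrier N" "finite B" "B \<subseteq> carrier N"
      "\<And>H. submodule H R N \<Longrightarrow> A \<subseteq> H \<Longrightarrow> a \<in> tensor_rels R M (N\<lparr>carrier := H\<rparr>)"
      "\<And>H. submodule H R N \<Longrightarrow> B \<subseteq> H \<Longrightarrow> b \<in> tensor_rels R M (N\<lparr>carrier := H\<rparr>)"
      using a b by meson
    then show ?thesis using cl(4) by (intro exI[of _ "A \<union> B"]) auto
  qed
qed

lemma finite_submodule_copy:
  fixes R :: "('a, 'r) ring_scheme" and N :: "('a, 'c, 'n) module_scheme"
  assumes N: "module R N" and A: "finite A" "A \<subseteq> carrier N"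
  shows "\<exists>H (N0 :: ('a, (nat \<Rightarrow> 'a) set) module) s t. submodule H R N \<and> A \<subseteq> H \<and> module R N0 \<and>
    s \<in> module_hom R (N\<lparr>carrier := H\<rparr>) N0 \<and> t \<in> module_hom R N0 N \<and> (\<forall>n\<in>H. t (s n) = n)"
proof -
  interpret N: module R N by fact
  obtain a and k :: nat where a: "A = a ` {..<k}"
    using finite_imp_nat_seg_image_inj_on[OF A(1)] unfolding lessThan_def by metis
  have ac: "a i \<in> carrier N" if "i < k" for i using A a that by auto
  define lc where "lc c = (\<Oplus>\<^bsub>N\<^esub>i\<in>{..<k}. c i \<odot>\<^bsub>N\<^esub> a i)" for c
  let ?C = "{c. range c \<subseteq> carrier R}"
  define H where "H = lc ` ?C"
  have cc: "c i \<in> carrier R" if "c \<in> ?C" for c :: "nat \<Rightarrow> 'a" and i using that by auto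
  have lcc: "lc c \<in> carrier N" if "c \<in> ?C" for c
    unfolding lc_def using cc[OF that] ac by (auto intro!: N.M.finsum_closed)
  have lc_add: "lc (\<lambda>i. c i \<oplus>\<^bsub>R\<^esub> d i) = lc c \<oplus>\<^bsub>N\<^esub> lc d" if "c \<in> ?C" "d \<in> ?C" for c d
  proof -
    have "lc c \<oplus>\<^bsub>N\<^esub> lc d = (\<Oplus>\<^bsub>N\<^esub>i\<in>{..<k}. c i \<odot>\<^bsub>N\<^esub> a i \<oplus>\<^bsub>N\<^esub> d i \<odot>\<^bsub>N\<^esub> a i)"
      unfolding lc_def using cc[OF that(1)] cc[OF that(2)] ac by (subst N.M.finsum_addf) auto
    also have "\<dots> = lc (\<lambda>i. c i \<oplus>\<^bsub>R\<^esub> d i)"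
      unfolding lc_def using cc[OF that(1)] cc[OF that(2)] ac
      by (intro N.M.finsum_cong') (auto simp: N.smult_l_distr)
    finally show ?thesis by simp
  qed
  have lc_smult: "lc (\<lambda>i. r \<otimes>\<^bsub>R\<^esub> c i) = r \<odot>\<^bsub>N\<^esub> lc c" if "r \<in> carrier R" "c \<in> ?C" for r c
  proof -
    have "r \<odot>\<^bsub>N\<^esub> lc c = (\<Oplus>\<^bsub>N\<^esub>i\<in>{..<k}. r \<odot>\<^bsub>N\<^esub> (c i \<odot>\<^bsub>N\<^esub> a i))"
      unfolding lc_def using cc[OF that(2)] ac that(1) by (subst N.finsum_smult_ldistr) auto
    also have "\<dots> = lc (\<lambda>i. r \<otimes>\<^bsub>R\<^esub> c i)"
      unfolding lc_def using cc[OF that(2)] ac that(1)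
      by (intro N.M.finsum_cong') (auto simp: N.smult_assoc1)
    finally show ?thesis by simp
  qed
  have addH: "x \<oplus>\<^bsub>N\<^esub> y \<in> H" if xy: "x \<in> H" "y \<in> H" for x y
  proof -
    obtain c d where cd: "c \<in> ?C" "d \<in> ?C" "x = lc c" "y = lc d" using xy unfolding H_def by blast
    have "(\<lambda>i. c i \<oplus>\<^bsub>R\<^esub> d i) \<in> ?C" using cc[OF cd(1)] cc[OF cd(2)] by auto
    then show ?thesis unfolding H_def cd lc_add[OF cd(1,2), symmetric] by blast
  qed
  have smultH: "r \<odot>\<^bsub>N\<^esub> x \<in> H" if rx: "r \<in> carrier R" "x \<in> H" for r x
  proof -
    obtain c where c: "c \<in> ?C" "x = lc c" using rx unfolding H_def by blast
    have "(\<lambda>i. r \<otimes>\<^bsub>R\<^esub> c i) \<in> ?C" using cc[OF c(1)] that(1) by auto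
    then show ?thesis unfolding H_def c lc_smult[OF that(1) c(1), symmetric] by blast
  qed
  have Hc: "H \<subseteq> carrier N" using lcc unfolding H_def by blast
  have "(\<lambda>i. \<zero>\<^bsub>R\<^esub>) \<in> ?C" by auto
  moreover from this have "lc (\<lambda>i. \<zero>\<^bsub>R\<^esub>) = \<zero>\<^bsub>N\<^esub>"
    using lc_smult[of "\<zero>\<^bsub>R\<^esub>" "\<lambda>i. \<zero>\<^bsub>R\<^esub>"] lcc by simp
  ultimately have zeroH: "\<zero>\<^bsub>N\<^esub> \<in> H" unfolding H_def by force
  have subH: "submodule H R N"
  proof (rule N.submoduleI[OF Hc zeroH])
    fix x assume x: "x \<in> H"
    then have "\<ominus>\<^bsub>N\<^esub> x = (\<ominus>\<^bsub>R\<^esub> \<one>\<^bsub>R\<^esub>) \<odot>\<^bsub>N\<^esub> x"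
      using Hc by (subst N.smult_l_minus) auto
    then show "\<ominus>\<^bsub>N\<^esub> x \<in> H" using smultH[OF _ x] by simp
  qed (use addH smultH in auto)
  have AH: "A \<subseteq> H"
  proof
    fix x assume "x \<in> A"
    then obtain j where j: "j < k" "x = a j" using a by blast
    let ?d = "\<lambda>i. if i = j then \<one>\<^bsub>R\<^esub> else \<zero>\<^bsub>R\<^esub>"
    have "lc ?d = (\<Oplus>\<^bsub>N\<^esub>i\<in>{..<k}. if j = i then a i else \<zero>\<^bsub>N\<^esub>)"
      unfolding lc_def using ac by (intro N.M.finsum_cong') auto
    also have "\<dots> = a j" using j ac by (intro N.M.finsum_singleton) auto
    finally have "x = lc ?d" using j by simp
    then show "x \<in> H" unfolding H_def by auto
  qed
  define s where "s n = {c \<in> ?C. lc c = n}" for n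
  define t where "t K = lc (SOME c. c \<in> K)" for K
  have ts: "t (s n) = n" if "n \<in> H" for n
  proof -
    have "\<exists>c. c \<in> s n" using that unfolding H_def s_def by blast
    then have "(SOME c. c \<in> s n) \<in> s n" by (rule someI_ex)
    then show ?thesis unfolding t_def s_def by blast
  qed
  define N0 :: "('a, (nat \<Rightarrow> 'a) set) module" where
    "N0 = \<lparr>carrier = s ` H, monoid.mult = undefined, monoid.one = undefined, ring.zero = s \<zero>\<^bsub>N\<^esub>,
      ring.add = (\<lambda>K L. s (t K \<oplus>\<^bsub>N\<^esub> t L)), smult = (\<lambda>r K. s (r \<odot>\<^bsub>N\<^esub> t K))\<rparr>"
  have N0: "carrier N0 = s ` H" "\<zero>\<^bsub>N0\<^esub> = s \<zero>\<^bsub>N\<^esub>" "K \<oplus>\<^bsub>N0\<^esub> L = s (t K \<oplus>\<^bsub>N\<^esub> t L)"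
    "r \<odot>\<^bsub>N0\<^esub> K = s (r \<odot>\<^bsub>N\<^esub> t K)" for K L r
    by (simp_all add: N0_def)
  have Hcc: "x \<in> carrier N" if "x \<in> H" for x using Hc that by blast
  have minusH: "\<ominus>\<^bsub>N\<^esub> x \<in> H" if "x \<in> H" for x using N.submoduleE(3)[OF subH that] .
  have "abelian_group N0"
  proof (rule abelian_groupI)
    fix K assume "K \<in> carrier N0"
    then obtain x where "x \<in> H" "K = s x" by (auto simp: N0)
    then show "\<exists>L\<in>carrier N0. L \<oplus>\<^bsub>N0\<^esub> K = \<zero>\<^bsub>N0\<^esub>"
      by (intro bexI[of _ "s (\<ominus>\<^bsub>N\<^esub> x)"]) (auto simp: N0 ts minusH Hcc N.M.l_neg)
  qed (auto simp: N0 ts addH zeroH Hcc N.M.a_ac)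
  then have "module R N0"
  proof (intro moduleI)
    show "cring R" by unfold_locales
  qed (auto simp: N0 ts addH smultH Hcc N.smult_l_distr N.smult_r_distr N.smult_assoc1)
  moreover have "s \<in> module_hom R (N\<lparr>carrier := H\<rparr>) N0"
    by (rule module_homI) (auto simp: N0 ts)
  moreover have "t \<in> module_hom R N0 N"
    by (rule module_homI) (auto simp: N0 ts addH smultH Hcc)
  ultimately show ?thesis using subH AH ts by blast
qed

theorem pure_submodule_tensor_exact:
  fixes R :: "('a, 'r) ring_scheme" and M :: "('a, 'b, 'm) module_scheme"
    and N :: "('a, 'c, 'n) module_scheme"
  assumes M: "module R M" and pure: "pure_submodule R M F" and N: "module R N"
  shows "tensor_exact R M F N"
proof -
  have F: "submodule F R M" using pure by (simp add: pure_submodule_def)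
  let ?F = "M\<lparr>carrier := F\<rparr>" and ?Q = "quotient_module M F" and ?p = "\<lambda>x. F +>\<^bsub>M\<^esub> x"
  note FM = submodule_carrier_module[OF M F] and QM = quotient_module_module[OF M F]
  note FE = module.submoduleE[OF M F]
  have test: "tensor_exact R M F N0" if "module R N0" for N0 :: "('a, (nat \<Rightarrow> 'a) set) module"
    using pure that by (simp add: pure_submodule_def)
  show ?thesis
    unfolding tensor_exact_iff[OF M F N]
  proof (intro conjI allI impI)
    fix c assume c: "Poly_Mapping.keys c \<subseteq> F \<times> carrier N" "c \<in> tensor_rels R M N"
    obtain A where A: "finite A" "A \<subseteq> carrier N"
      "\<And>H. submodule H R N \<Longrightarrow> A \<subseteq> H \<Longrightarrow> c \<in> tensor_rels R M (N\<lparr>carrier := H\<rparr>)"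
      using tensor_rels_finite[OF M N c(2)] by meson
    have "finite (A \<union> snd ` Poly_Mapping.keys c)" "A \<union> snd ` Poly_Mapping.keys c \<subseteq> carrier N"
      using A c(1) by auto
    from finite_submodule_copy[OF N this]
    obtain H s t and N0 :: "('a, (nat \<Rightarrow> 'a) set) module" where
      H: "submodule H R N" "A \<union> snd ` Poly_Mapping.keys c \<subseteq> H" and N0: "module R N0"
      and s: "s \<in> module_hom R (N\<lparr>carrier := H\<rparr>) N0" and t: "t \<in> module_hom R N0 N"
      and ts: "\<And>n. n \<in> H \<Longrightarrow> t (s n) = n" by blast
    note HM = submodule_carrier_module[OF N H(1)]
    have kc: "Poly_Mapping.keys c \<subseteq> F \<times> H" using c(1) H(2) by force
    have "frag_map2 id s c \<in> tensor_rels R M N0"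
      using frag_map2_rels[OF M HM M N0 id_module_hom s] A(3) H by blast
    moreover have "Poly_Mapping.keys (frag_map2 id s c) \<subseteq> F \<times> carrier N0"
      by (rule frag_map2_keys[OF kc]) (use module_homD(1)[OF s] in auto)
    ultimately have "frag_map2 id s c \<in> tensor_rels R ?F N0"
      using test[OF N0] unfolding tensor_exact_iff[OF M F N0] by blast
    then have "frag_map2 id t (frag_map2 id s c) \<in> tensor_rels R ?F N"
      by (rule frag_map2_rels[OF FM N0 FM N id_module_hom t])
    also have "frag_map2 id t (frag_map2 id s c) = frag_map2 id id c"
      unfolding frag_map2_comp by (rule frag_map2_cong[OF kc]) (auto simp: ts)
    finally show "c \<in> tensor_rels R ?F N" by (simp add: frag_map2_id)
  next
    fix d assume d: "Poly_Mapping.keys d \<subseteq> carrier M \<times> carrier N"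
      "frag_map2 ?p id d \<in> tensor_rels R ?Q N"
    obtain A where A: "finite A" "A \<subseteq> carrier N"
      "\<And>H. submodule H R N \<Longrightarrow> A \<subseteq> H \<Longrightarrow> frag_map2 ?p id d \<in> tensor_rels R ?Q (N\<lparr>carrier := H\<rparr>)"
      using tensor_rels_finite[OF QM N d(2)] by meson
    have "finite (A \<union> snd ` Poly_Mapping.keys d)" "A \<union> snd ` Poly_Mapping.keys d \<subseteq> carrier N"
      using A d(1) by auto
    from finite_submodule_copy[OF N this]
    obtain H s t and N0 :: "('a, (nat \<Rightarrow> 'a) set) module" where
      H: "submodule H R N" "A \<union> snd ` Poly_Mapping.keys d \<subseteq> H" and N0: "module R N0"
      and s: "s \<in> module_hom R (N\<lparr>carrier := H\<rparr>) N0" and t: "t \<in> module_hom R N0 N"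
      and ts: "\<And>n. n \<in> H \<Longrightarrow> t (s n) = n" by blast
    note HM = submodule_carrier_module[OF N H(1)]
    have kd: "Poly_Mapping.keys d \<subseteq> carrier M \<times> H" using d(1) H(2) by force
    have "frag_map2 id s (frag_map2 ?p id d) \<in> tensor_rels R ?Q N0"
      using frag_map2_rels[OF QM HM QM N0 id_module_hom s] A(3) H by blast
    also have "frag_map2 id s (frag_map2 ?p id d) = frag_map2 ?p id (frag_map2 id s d)"
      by (simp add: frag_map2_comp comp_def)
    finally have "frag_map2 ?p id (frag_map2 id s d) \<in> tensor_rels R ?Q N0" .
    moreover have "Poly_Mapping.keys (frag_map2 id s d) \<subseteq> carrier M \<times> carrier N0"
      by (rule frag_map2_keys[OF kd]) (use module_homD(1)[OF s] in auto)
    ultimately obtain c where c: "Poly_Mapping.keys c \<subseteq> F \<times> carrier N0"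
        "frag_map2 id s d - c \<in> tensor_rels R M N0"
      using test[OF N0] unfolding tensor_exact_iff[OF M F N0] by blast
    have "frag_map2 id t (frag_map2 id s d - c) \<in> tensor_rels R M N"
      by (rule frag_map2_rels[OF M N0 M N id_module_hom t c(2)])
    moreover have "frag_map2 id t (frag_map2 id s d) = frag_map2 id id d"
      unfolding frag_map2_comp by (rule frag_map2_cong[OF kd]) (auto simp: ts)
    moreover have "Poly_Mapping.keys (frag_map2 id t c) \<subseteq> F \<times> carrier N"
      by (rule frag_map2_keys[OF c(1)]) (use module_homD(1)[OF t] in auto)
    ultimately show "\<exists>c. Poly_Mapping.keys c \<subseteq> F \<times> carrier N \<and> d - c \<in> tensor_rels R M N"
      by (auto simp: frag_map2_id)
  qed
qed

end

theory Submission
  imports Defs "HOL-Combinatorics.Permutations"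
begin

text \<open>
  The \<^emph>\<open>type\<close> of a nonzero element \<open>u\<close> of a uniserial module \<open>U\<close> is the pair \<open>(A, B)\<close> of its
  annihilator \<open>A\<close> and the set \<open>B\<close> of all scalars \<open>r\<close> with \<open>u \<notin> rU\<close>; over a valuation ring both
  are proper ideals. A back-and-forth argument (\<open>isomorphic_if_common_type\<close>) shows that two
  countably generated uniserial modules with a common type are isomorphic, so the isomorphism
  class of such a module is determined by any one of its types. The factors in question are
  countably generated because the kernel of a map with uniserial image inherits countable
  generation when the kernel is pure (\<open>countably_generated_kernel\<close>). It therefore suffices that, for
  each pair \<open>(A, B)\<close>, both series have the same number of factors possessing the type \<open>(A, B)\<close>;
  this is \<open>card_factors_of_type_le\<close>, applied in both directions, and it is the heart of the matter.

  An element has type \<open>(A, B)\<close> if it lies in every \<^emph>\<open>window\<close> \<open>sM \<inter> M[a]\<close> with \<open>a \<in> A\<close>, \<open>s \<notin> B\<close>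
  (where \<open>M[a]\<close> denotes the elements killed by \<open>a\<close>), and in no \<open>M[r] + bM\<close> with \<open>r \<notin> A\<close>, \<open>b \<in> B\<close>.
  Each of these subgroups behaves well along a pure exact sequence, but infinitely many windows
  cannot be lifted simultaneously: an element of type \<open>(A, B)\<close> of a pure quotient need not lift to an
  element in all the windows of \<open>M\<close>. Hence the dimension of (intersection of the windows) modulo
  (negligible elements) is not additive, and elements must be replaced by approximations, one for
  each window.

  Let \<open>v \<in> T\<^sub>j\<close> have type \<open>(A, B)\<close> modulo \<open>T\<^sub>j\<^sub>-\<^sub>1\<close>, and choose \<open>k\<close> least such that every window of
  \<open>S\<^sub>k\<close> contains an element that agrees with \<open>v\<close> modulo \<open>T\<^sub>j\<^sub>-\<^sub>1\<close> and negligible elements. Some window of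
  \<open>S\<^sub>k\<^sub>-\<^sub>1\<close> contains no such element. In windows of \<open>S\<^sub>k\<close> below that one, any two approximations of \<open>v\<close> are
  multiples of each other modulo \<open>S\<^sub>k\<^sub>-\<^sub>1\<close>: if \<open>y \<equiv> cx\<close> with \<open>c\<close> a non-unit, then \<open>1 - c\<close> is a unit and
  \<open>y - cx\<close>, up to that unit, approximates \<open>v\<close> from within \<open>S\<^sub>k\<^sub>-\<^sub>1\<close>. So all of them represent one element of
  \<open>S\<^sub>k/S\<^sub>k\<^sub>-\<^sub>1\<close> up to units, that element lies in all windows at once, and it has type \<open>(A, B)\<close>
  (\<open>approximation_has_type\<close>). Finally \<open>j \<mapsto> k\<close> is injective: if \<open>i < j\<close> led to the same \<open>k\<close>, then
  combining the approximations for \<open>i\<close>, which are negligible for \<open>j\<close>, with those for \<open>j\<close> would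
  approximate the element belonging to \<open>j\<close> from within \<open>S\<^sub>k\<^sub>-\<^sub>1\<close> (\<open>approximation_levels_distinct\<close>).

  Purity enters only through the consequence \<open>rM \<inter> F = rF\<close> (\<open>pure_submodule_divisible\<close>), and all of the
  argument takes place inside \<open>M\<close>, with congruences modulo submodules in place of quotients.
\<close>

section \<open>Congruences in a module over a valuation ring\<close>

locale valuation_module = module R M for R (structure) and M (structure) +
  assumes divides_total: "\<lbrakk>a \<in> carrier R; b \<in> carrier R\<rbrakk> \<Longrightarrow>
    (\<exists>c\<in>carrier R. a = b \<otimes> c) \<or> (\<exists>c\<in>carrier R. b = a \<otimes> c)"
begin

definition congruent_mod :: "'c set \<Rightarrow> 'c \<Rightarrow> 'c \<Rightarrow> bool" where
  "congruent_mod N x y \<longleftrightarrow> x \<in> carrier M \<and> y \<in> carrier M \<and> x \<ominus>\<^bsub>M\<^esub> y \<in> N"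

lemma submodule_closed:
  assumes "submodule N R M"
  shows "x \<in> N \<Longrightarrow> x \<in> carrier M" and "\<zero>\<^bsub>M\<^esub> \<in> N"
    and "x \<in> N \<Longrightarrow> \<ominus>\<^bsub>M\<^esub> x \<in> N"
    and "\<lbrakk>x \<in> N; y \<in> N\<rbrakk> \<Longrightarrow> x \<oplus>\<^bsub>M\<^esub> y \<in> N"
    and "\<lbrakk>x \<in> N; y \<in> N\<rbrakk> \<Longrightarrow> x \<ominus>\<^bsub>M\<^esub> y \<in> N"
    and "\<lbrakk>r \<in> carrier R; x \<in> N\<rbrakk> \<Longrightarrow> r \<odot>\<^bsub>M\<^esub> x \<in> N"
proof -
  interpret N: submodule N R M by fact
  show "x \<in> N \<Longrightarrow> x \<in> carrier M" for x using N.subset by auto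
  show "\<zero>\<^bsub>M\<^esub> \<in> N" using N.one_closed by simp
  show i: "x \<in> N \<Longrightarrow> \<ominus>\<^bsub>M\<^esub> x \<in> N" for x using N.m_inv_closed by (simp add: a_inv_def)
  show a: "\<lbrakk>x \<in> N; y \<in> N\<rbrakk> \<Longrightarrow> x \<oplus>\<^bsub>M\<^esub> y \<in> N" for x y using N.m_closed by simp
  show "\<lbrakk>x \<in> N; y \<in> N\<rbrakk> \<Longrightarrow> x \<ominus>\<^bsub>M\<^esub> y \<in> N" using i a by (simp add: M.minus_eq)
  show "\<lbrakk>r \<in> carrier R; x \<in> N\<rbrakk> \<Longrightarrow> r \<odot>\<^bsub>M\<^esub> x \<in> N" using N.smult_closed by simp
qed

lemma submodule_if_closed:
  assumes "N \<subseteq> carrier M" "\<zero>\<^bsub>M\<^esub> \<in> N" "\<And>x y. \<lbrakk>x \<in> N; y \<in> N\<rbrakk> \<Longrightarrow> x \<oplus>\<^bsub>M\<^esub> y \<in> N"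
    and "\<And>r x. \<lbrakk>r \<in> carrier R; x \<in> N\<rbrakk> \<Longrightarrow> r \<odot>\<^bsub>M\<^esub> x \<in> N"
  shows "submodule N R M"
proof (rule submoduleI)
  show "\<ominus>\<^bsub>M\<^esub> x \<in> N" if "x \<in> N" for x
  proof -
    have "\<ominus>\<^bsub>M\<^esub> x = (\<ominus> \<one>) \<odot>\<^bsub>M\<^esub> x" using that assms(1) by (subst smult_l_minus) auto
    then show ?thesis using assms(4)[OF _ that] by simp
  qed
qed (use assms in auto)

lemma submodule_carrier: "submodule (carrier M) R M"
  by (rule submodule_if_closed) auto

lemma minus_zero: "\<ominus>\<^bsub>M\<^esub> \<zero>\<^bsub>M\<^esub> = \<zero>\<^bsub>M\<^esub>"
  using M.r_neg[of "\<zero>\<^bsub>M\<^esub>"] M.l_zero[of "\<ominus>\<^bsub>M\<^esub> \<zero>\<^bsub>M\<^esub>"] by simp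

lemma smult_diff_right:
  assumes "a \<in> carrier R" "x \<in> carrier M" "y \<in> carrier M"
  shows "a \<odot>\<^bsub>M\<^esub> (x \<ominus>\<^bsub>M\<^esub> y) = a \<odot>\<^bsub>M\<^esub> x \<ominus>\<^bsub>M\<^esub> a \<odot>\<^bsub>M\<^esub> y"
  using assms by (simp add: M.minus_eq smult_r_distr smult_r_minus)

lemma smult_diff_left:
  assumes "a \<in> carrier R" "b \<in> carrier R" "x \<in> carrier M"
  shows "(a \<ominus> b) \<odot>\<^bsub>M\<^esub> x = a \<odot>\<^bsub>M\<^esub> x \<ominus>\<^bsub>M\<^esub> b \<odot>\<^bsub>M\<^esub> x"
  using assms by (simp add: M.minus_eq R.minus_eq smult_l_distr smult_l_minus)

lemma smult_left_commute:
  "\<lbrakk>a \<in> carrier R; b \<in> carrier R; x \<in> carrier M\<rbrakk> \<Longrightarrow> a \<odot>\<^bsub>M\<^esub> (b \<odot>\<^bsub>M\<^esub> x) = b \<odot>\<^bsub>M\<^esub> (a \<odot>\<^bsub>M\<^esub> x)"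
  by (simp flip: smult_assoc1 add: m_comm)

lemma congruent_carrier:
  "congruent_mod N x y \<Longrightarrow> x \<in> carrier M" "congruent_mod N x y \<Longrightarrow> y \<in> carrier M"
  by (auto simp: congruent_mod_def)

lemma congruent_mono: "\<lbrakk>congruent_mod N x y; N \<subseteq> N'\<rbrakk> \<Longrightarrow> congruent_mod N' x y"
  by (auto simp: congruent_mod_def)

context
  fixes N assumes N: "submodule N R M"
begin

lemma congruent_refl: "x \<in> carrier M \<Longrightarrow> congruent_mod N x x"
  using submodule_closed(2)[OF N] by (simp add: congruent_mod_def M.minus_eq M.r_neg)

lemma congruent_sym:
  assumes "congruent_mod N x y" shows "congruent_mod N y x"
proof -
  have "y \<ominus>\<^bsub>M\<^esub> x = \<ominus>\<^bsub>M\<^esub> (x \<ominus>\<^bsub>M\<^esub> y)"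
    using assms by (simp add: congruent_mod_def M.minus_eq M.minus_add M.a_comm)
  then show ?thesis using assms submodule_closed(3)[OF N] by (auto simp: congruent_mod_def)
qed

lemma congruent_trans [trans]:
  assumes "congruent_mod N x y" "congruent_mod N y z" shows "congruent_mod N x z"
proof -
  have "x \<ominus>\<^bsub>M\<^esub> z = (x \<ominus>\<^bsub>M\<^esub> y) \<oplus>\<^bsub>M\<^esub> (y \<ominus>\<^bsub>M\<^esub> z)"
    using assms by (simp add: congruent_mod_def M.minus_eq M.a_assoc M.r_neg1)
  then show ?thesis using assms submodule_closed(4)[OF N] by (auto simp: congruent_mod_def)
qed

lemma congruent_add:
  assumes "congruent_mod N x y" "congruent_mod N x' y'"
  shows "congruent_mod N (x \<oplus>\<^bsub>M\<^esub> x') (y \<oplus>\<^bsub>M\<^esub> y')"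
proof -
  have "(x \<oplus>\<^bsub>M\<^esub> x') \<ominus>\<^bsub>M\<^esub> (y \<oplus>\<^bsub>M\<^esub> y') = (x \<ominus>\<^bsub>M\<^esub> y) \<oplus>\<^bsub>M\<^esub> (x' \<ominus>\<^bsub>M\<^esub> y')"
    using assms by (simp add: congruent_mod_def M.minus_eq M.minus_add M.a_ac)
  then show ?thesis using assms submodule_closed(4)[OF N] by (auto simp: congruent_mod_def)
qed

lemma congruent_smult:
  assumes "r \<in> carrier R" "congruent_mod N x y"
  shows "congruent_mod N (r \<odot>\<^bsub>M\<^esub> x) (r \<odot>\<^bsub>M\<^esub> y)"
  using assms submodule_closed(6)[OF N] by (auto simp: congruent_mod_def simp flip: smult_diff_right)

lemma congruent_diff:
  assumes "congruent_mod N x y" "congruent_mod N x' y'"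
  shows "congruent_mod N (x \<ominus>\<^bsub>M\<^esub> x') (y \<ominus>\<^bsub>M\<^esub> y')"
proof -
  have "congruent_mod N (\<ominus>\<^bsub>M\<^esub> x') (\<ominus>\<^bsub>M\<^esub> y')"
    using congruent_smult[OF _ assms(2), of "\<ominus> \<one>"] congruent_carrier[OF assms(2)]
    by (simp add: smult_l_minus)
  then show ?thesis using congruent_add[OF assms(1)] by (simp add: M.minus_eq)
qed

lemma congruent_zero_iff: "x \<in> carrier M \<Longrightarrow> congruent_mod N x \<zero>\<^bsub>M\<^esub> \<longleftrightarrow> x \<in> N"
  by (simp add: congruent_mod_def M.minus_eq minus_zero)

lemma congruent_mem_iff:
  assumes "congruent_mod N x y" shows "x \<in> N \<longleftrightarrow> y \<in> N"
  using congruent_trans[OF assms] congruent_trans[OF congruent_sym[OF assms]]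
    congruent_zero_iff congruent_carrier[OF assms] by blast

lemma congruent_diff_mem:
  assumes "x \<in> carrier M" "y \<in> N" shows "congruent_mod N (x \<ominus>\<^bsub>M\<^esub> y) x"
  using congruent_diff[OF congruent_refl[OF assms(1)], of y "\<zero>\<^bsub>M\<^esub>"] assms submodule_closed(1)[OF N]
  by (simp add: congruent_zero_iff M.minus_eq minus_zero)

lemma unit_smult_mem_iff:
  assumes "c \<in> Units R" "x \<in> carrier M"
  shows "c \<odot>\<^bsub>M\<^esub> x \<in> N \<longleftrightarrow> x \<in> N"
proof
  assume "c \<odot>\<^bsub>M\<^esub> x \<in> N"
  then have "inv c \<odot>\<^bsub>M\<^esub> (c \<odot>\<^bsub>M\<^esub> x) \<in> N" using assms submodule_closed(6)[OF N] by simp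
  then show "x \<in> N" using assms by (simp flip: smult_assoc1 add: Units_closed)
qed (use assms submodule_closed(6)[OF N] in auto)

lemma congruent_unit_solve:
  assumes "c \<in> Units R" "congruent_mod N y (c \<odot>\<^bsub>M\<^esub> x)" "x \<in> carrier M"
  shows "congruent_mod N x (inv c \<odot>\<^bsub>M\<^esub> y)"
proof -
  have "inv c \<odot>\<^bsub>M\<^esub> (c \<odot>\<^bsub>M\<^esub> x) = x" using assms by (simp flip: smult_assoc1 add: Units_closed)
  then show ?thesis using congruent_sym[OF congruent_smult[OF _ assms(2), of "inv c"]] assms(1) by simp
qed

end

lemma unit_or_one_minus_unit:
  assumes c: "c \<in> carrier R"
  shows "c \<in> Units R \<or> \<one> \<ominus> c \<in> Units R"
proof -
  let ?d = "\<one> \<ominus> c"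
  have one: "\<one> = c \<oplus> ?d" "\<one> = ?d \<oplus> c"
    using c R.a_lcomm[of c \<one> "\<ominus> c"] R.a_comm[of c "\<one> \<ominus> c"] by (simp_all add: R.minus_eq R.r_neg)
  have *: "b \<in> Units R"
    if ab: "a \<in> carrier R" "b \<in> carrier R" "e \<in> carrier R" "a = b \<otimes> e" "\<one> = a \<oplus> b" for a b e
  proof -
    have "b \<otimes> (e \<oplus> \<one>) = b \<otimes> e \<oplus> b" using ab(1-3) by (simp add: r_distr)
    then have "b \<otimes> (e \<oplus> \<one>) = \<one>" by (simp only: ab(4,5))
    then show ?thesis using ab(1-3) unfolding Units_def by (intro CollectI conjI bexI[of _ "e \<oplus> \<one>"]) (auto simp: m_comm)
  qed
  have d: "?d \<in> carrier R" using c by simp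
  show ?thesis using divides_total[OF c d] *[OF c d _ _ one(1)] *[OF d c _ _ one(2)] by blast
qed

text \<open>
  If two approximations of \<open>v\<close> are proportional up to \<open>H\<close> by a non-unit \<open>c\<close>, then \<open>1 - c\<close> is a unit
  and \<open>(1 - c)v\<close>, hence \<open>v\<close> itself, is approximated from within \<open>H\<close>. Since \<open>H\<close> will be chosen to
  contain no approximation, this is the source of all uniqueness below.
\<close>

lemma unit_or_approximated:
  assumes Q: "submodule Q R M" and H: "submodule H R M" and c: "c \<in> carrier R"
    and x: "congruent_mod Q v x" and y: "congruent_mod Q v y" and diff: "y \<ominus>\<^bsub>M\<^esub> c \<odot>\<^bsub>M\<^esub> x \<in> H"
  shows "c \<in> Units R \<or> (\<exists>h\<in>H. congruent_mod Q v h)"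
proof (rule disjCI)
  assume no: "\<not> (\<exists>h\<in>H. congruent_mod Q v h)"
  have vM: "v \<in> carrier M" using congruent_carrier x by blast
  show "c \<in> Units R"
  proof (rule ccontr)
    assume "c \<notin> Units R"
    then have u: "\<one> \<ominus> c \<in> Units R" using unit_or_one_minus_unit c by blast
    have "congruent_mod Q (v \<ominus>\<^bsub>M\<^esub> c \<odot>\<^bsub>M\<^esub> v) (y \<ominus>\<^bsub>M\<^esub> c \<odot>\<^bsub>M\<^esub> x)"
      by (rule congruent_diff[OF Q y congruent_smult[OF Q c x]])
    moreover have "v \<ominus>\<^bsub>M\<^esub> c \<odot>\<^bsub>M\<^esub> v = (\<one> \<ominus> c) \<odot>\<^bsub>M\<^esub> v"
      using smult_diff_left[of \<one> c v] c vM by simp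
    ultimately have "congruent_mod Q (y \<ominus>\<^bsub>M\<^esub> c \<odot>\<^bsub>M\<^esub> x) ((\<one> \<ominus> c) \<odot>\<^bsub>M\<^esub> v)"
      using congruent_sym[OF Q] by simp
    from congruent_unit_solve[OF Q u this vM] no submodule_closed(6)[OF H _ diff] u
    show False by blast
  qed
qed

section \<open>Uniserial factors and types relative to a submodule\<close>

definition uniserial_factor :: "'c set \<Rightarrow> 'c set \<Rightarrow> bool" where
  "uniserial_factor L N \<longleftrightarrow> (\<forall>x\<in>L. \<forall>y\<in>L.
     (\<exists>c\<in>carrier R. congruent_mod N x (c \<odot>\<^bsub>M\<^esub> y)) \<or> (\<exists>c\<in>carrier R. congruent_mod N y (c \<odot>\<^bsub>M\<^esub> x)))"

text \<open>
  Relative divisibility, also called RD-purity; over a valuation ring it is equivalent to purity.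
\<close>

definition relatively_divisible :: "'c set \<Rightarrow> 'c set \<Rightarrow> bool" where
  "relatively_divisible N L \<longleftrightarrow> submodule N R M \<and> submodule L R M \<and> N \<subseteq> L \<and>
     (\<forall>r\<in>carrier R. \<forall>z\<in>L. r \<odot>\<^bsub>M\<^esub> z \<in> N \<longrightarrow> (\<exists>y\<in>N. r \<odot>\<^bsub>M\<^esub> z = r \<odot>\<^bsub>M\<^esub> y))"

text \<open>
  The type of the class of \<open>w\<close> in \<open>L/N\<close>, expressed in \<open>M\<close>.
\<close>

definition type_at :: "'c set \<Rightarrow> 'c set \<Rightarrow> 'c \<Rightarrow> 'a set \<Rightarrow> 'a set \<Rightarrow> bool" where
  "type_at L N w A B \<longleftrightarrow> w \<in> L \<and> w \<notin> N \<and> A = {r \<in> carrier R. r \<odot>\<^bsub>M\<^esub> w \<in> N} \<and>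
     B = {r \<in> carrier R. \<forall>z\<in>L. \<not> congruent_mod N w (r \<odot>\<^bsub>M\<^esub> z)}"

text \<open>
  Over a valuation ring these are exactly the proper ideals: closure under addition follows from
  closure under multiples, since of two elements one is a multiple of the other.
\<close>

definition proper_cut :: "'a set \<Rightarrow> bool" where
  "proper_cut C \<longleftrightarrow> C \<subseteq> carrier R \<and> \<zero> \<in> C \<and> \<one> \<notin> C \<and> (\<forall>c\<in>C. \<forall>r\<in>carrier R. c \<otimes> r \<in> C)"

lemma proper_cut_dvd:
  assumes "proper_cut C" "c \<in> C" "r \<in> carrier R" "r \<notin> C"
  shows "\<exists>e\<in>carrier R. c = r \<otimes> e"
  using assms divides_total[of c r] unfolding proper_cut_def by blast

lemma type_at_proper_cuts:
  assumes L: "submodule L R M" and N: "submodule N R M" and t: "type_at L N w A B"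
  shows "proper_cut A" and "proper_cut B"
proof -
  have w: "w \<in> L" "w \<notin> N" "w \<in> carrier M" using t submodule_closed(1)[OF L] by (auto simp: type_at_def)
  have A: "A = {r \<in> carrier R. r \<odot>\<^bsub>M\<^esub> w \<in> N}" and
    B: "B = {r \<in> carrier R. \<forall>z\<in>L. \<not> congruent_mod N w (r \<odot>\<^bsub>M\<^esub> z)}" using t by (auto simp: type_at_def)
  have "(c \<otimes> r) \<odot>\<^bsub>M\<^esub> w \<in> N" if "c \<in> A" "r \<in> carrier R" for c r
    using that w submodule_closed(6)[OF N] unfolding A by (simp add: m_comm[of c] smult_assoc1)
  then show "proper_cut A"
    unfolding proper_cut_def using w submodule_closed(2)[OF N] by (auto simp: A)
  have "\<not> congruent_mod N w (c \<otimes> r \<odot>\<^bsub>M\<^esub> z)" if "c \<in> B" "r \<in> carrier R" "z \<in> L" for c r z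
    using that submodule_closed(1,6)[OF L] unfolding B by (auto simp: smult_assoc1)
  moreover have "\<not> congruent_mod N w (\<zero> \<odot>\<^bsub>M\<^esub> z)" if "z \<in> L" for z
    using that w submodule_closed(1)[OF L] congruent_zero_iff[OF N w(3)] by simp
  moreover have "\<exists>z\<in>L. congruent_mod N w (\<one> \<odot>\<^bsub>M\<^esub> z)"
    using w congruent_refl[OF N] by (intro bexI[of _ w]) auto
  ultimately show "proper_cut B" unfolding proper_cut_def using w B by auto
qed

section \<open>Windows and negligible elements\<close>

text \<open>
  The subgroup \<open>sL \<inter> L[a]\<close>. Windows shrink when \<open>a\<close> is replaced by a divisor and \<open>s\<close> by a multiple.
\<close>

definition window :: "'c set \<Rightarrow> 'a \<Rightarrow> 'a \<Rightarrow> 'c set" where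
  "window L a s = {x \<in> L. (\<exists>z\<in>L. x = s \<odot>\<^bsub>M\<^esub> z) \<and> a \<odot>\<^bsub>M\<^esub> x = \<zero>\<^bsub>M\<^esub>}"

lemma window_submodule:
  assumes L: "submodule L R M" and "a \<in> carrier R" "s \<in> carrier R"
  shows "submodule (window L a s) R M"
proof (rule submodule_if_closed)
  note cl = submodule_closed[OF L]
  show "window L a s \<subseteq> carrier M" using cl(1) by (auto simp: window_def)
  show "\<zero>\<^bsub>M\<^esub> \<in> window L a s" using cl(2) assms by (auto simp: window_def intro!: bexI[of _ "\<zero>\<^bsub>M\<^esub>"])
  fix x y assume "x \<in> window L a s" "y \<in> window L a s"
  then obtain z z' where "z \<in> L" "z' \<in> L" "x = s \<odot>\<^bsub>M\<^esub> z" "y = s \<odot>\<^bsub>M\<^esub> z'" "x \<in> L" "y \<in> L"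
    "a \<odot>\<^bsub>M\<^esub> x = \<zero>\<^bsub>M\<^esub>" "a \<odot>\<^bsub>M\<^esub> y = \<zero>\<^bsub>M\<^esub>" by (auto simp: window_def)
  then show "x \<oplus>\<^bsub>M\<^esub> y \<in> window L a s"
    using assms cl by (auto simp: window_def smult_r_distr intro!: bexI[of _ "z \<oplus>\<^bsub>M\<^esub> z'"])
next
  note cl = submodule_closed[OF L]
  fix r x assume r: "r \<in> carrier R" and "x \<in> window L a s"
  then obtain z where z: "z \<in> L" "x = s \<odot>\<^bsub>M\<^esub> z" "x \<in> L" "a \<odot>\<^bsub>M\<^esub> x = \<zero>\<^bsub>M\<^esub>" by (auto simp: window_def)
  have "r \<odot>\<^bsub>M\<^esub> x = s \<odot>\<^bsub>M\<^esub> (r \<odot>\<^bsub>M\<^esub> z)" using z r assms cl(1) by (simp add: smult_left_commute)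
  moreover have "a \<odot>\<^bsub>M\<^esub> (r \<odot>\<^bsub>M\<^esub> x) = \<zero>\<^bsub>M\<^esub>" using z r assms cl(1) by (subst smult_left_commute) auto
  ultimately show "r \<odot>\<^bsub>M\<^esub> x \<in> window L a s" using z r cl(6) unfolding window_def by blast
qed

lemma window_mono:
  assumes "submodule L R M" "a \<in> carrier R" "s \<in> carrier R" "e \<in> carrier R" "f \<in> carrier R"
  shows "window L a (s \<otimes> e) \<subseteq> window L (a \<otimes> f) s"
proof
  fix x assume "x \<in> window L a (s \<otimes> e)"
  then obtain z where z: "z \<in> L" "x = s \<odot>\<^bsub>M\<^esub> (e \<odot>\<^bsub>M\<^esub> z)" "x \<in> L" "a \<odot>\<^bsub>M\<^esub> x = \<zero>\<^bsub>M\<^esub>"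
    using submodule_closed(1)[OF assms(1)] assms by (auto simp: window_def smult_assoc1)
  then have "(a \<otimes> f) \<odot>\<^bsub>M\<^esub> x = \<zero>\<^bsub>M\<^esub>"
    using assms submodule_closed(1)[OF assms(1)] by (subst m_comm) (auto simp: smult_assoc1)
  then show "x \<in> window L (a \<otimes> f) s"
    using z submodule_closed(6)[OF assms(1)] assms unfolding window_def by blast
qed

lemma window_relatively_divisible:
  assumes "relatively_divisible N L" "s \<in> carrier R" "x \<in> window L a s" "x \<in> N"
  shows "x \<in> window N a s"
  using assms unfolding window_def relatively_divisible_def by blast

text \<open>
  Membership in a single window lifts from \<open>L/N\<close> to \<open>L\<close>: if \<open>asz \<in> N\<close>, then \<open>asz = asy\<close> with
  \<open>y \<in> N\<close>, and \<open>s(z - y)\<close> is the required lift.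
\<close>

lemma window_lift:
  assumes rd: "relatively_divisible N L" and as: "a \<in> carrier R" "s \<in> carrier R"
    and z: "z \<in> L" and w: "congruent_mod N w (s \<odot>\<^bsub>M\<^esub> z)" "a \<odot>\<^bsub>M\<^esub> w \<in> N"
  shows "\<exists>x\<in>window L a s. congruent_mod N w x"
proof -
  have N: "submodule N R M" and L: "submodule L R M" and "N \<subseteq> L"
    using rd by (auto simp: relatively_divisible_def)
  note cN = submodule_closed[OF N] and cL = submodule_closed[OF L]
  have "a \<odot>\<^bsub>M\<^esub> (s \<odot>\<^bsub>M\<^esub> z) \<in> N"
    using congruent_mem_iff[OF N congruent_smult[OF N as(1) w(1)]] w(2) by simp
  then have "(a \<otimes> s) \<odot>\<^bsub>M\<^esub> z \<in> N" using as z cL(1) by (simp add: smult_assoc1)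
  then obtain y where y: "y \<in> N" "(a \<otimes> s) \<odot>\<^bsub>M\<^esub> z = (a \<otimes> s) \<odot>\<^bsub>M\<^esub> y"
    using rd as z unfolding relatively_divisible_def by blast
  let ?x = "s \<odot>\<^bsub>M\<^esub> (z \<ominus>\<^bsub>M\<^esub> y)"
  have zy: "z \<in> carrier M" "y \<in> carrier M" "z \<ominus>\<^bsub>M\<^esub> y \<in> L" using z y cN cL \<open>N \<subseteq> L\<close> by auto
  have "a \<odot>\<^bsub>M\<^esub> ?x = (a \<otimes> s) \<odot>\<^bsub>M\<^esub> z \<ominus>\<^bsub>M\<^esub> (a \<otimes> s) \<odot>\<^bsub>M\<^esub> y"
    using as zy by (simp flip: smult_assoc1 add: smult_diff_right)
  also have "\<dots> = \<zero>\<^bsub>M\<^esub>" using y as zy by (simp add: M.minus_eq M.r_neg)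
  finally have "?x \<in> window L a s" using zy as cL(6) unfolding window_def by blast
  moreover have "congruent_mod N (s \<odot>\<^bsub>M\<^esub> z) ?x"
    by (rule congruent_smult[OF N as(2) congruent_sym[OF N congruent_diff_mem[OF N zy(1) y(1)]]])
  ultimately show ?thesis using congruent_trans[OF N w(1)] by blast
qed

text \<open>
  The preimage in \<open>M\<close> of the union of all \<open>Q[r] + bQ\<close> with \<open>r \<notin> A\<close> and \<open>b \<in> B\<close>, where \<open>Q = M/K\<close>.
\<close>

definition negligible :: "'a set \<Rightarrow> 'a set \<Rightarrow> 'c set \<Rightarrow> 'c set" where
  "negligible A B K = {x \<in> carrier M. \<exists>r\<in>carrier R - A. \<exists>b\<in>B. \<exists>z\<in>carrier M.
     r \<odot>\<^bsub>M\<^esub> (x \<ominus>\<^bsub>M\<^esub> b \<odot>\<^bsub>M\<^esub> z) \<in> K}"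

lemma negligible_mono: "K \<subseteq> K' \<Longrightarrow> negligible A B K \<subseteq> negligible A B K'"
  unfolding negligible_def by blast

context
  fixes A B K
  assumes A: "proper_cut A" and B: "proper_cut B" and K: "submodule K R M"
begin

lemma negligible_annihilated:
  assumes "r \<in> carrier R - A" "r \<odot>\<^bsub>M\<^esub> x \<in> K" "x \<in> carrier M"
  shows "x \<in> negligible A B K"
proof -
  have "\<zero> \<in> B" using B by (simp add: proper_cut_def)
  moreover have "r \<odot>\<^bsub>M\<^esub> (x \<ominus>\<^bsub>M\<^esub> \<zero> \<odot>\<^bsub>M\<^esub> \<zero>\<^bsub>M\<^esub>) \<in> K" using assms by (simp add: M.minus_eq minus_zero)
  ultimately show ?thesis using assms unfolding negligible_def by blast
qed

lemma negligible_contains: "K \<subseteq> negligible A B K"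
  using negligible_annihilated[of \<one>] A submodule_closed(1)[OF K] by (auto simp: proper_cut_def)

lemma negligible_divisible:
  assumes "b \<in> B" "z \<in> carrier M"
  shows "b \<odot>\<^bsub>M\<^esub> z \<in> negligible A B K"
proof -
  have "b \<in> carrier R" "\<one> \<notin> A" using A B assms by (auto simp: proper_cut_def)
  moreover from this have "\<one> \<odot>\<^bsub>M\<^esub> (b \<odot>\<^bsub>M\<^esub> z \<ominus>\<^bsub>M\<^esub> b \<odot>\<^bsub>M\<^esub> z) \<in> K"
    using assms submodule_closed(2)[OF K] by (simp add: M.minus_eq M.r_neg)
  ultimately show ?thesis using assms unfolding negligible_def
    by (intro CollectI conjI bexI[of _ \<one>] bexI[of _ b] bexI[of _ z]) auto
qed

lemma negligible_iff_congruent: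
  assumes "x \<in> carrier M"
  shows "x \<in> negligible A B K \<longleftrightarrow> (\<exists>r\<in>carrier R - A. \<exists>b\<in>B. \<exists>z\<in>carrier M.
     congruent_mod K (r \<odot>\<^bsub>M\<^esub> x) (r \<odot>\<^bsub>M\<^esub> (b \<odot>\<^bsub>M\<^esub> z)))"
proof -
  have "congruent_mod K (r \<odot>\<^bsub>M\<^esub> x) (r \<odot>\<^bsub>M\<^esub> (b \<odot>\<^bsub>M\<^esub> z)) \<longleftrightarrow> r \<odot>\<^bsub>M\<^esub> (x \<ominus>\<^bsub>M\<^esub> b \<odot>\<^bsub>M\<^esub> z) \<in> K"
    if "r \<in> carrier R" "b \<in> B" "z \<in> carrier M" for r b z
    using that assms B by (auto simp: congruent_mod_def smult_diff_right proper_cut_def subset_iff)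
  then show ?thesis using assms unfolding negligible_def by auto
qed

lemma negligible_submodule: "submodule (negligible A B K) R M"
proof (rule submodule_if_closed)
  show sub: "negligible A B K \<subseteq> carrier M" by (auto simp: negligible_def)
  show "\<zero>\<^bsub>M\<^esub> \<in> negligible A B K" using negligible_contains submodule_closed(2)[OF K] by blast
  have Bc: "b \<in> carrier R" if "b \<in> B" for b using that B by (auto simp: proper_cut_def)
  fix x y assume x: "x \<in> negligible A B K" and y: "y \<in> negligible A B K"
  obtain r b z where r: "r \<in> carrier R - A" "b \<in> B" "z \<in> carrier M"
    "congruent_mod K (r \<odot>\<^bsub>M\<^esub> x) (r \<odot>\<^bsub>M\<^esub> (b \<odot>\<^bsub>M\<^esub> z))"
    using x sub negligible_iff_congruent[of x] by blast
  obtain r' b' z' where r': "r' \<in> carrier R - A" "b' \<in> B" "z' \<in> carrier M"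
    "congruent_mod K (r' \<odot>\<^bsub>M\<^esub> y) (r' \<odot>\<^bsub>M\<^esub> (b' \<odot>\<^bsub>M\<^esub> z'))"
    using y sub negligible_iff_congruent[of y] by blast
  have xy: "x \<in> carrier M" "y \<in> carrier M" using x y sub by auto
  have up: "congruent_mod K ((p \<otimes> e) \<odot>\<^bsub>M\<^esub> u) ((p \<otimes> e) \<odot>\<^bsub>M\<^esub> u')"
    if "p \<in> carrier R" "e \<in> carrier R" "u \<in> carrier M" "u' \<in> carrier M"
      "congruent_mod K (p \<odot>\<^bsub>M\<^esub> u) (p \<odot>\<^bsub>M\<^esub> u')" for p e u u'
    using congruent_smult[OF K that(2,5)] that by (simp add: smult_assoc1 smult_left_commute)
  have "\<exists>q\<in>carrier R - A. congruent_mod K (q \<odot>\<^bsub>M\<^esub> x) (q \<odot>\<^bsub>M\<^esub> (b \<odot>\<^bsub>M\<^esub> z)) \<and>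
      congruent_mod K (q \<odot>\<^bsub>M\<^esub> y) (q \<odot>\<^bsub>M\<^esub> (b' \<odot>\<^bsub>M\<^esub> z'))"
    using divides_total[of r r'] r r' up xy Bc by (metis DiffD1 smult_closed)
  then obtain q where q: "q \<in> carrier R - A"
    "congruent_mod K (q \<odot>\<^bsub>M\<^esub> x) (q \<odot>\<^bsub>M\<^esub> (b \<odot>\<^bsub>M\<^esub> z))"
    "congruent_mod K (q \<odot>\<^bsub>M\<^esub> y) (q \<odot>\<^bsub>M\<^esub> (b' \<odot>\<^bsub>M\<^esub> z'))" by blast
  have "\<exists>d\<in>B. \<exists>t\<in>carrier M. b \<odot>\<^bsub>M\<^esub> z \<oplus>\<^bsub>M\<^esub> b' \<odot>\<^bsub>M\<^esub> z' = d \<odot>\<^bsub>M\<^esub> t"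
  proof (rule disjE[OF divides_total[OF Bc[OF r(2)] Bc[OF r'(2)]]])
    assume "\<exists>c\<in>carrier R. b = b' \<otimes> c"
    then obtain c where c: "c \<in> carrier R" "b = b' \<otimes> c" by blast
    then have "b \<odot>\<^bsub>M\<^esub> z \<oplus>\<^bsub>M\<^esub> b' \<odot>\<^bsub>M\<^esub> z' = b' \<odot>\<^bsub>M\<^esub> (c \<odot>\<^bsub>M\<^esub> z \<oplus>\<^bsub>M\<^esub> z')"
      using r r' Bc by (simp add: smult_r_distr smult_assoc1)
    then show ?thesis using r r' c by (intro bexI[of _ b'] bexI[of _ "c \<odot>\<^bsub>M\<^esub> z \<oplus>\<^bsub>M\<^esub> z'"]) auto
  next
    assume "\<exists>c\<in>carrier R. b' = b \<otimes> c"
    then obtain c where c: "c \<in> carrier R" "b' = b \<otimes> c" by blast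
    then have "b \<odot>\<^bsub>M\<^esub> z \<oplus>\<^bsub>M\<^esub> b' \<odot>\<^bsub>M\<^esub> z' = b \<odot>\<^bsub>M\<^esub> (z \<oplus>\<^bsub>M\<^esub> c \<odot>\<^bsub>M\<^esub> z')"
      using r r' Bc by (simp add: smult_r_distr smult_assoc1)
    then show ?thesis using r r' c by (intro bexI[of _ b] bexI[of _ "z \<oplus>\<^bsub>M\<^esub> c \<odot>\<^bsub>M\<^esub> z'"]) auto
  qed
  then obtain d t where d: "d \<in> B" "t \<in> carrier M" "b \<odot>\<^bsub>M\<^esub> z \<oplus>\<^bsub>M\<^esub> b' \<odot>\<^bsub>M\<^esub> z' = d \<odot>\<^bsub>M\<^esub> t" by blast
  have "congruent_mod K (q \<odot>\<^bsub>M\<^esub> (x \<oplus>\<^bsub>M\<^esub> y)) (q \<odot>\<^bsub>M\<^esub> (d \<odot>\<^bsub>M\<^esub> t))"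
    using congruent_add[OF K q(2,3)] q(1) xy r r' Bc unfolding d(3)[symmetric]
    by (simp add: smult_r_distr)
  then show "x \<oplus>\<^bsub>M\<^esub> y \<in> negligible A B K"
    using negligible_iff_congruent[of "x \<oplus>\<^bsub>M\<^esub> y"] xy q(1) d by blast
next
  have Bc: "b \<in> carrier R" if "b \<in> B" for b using that B by (auto simp: proper_cut_def)
  fix c x assume c: "c \<in> carrier R" and x: "x \<in> negligible A B K"
  then have xM: "x \<in> carrier M" by (simp add: negligible_def)
  obtain r b z where r: "r \<in> carrier R - A" "b \<in> B" "z \<in> carrier M"
    "congruent_mod K (r \<odot>\<^bsub>M\<^esub> x) (r \<odot>\<^bsub>M\<^esub> (b \<odot>\<^bsub>M\<^esub> z))"
    using x xM negligible_iff_congruent[of x] by blast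
  have "congruent_mod K (c \<odot>\<^bsub>M\<^esub> (r \<odot>\<^bsub>M\<^esub> x)) (c \<odot>\<^bsub>M\<^esub> (r \<odot>\<^bsub>M\<^esub> (b \<odot>\<^bsub>M\<^esub> z)))"
    by (rule congruent_smult[OF K c r(4)])
  then have "congruent_mod K (r \<odot>\<^bsub>M\<^esub> (c \<odot>\<^bsub>M\<^esub> x)) (r \<odot>\<^bsub>M\<^esub> (b \<odot>\<^bsub>M\<^esub> (c \<odot>\<^bsub>M\<^esub> z)))"
    using c r xM Bc by (simp add: smult_left_commute[of c])
  then show "c \<odot>\<^bsub>M\<^esub> x \<in> negligible A B K"
    using negligible_iff_congruent[of "c \<odot>\<^bsub>M\<^esub> x"] xM c r by blast
qed

end

lemma window_common_refinement:
  assumes A: "proper_cut A" and B: "proper_cut B"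
    and a: "a \<in> A" "a' \<in> A" and s: "s \<in> carrier R - B" "s' \<in> carrier R - B"
  shows "\<exists>d\<in>A. \<exists>t\<in>carrier R - B. \<forall>H. submodule H R M \<longrightarrow>
    window H d t \<subseteq> window H a s \<and> window H d t \<subseteq> window H a' s'"
proof -
  have ac: "a \<in> carrier R" "a' \<in> carrier R" and sc: "s \<in> carrier R" "s' \<in> carrier R"
    using a s A by (auto simp: proper_cut_def)
  have "\<exists>d\<in>A. (\<exists>f\<in>carrier R. a = d \<otimes> f) \<and> (\<exists>f\<in>carrier R. a' = d \<otimes> f)"
    using divides_total[OF ac] a ac by (metis one_closed r_one)
  then obtain d f f' where d: "d \<in> A" "f \<in> carrier R" "a = d \<otimes> f" "f' \<in> carrier R" "a' = d \<otimes> f'"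
    by blast
  have "\<exists>t\<in>carrier R - B. (\<exists>e\<in>carrier R. t = s \<otimes> e) \<and> (\<exists>e\<in>carrier R. t = s' \<otimes> e)"
    using divides_total[OF sc] s sc by (metis one_closed r_one)
  then obtain t e e' where t: "t \<in> carrier R - B" "e \<in> carrier R" "t = s \<otimes> e" "e' \<in> carrier R" "t = s' \<otimes> e'"
    by blast
  have dc: "d \<in> carrier R" using d A by (auto simp: proper_cut_def)
  have "window H d t \<subseteq> window H a s \<and> window H d t \<subseteq> window H a' s'" if "submodule H R M" for H
    using window_mono[OF that dc sc(1) t(2) d(2)] window_mono[OF that dc sc(2) t(4) d(4)] t d by simp
  then show ?thesis using d t by blast
qed

section \<open>Approximating an element from a smaller submodule\<close>

text \<open>
  Suppose \<open>r(v - bz) \<in> N\<close>. Relative divisibility allows \<open>z\<close> to be taken in \<open>L\<close>. As \<open>b \<in> B\<close>, \<open>v\<close> is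
  not a multiple of \<open>bz\<close> modulo \<open>N\<close>, so \<open>bz \<equiv> cv\<close> with \<open>c\<close> a non-unit; but then \<open>r(1 - c)v \<in> N\<close> forces
  \<open>rv \<in> N\<close>, although \<open>r \<notin> A\<close>.
\<close>

lemma type_at_not_negligible:
  assumes LM: "relatively_divisible L (carrier M)" and N: "submodule N R M" "N \<subseteq> L"
    and us: "uniserial_factor L N" and t: "type_at L N v A B"
  shows "v \<notin> negligible A B N"
proof
  have L: "submodule L R M" using LM by (simp add: relatively_divisible_def)
  note cL = submodule_closed[OF L]
  note cuts = type_at_proper_cuts[OF L N(1) t]
  have v: "v \<in> L" "v \<in> carrier M" using t cL(1) by (auto simp: type_at_def)
  assume "v \<in> negligible A B N"
  then obtain r b z where r: "r \<in> carrier R" "r \<notin> A" and b: "b \<in> B" and z: "z \<in> carrier M"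
    and cong: "congruent_mod N (r \<odot>\<^bsub>M\<^esub> v) (r \<odot>\<^bsub>M\<^esub> (b \<odot>\<^bsub>M\<^esub> z))"
    using negligible_iff_congruent[OF cuts N(1) v(2)] by blast
  have b: "b \<in> B" "b \<in> carrier R" using b cuts(2) by (auto simp: proper_cut_def)
  have "r \<odot>\<^bsub>M\<^esub> (b \<odot>\<^bsub>M\<^esub> z) \<in> L"
    using congruent_mem_iff[OF L congruent_mono[OF cong N(2)]] v r cL by simp
  then have "(r \<otimes> b) \<odot>\<^bsub>M\<^esub> z \<in> L" using r b z by (simp add: smult_assoc1)
  then obtain y where y: "y \<in> L" "(r \<otimes> b) \<odot>\<^bsub>M\<^esub> z = (r \<otimes> b) \<odot>\<^bsub>M\<^esub> y"
    using LM r b z unfolding relatively_divisible_def by blast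
  have yM: "y \<in> carrier M" using y cL by simp
  have cong': "congruent_mod N (r \<odot>\<^bsub>M\<^esub> v) (r \<odot>\<^bsub>M\<^esub> (b \<odot>\<^bsub>M\<^esub> y))"
    using cong y(2) r b z yM by (simp add: smult_assoc1)
  have notdiv: "\<not> congruent_mod N v (b \<odot>\<^bsub>M\<^esub> y')" if "y' \<in> L" for y'
    using t b(1) that by (auto simp: type_at_def)
  have byL: "b \<odot>\<^bsub>M\<^esub> y \<in> L" using b y cL by simp
  consider (1) c where "c \<in> carrier R" "congruent_mod N v (c \<odot>\<^bsub>M\<^esub> (b \<odot>\<^bsub>M\<^esub> y))"
    | (2) c where "c \<in> carrier R" "congruent_mod N (b \<odot>\<^bsub>M\<^esub> y) (c \<odot>\<^bsub>M\<^esub> v)"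
    using us v(1) byL unfolding uniserial_factor_def by blast
  then show False
  proof cases
    case 1
    then show False using notdiv[of "c \<odot>\<^bsub>M\<^esub> y"] y cL b yM by (simp add: smult_left_commute)
  next
    case 2
    have "congruent_mod N (r \<odot>\<^bsub>M\<^esub> v) (r \<odot>\<^bsub>M\<^esub> (c \<odot>\<^bsub>M\<^esub> v))"
      by (rule congruent_trans[OF N(1) cong' congruent_smult[OF N(1) r(1) 2(2)]])
    then have "r \<odot>\<^bsub>M\<^esub> (v \<ominus>\<^bsub>M\<^esub> c \<odot>\<^bsub>M\<^esub> v) \<in> N"
      using r 2 v by (simp add: congruent_mod_def smult_diff_right)
    then have "(\<one> \<ominus> c) \<odot>\<^bsub>M\<^esub> (r \<odot>\<^bsub>M\<^esub> v) \<in> N"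
      using smult_diff_left[of \<one> c v] r 2 v by (subst smult_left_commute) auto
    moreover have "r \<odot>\<^bsub>M\<^esub> v \<notin> N" using t r by (auto simp: type_at_def)
    ultimately have "\<one> \<ominus> c \<notin> Units R" using unit_smult_mem_iff[OF N(1)] r v by auto
    then have c: "c \<in> Units R" using unit_or_one_minus_unit 2 by blast
    from congruent_unit_solve[OF N(1) this 2(2) v(2)]
    have "congruent_mod N v (b \<odot>\<^bsub>M\<^esub> (inv c \<odot>\<^bsub>M\<^esub> y))" using c b yM by (simp add: smult_left_commute)
    then show False using notdiv[of "inv c \<odot>\<^bsub>M\<^esub> y"] c y cL by simp
  qed
qed

text \<open>
  The approximation may depend on the window: no single element of \<open>L\<close> need serve for all windows.
\<close>

definition approximable :: "'a set \<Rightarrow> 'a set \<Rightarrow> 'c set \<Rightarrow> 'c \<Rightarrow> 'c set \<Rightarrow> bool" where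
  "approximable A B Q v L \<longleftrightarrow> (\<forall>a\<in>A. \<forall>s\<in>carrier R - B. \<exists>x\<in>window L a s. congruent_mod Q v x)"

text \<open>
  If \<open>y \<equiv> cx\<close> modulo \<open>N\<close>, then \<open>c\<close> must be a unit, because \<open>y - cx\<close> lies in the window of \<open>N\<close>,
  which contains no approximation. By symmetry the classes of \<open>x\<close> and \<open>y\<close> in \<open>L/N\<close> generate the
  same submodule.
\<close>

lemma approximations_proportional:
  assumes Q: "submodule Q R M" and rd: "relatively_divisible N L" and us: "uniserial_factor L N"
    and as: "a \<in> carrier R" "s \<in> carrier R"
    and bad: "\<not> (\<exists>y\<in>window N a s. congruent_mod Q v y)"
    and x: "x \<in> window L a s" "congruent_mod Q v x"
    and y: "y \<in> window L a s" "congruent_mod Q v y"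
  shows "\<exists>c\<in>carrier R. congruent_mod N x (c \<odot>\<^bsub>M\<^esub> y)"
proof -
  have N: "submodule N R M" and L: "submodule L R M" and "N \<subseteq> L"
    using rd by (auto simp: relatively_divisible_def)
  have xy: "x \<in> L" "y \<in> L" "x \<in> carrier M" "y \<in> carrier M"
    using x y submodule_closed(1)[OF L] by (auto simp: window_def)
  consider (1) "\<exists>c\<in>carrier R. congruent_mod N x (c \<odot>\<^bsub>M\<^esub> y)"
    | (2) c where "c \<in> carrier R" "congruent_mod N y (c \<odot>\<^bsub>M\<^esub> x)"
    using us xy unfolding uniserial_factor_def by blast
  then show ?thesis
  proof cases
    case 2
    note W = window_submodule[OF L as]
    have "y \<ominus>\<^bsub>M\<^esub> c \<odot>\<^bsub>M\<^esub> x \<in> window L a s"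
      using submodule_closed(5,6)[OF W] x y 2 by blast
    then have "y \<ominus>\<^bsub>M\<^esub> c \<odot>\<^bsub>M\<^esub> x \<in> window N a s"
      using window_relatively_divisible[OF rd as(2)] 2(2) by (simp add: congruent_mod_def)
    then have c: "c \<in> Units R"
      using unit_or_approximated[OF Q window_submodule[OF N as] 2(1) x(2) y(2)] bad by blast
    then show ?thesis using congruent_unit_solve[OF N c 2(2) xy(3)] by blast
  qed
qed

text \<open>
  The class of \<open>x\<close> lies in every window of \<open>L/N\<close>, because it is a multiple of the class of an
  approximation taken from a finer window. It is not negligible in \<open>L/N\<close>: a negligible class
  would lift to a negligible \<open>y\<close> in the same window, and \<open>x - y\<close> would be an approximation in the
  window of \<open>N\<close> that contains none.
\<close>

lemma approximation_has_type:
  assumes A: "proper_cut A" and B: "proper_cut B" and K: "submodule K R M"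
    and rd: "relatively_divisible N L" and us: "uniserial_factor L N"
    and as: "a \<in> A" "s \<in> carrier R - B"
    and bad: "\<not> (\<exists>y\<in>window N a s. congruent_mod (negligible A B K) v y)"
    and appr: "approximable A B (negligible A B K) v L"
    and x: "x \<in> window L a s" "congruent_mod (negligible A B K) v x"
  shows "type_at L N x A B"
proof -
  let ?Q = "negligible A B K"
  have N: "submodule N R M" and L: "submodule L R M"
    using rd by (auto simp: relatively_divisible_def)
  note Q = negligible_submodule[OF A B K]
  note cL = submodule_closed[OF L] and cN = submodule_closed[OF N]
  have AR: "d \<in> carrier R" if "d \<in> A" for d using that A by (auto simp: proper_cut_def)
  have BR: "d \<in> carrier R" if "d \<in> B" for d using that B by (auto simp: proper_cut_def)
  have asc: "a \<in> carrier R" "s \<in> carrier R" using as AR by auto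
  have xL: "x \<in> L" "x \<in> carrier M" "a \<odot>\<^bsub>M\<^esub> x = \<zero>\<^bsub>M\<^esub>" using x cL(1) by (auto simp: window_def)
  obtain z where z: "z \<in> L" "x = s \<odot>\<^bsub>M\<^esub> z" using x by (auto simp: window_def)
  \<comment> \<open>All conditions of type \<open>(A, B)\<close> that ask for membership, namely in the windows.\<close>
  have deep: "d \<odot>\<^bsub>M\<^esub> x \<in> N \<and> (\<exists>z\<in>L. congruent_mod N x (t \<odot>\<^bsub>M\<^esub> z))"
    if d: "d \<in> A" and t: "t \<in> carrier R - B" for d t
  proof -
    obtain d' t' where d': "d' \<in> A" "t' \<in> carrier R - B"
      and sub: "\<And>H. submodule H R M \<Longrightarrow> window H d' t' \<subseteq> window H a s \<and> window H d' t' \<subseteq> window H d t"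
      using window_common_refinement[OF A B as(1) d as(2) t] by blast
    obtain y where y: "y \<in> window L d' t'" "congruent_mod ?Q v y"
      using appr d' unfolding approximable_def by blast
    obtain c where c: "c \<in> carrier R" "congruent_mod N x (c \<odot>\<^bsub>M\<^esub> y)"
      using approximations_proportional[OF Q rd us asc bad x _ y(2)] y sub[OF L] by blast
    have "c \<odot>\<^bsub>M\<^esub> y \<in> window L d t"
      using submodule_closed(6)[OF window_submodule[OF L AR[OF d]]] c y sub[OF L] t by blast
    then obtain z' where z': "z' \<in> L" "c \<odot>\<^bsub>M\<^esub> y = t \<odot>\<^bsub>M\<^esub> z'" "d \<odot>\<^bsub>M\<^esub> (c \<odot>\<^bsub>M\<^esub> y) = \<zero>\<^bsub>M\<^esub>"
      by (auto simp: window_def)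
    have "d \<odot>\<^bsub>M\<^esub> x \<in> N"
      using congruent_mem_iff[OF N congruent_smult[OF N AR[OF d] c(2)]] z' cN(2) by simp
    then show ?thesis using c(2) z' by auto
  qed
  \<comment> \<open>The conditions that ask for non-membership reduce to excluding a negligible lift of \<open>x\<close>.\<close>
  have notQ: False if y: "y \<in> window L a s" "congruent_mod N x y" "y \<in> ?Q" for y
  proof -
    have "x \<ominus>\<^bsub>M\<^esub> y \<in> window L a s" using submodule_closed(5)[OF window_submodule[OF L asc]] x y by blast
    then have "x \<ominus>\<^bsub>M\<^esub> y \<in> window N a s"
      using window_relatively_divisible[OF rd asc(2)] y(2) by (simp add: congruent_mod_def)
    moreover have "congruent_mod ?Q v (x \<ominus>\<^bsub>M\<^esub> y)"
      using congruent_trans[OF Q x(2) congruent_sym[OF Q congruent_diff_mem[OF Q xL(2) y(3)]]] .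
    ultimately show False using bad by blast
  qed
  have noann: "r \<odot>\<^bsub>M\<^esub> x \<notin> N" if r: "r \<in> carrier R - A" for r
  proof
    assume rx: "r \<odot>\<^bsub>M\<^esub> x \<in> N"
    have rc: "r \<in> carrier R" using r by simp
    obtain y where y: "y \<in> window L r s" "congruent_mod N x y"
      using window_lift[OF rd rc asc(2) z(1) _ rx] z xL congruent_refl[OF N] by auto
    obtain e where e: "e \<in> carrier R" "a = r \<otimes> e" using proper_cut_dvd[OF A as(1)] r by auto
    have "y \<in> window L a s" using window_mono[OF L rc asc(2) one_closed e(1)] y e asc by auto
    moreover have "y \<in> ?Q"
      using negligible_annihilated[OF A B K r] y cL(1) submodule_closed(2)[OF K] by (auto simp: window_def)
    ultimately show False using notQ y by blast
  qed
  have nodiv: "\<not> congruent_mod N x (b \<odot>\<^bsub>M\<^esub> z')" if b: "b \<in> B" and z': "z' \<in> L" for b z'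
  proof
    assume c: "congruent_mod N x (b \<odot>\<^bsub>M\<^esub> z')"
    obtain y where y: "y \<in> window L a b" "congruent_mod N x y"
      using window_lift[OF rd asc(1) BR[OF b] z' c] xL cN(2) by auto
    obtain e where e: "e \<in> carrier R" "b = s \<otimes> e" using proper_cut_dvd[OF B b] as by auto
    have "y \<in> window L a s" using window_mono[OF L asc e(1) one_closed] y e asc by auto
    moreover have "y \<in> ?Q"
      using y negligible_divisible[OF A B K b] cL(1) by (auto simp: window_def)
    ultimately show False using notQ y by blast
  qed
  have one: "\<one> \<in> carrier R - A" using A by (auto simp: proper_cut_def)
  have "A = {r \<in> carrier R. r \<odot>\<^bsub>M\<^esub> x \<in> N}" using deep[OF _ as(2)] noann AR by blast
  moreover have "B = {r \<in> carrier R. \<forall>z\<in>L. \<not> congruent_mod N x (r \<odot>\<^bsub>M\<^esub> z)}"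
    using deep[OF as(1)] nodiv BR by blast
  moreover have "x \<notin> N" using noann[OF one] xL by simp
  ultimately show ?thesis using xL unfolding type_at_def by blast
qed

text \<open>
  For such \<open>c\<close>, multiplication by \<open>c\<close> changes neither \<open>A\<close> nor \<open>B\<close>, so \<open>c\<close> behaves like a unit as far
  as elements of type \<open>(A, B)\<close> are concerned. These are the scalars outside a certain prime ideal,
  and they need not be units of \<open>R\<close>.
\<close>

definition preserves_cuts :: "'a set \<Rightarrow> 'a set \<Rightarrow> 'a \<Rightarrow> bool" where
  "preserves_cuts A B c \<longleftrightarrow> c \<in> carrier R \<and> (\<forall>r\<in>carrier R. r \<otimes> c \<in> A \<longrightarrow> r \<in> A) \<and>
     (\<forall>s\<in>carrier R - B. c \<otimes> s \<notin> B) \<and> (\<forall>b\<in>B. \<exists>b'\<in>B. b = c \<otimes> b') \<and> (\<forall>a\<in>A. \<exists>a'\<in>A. a = c \<otimes> a')"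

lemma preserves_cuts_if_proportional:
  assumes L: "submodule L R M" and N: "submodule N R M"
    and w: "type_at L N w A B" and w': "type_at L N w' A B"
    and c: "c \<in> carrier R" "congruent_mod N w (c \<odot>\<^bsub>M\<^esub> w')"
  shows "preserves_cuts A B c"
proof -
  note cuts = type_at_proper_cuts[OF L N w]
  have wM: "w' \<in> L" "w' \<in> carrier M" "w \<in> carrier M"
    using w w' submodule_closed(1)[OF L] by (auto simp: type_at_def)
  have Aw: "r \<in> A \<longleftrightarrow> r \<odot>\<^bsub>M\<^esub> w \<in> N" and Aw': "r \<in> A \<longleftrightarrow> r \<odot>\<^bsub>M\<^esub> w' \<in> N" if "r \<in> carrier R" for r
    using w w' that by (auto simp: type_at_def)
  have B1: "(r \<in> B) \<longleftrightarrow> \<not> (\<exists>z\<in>L. congruent_mod N w (r \<odot>\<^bsub>M\<^esub> z))"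
    and B2: "(r \<in> B) \<longleftrightarrow> \<not> (\<exists>z\<in>L. congruent_mod N w' (r \<odot>\<^bsub>M\<^esub> z))" if "r \<in> carrier R" for r
    using w w' that by (auto simp: type_at_def)
  have g1: "r \<in> A" if "r \<in> carrier R" "r \<otimes> c \<in> A" for r
  proof -
    have "r \<odot>\<^bsub>M\<^esub> (c \<odot>\<^bsub>M\<^esub> w') \<in> N" using Aw'[of "r \<otimes> c"] that c wM by (simp add: smult_assoc1)
    then show ?thesis using congruent_mem_iff[OF N congruent_smult[OF N that(1) c(2)]] Aw that by simp
  qed
  have cA: "c \<notin> A" using g1[of \<one>] c cuts(1) by (auto simp: proper_cut_def)
  have g2: "c \<otimes> s \<notin> B" if s: "s \<in> carrier R - B" for s
  proof -
    obtain z where z: "z \<in> L" "congruent_mod N w' (s \<odot>\<^bsub>M\<^esub> z)" using s B2[of s] by auto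
    have "congruent_mod N w ((c \<otimes> s) \<odot>\<^bsub>M\<^esub> z)"
      using congruent_trans[OF N c(2) congruent_smult[OF N c(1) z(2)]] c s z submodule_closed(1)[OF L]
      by (simp add: smult_assoc1)
    then show ?thesis using B1[of "c \<otimes> s"] c s z by auto
  qed
  have cB: "c \<notin> B" using g2[of \<one>] c cuts(2) by (auto simp: proper_cut_def)
  have g3: "\<exists>b'\<in>B. b = c \<otimes> b'" if "b \<in> B" for b
    using proper_cut_dvd[OF cuts(2) that c(1) cB] g2 that by blast
  have g4: "\<exists>a'\<in>A. a = c \<otimes> a'" if "a \<in> A" for a
    using proper_cut_dvd[OF cuts(1) that c(1) cA] g1 that c m_comm by metis
  show ?thesis unfolding preserves_cuts_def using c g1 g2 g3 g4 by blast
qed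

lemma negligible_cancel:
  assumes A: "proper_cut A" and B: "proper_cut B" and K: "submodule K R M"
    and c: "preserves_cuts A B c" and x: "x \<in> carrier M" "c \<odot>\<^bsub>M\<^esub> x \<in> negligible A B K"
  shows "x \<in> negligible A B K"
proof -
  have cR: "c \<in> carrier R" using c by (simp add: preserves_cuts_def)
  have BR: "d \<in> carrier R" if "d \<in> B" for d using that B by (auto simp: proper_cut_def)
  obtain r b z where r: "r \<in> carrier R - A" "b \<in> B" "z \<in> carrier M"
    "r \<odot>\<^bsub>M\<^esub> (c \<odot>\<^bsub>M\<^esub> x \<ominus>\<^bsub>M\<^esub> b \<odot>\<^bsub>M\<^esub> z) \<in> K" using x(2) unfolding negligible_def by blast
  obtain b' where b': "b' \<in> B" "b = c \<otimes> b'" using c r(2) unfolding preserves_cuts_def by blast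
  have "c \<odot>\<^bsub>M\<^esub> x \<ominus>\<^bsub>M\<^esub> b \<odot>\<^bsub>M\<^esub> z = c \<odot>\<^bsub>M\<^esub> (x \<ominus>\<^bsub>M\<^esub> b' \<odot>\<^bsub>M\<^esub> z)"
    using b' cR BR x r by (simp add: smult_assoc1 smult_diff_right)
  then have "(r \<otimes> c) \<odot>\<^bsub>M\<^esub> (x \<ominus>\<^bsub>M\<^esub> b' \<odot>\<^bsub>M\<^esub> z) \<in> K"
    using r b' BR x cR by (simp add: smult_assoc1)
  moreover have "r \<otimes> c \<in> carrier R - A" using c r cR unfolding preserves_cuts_def by auto
  ultimately show ?thesis using x(1) b' r(3) unfolding negligible_def by blast
qed

text \<open>
  Both \<open>v\<close> and \<open>v'\<close> are approximated from \<open>L\<close>, giving classes \<open>x\<close> and \<open>x'\<close> of type \<open>(A, B)\<close> in \<open>L/N\<close>,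
  and \<open>v\<close>, with all its approximations, is negligible modulo \<open>K'\<close>. If \<open>x' \<equiv> cx\<close>, then \<open>x' - cx \<in> N\<close>
  still approximates \<open>v'\<close>. If \<open>x \<equiv> cx'\<close>, then \<open>c\<close> preserves \<open>A\<close> and \<open>B\<close>, and for
  finer approximations \<open>y\<close> and \<open>y'\<close> some difference of \<open>cy'\<close> and a multiple of \<open>y\<close> lies in \<open>N\<close> and
  approximates \<open>cv'\<close>; then \<open>c\<close> can be cancelled.
\<close>

lemma approximation_levels_distinct:
  assumes A: "proper_cut A" and B: "proper_cut B"
    and K: "submodule K R M" "submodule K' R M" "K \<subseteq> K'"
    and v: "v \<in> K'" "v' \<in> carrier M"
    and rd: "relatively_divisible N L" and us: "uniserial_factor L N"
    and appr: "approximable A B (negligible A B K) v L" "\<not> approximable A B (negligible A B K) v N"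
    and appr': "approximable A B (negligible A B K') v' L"
  shows "approximable A B (negligible A B K') v' N"
proof (rule ccontr)
  let ?Q = "negligible A B K" and ?Q' = "negligible A B K'"
  assume notappr': "\<not> approximable A B ?Q' v' N"
  have N: "submodule N R M" and L: "submodule L R M"
    using rd by (auto simp: relatively_divisible_def)
  note Q = negligible_submodule[OF A B K(1)] and Q' = negligible_submodule[OF A B K(2)]
  note cL = submodule_closed[OF L] and cN = submodule_closed[OF N] and cQ' = submodule_closed[OF Q']
  have QQ': "?Q \<subseteq> ?Q'" by (rule negligible_mono[OF K(3)])
  have vQ': "v \<in> ?Q'" using v(1) negligible_contains[OF A B K(2)] by blast
  have AR: "d \<in> carrier R" if "d \<in> A" for d using that A by (auto simp: proper_cut_def)
  obtain a1 s1 where bad1: "a1 \<in> A" "s1 \<in> carrier R - B"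
    "\<not> (\<exists>y\<in>window N a1 s1. congruent_mod ?Q v y)" using appr(2) unfolding approximable_def by blast
  obtain a2 s2 where bad2: "a2 \<in> A" "s2 \<in> carrier R - B"
    "\<not> (\<exists>y\<in>window N a2 s2. congruent_mod ?Q' v' y)" using notappr' unfolding approximable_def by blast
  obtain a s where as: "a \<in> A" "s \<in> carrier R - B"
    and sub: "\<And>H. submodule H R M \<Longrightarrow> window H a s \<subseteq> window H a1 s1 \<and> window H a s \<subseteq> window H a2 s2"
    using window_common_refinement[OF A B bad1(1) bad2(1) bad1(2) bad2(2)] by blast
  have asc: "a \<in> carrier R" "s \<in> carrier R" using as AR by auto
  have bad: "\<not> (\<exists>y\<in>window N a s. congruent_mod ?Q v y)"
    and bad': "\<not> (\<exists>y\<in>window N a s. congruent_mod ?Q' v' y)" using bad1 bad2 sub[OF N] by blast+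
  obtain x where x: "x \<in> window L a s" "congruent_mod ?Q v x" using appr(1) as unfolding approximable_def by blast
  obtain x' where x': "x' \<in> window L a s" "congruent_mod ?Q' v' x'" using appr' as unfolding approximable_def by blast
  note tx = approximation_has_type[OF A B K(1) rd us as bad appr(1) x]
    and tx' = approximation_has_type[OF A B K(2) rd us as bad' appr' x']
  have memQ': "y \<in> ?Q'" if "congruent_mod ?Q v y" for y
    using congruent_mem_iff[OF Q' congruent_mono[OF that QQ']] vQ' by simp
  \<comment> \<open>Multiples of approximations of \<open>v\<close> may be subtracted from those of \<open>v'\<close> without harm.\<close>
  have key: "approx \<in> window N d t \<and> congruent_mod ?Q' (e \<odot>\<^bsub>M\<^esub> v') approx"
    if "approx = e \<odot>\<^bsub>M\<^esub> y' \<ominus>\<^bsub>M\<^esub> c \<odot>\<^bsub>M\<^esub> y" "congruent_mod N (e \<odot>\<^bsub>M\<^esub> y') (c \<odot>\<^bsub>M\<^esub> y)"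
      "y \<in> window L d t" "congruent_mod ?Q v y" "y' \<in> window L d t" "congruent_mod ?Q' v' y'"
      "c \<in> carrier R" "e \<in> carrier R" "d \<in> carrier R" "t \<in> carrier R" for approx e y' c y d t
  proof
    have "approx \<in> window L d t"
      unfolding that(1) using submodule_closed(5,6)[OF window_submodule[OF L that(9,10)]] that(3,5,7,8) by simp
    then show "approx \<in> window N d t"
      using window_relatively_divisible[OF rd that(10)] that(1,2) by (simp add: congruent_mod_def)
    have "c \<odot>\<^bsub>M\<^esub> y \<in> ?Q'" by (rule cQ'(6)[OF that(7) memQ'[OF that(4)]])
    moreover have "e \<odot>\<^bsub>M\<^esub> y' \<in> carrier M" by (rule smult_closed[OF that(8) congruent_carrier(2)[OF that(6)]])
    ultimately have "congruent_mod ?Q' (e \<odot>\<^bsub>M\<^esub> y') approx"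
      unfolding that(1) using congruent_sym[OF Q' congruent_diff_mem[OF Q']] by blast
    then show "congruent_mod ?Q' (e \<odot>\<^bsub>M\<^esub> v') approx"
      using congruent_trans[OF Q' congruent_smult[OF Q' that(8,6)]] by blast
  qed
  have xM: "x \<in> L" "x' \<in> L" "x \<in> carrier M" "x' \<in> carrier M" using x x' cL(1) by (auto simp: window_def)
  consider (1) c where "c \<in> carrier R" "congruent_mod N x' (c \<odot>\<^bsub>M\<^esub> x)"
    | (2) c where "c \<in> carrier R" "congruent_mod N x (c \<odot>\<^bsub>M\<^esub> x')"
    using us xM unfolding uniserial_factor_def by blast
  then show False
  proof cases
    case 1
    have "\<one> \<odot>\<^bsub>M\<^esub> x' \<ominus>\<^bsub>M\<^esub> c \<odot>\<^bsub>M\<^esub> x \<in> window N a s \<and> congruent_mod ?Q' (\<one> \<odot>\<^bsub>M\<^esub> v') (\<one> \<odot>\<^bsub>M\<^esub> x' \<ominus>\<^bsub>M\<^esub> c \<odot>\<^bsub>M\<^esub> x)"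
      by (rule key[OF refl _ x x']) (use 1 xM asc in auto)
    then show False using bad' v by auto
  next
    case 2
    have pc: "preserves_cuts A B c" by (rule preserves_cuts_if_proportional[OF L N tx tx' 2])
    \<comment> \<open>The window for \<open>(a', c s\<^sub>2)\<close> is contained in \<open>c\<close> times the window for \<open>(a\<^sub>2, s\<^sub>2)\<close>, so an
      approximation of \<open>cv'\<close> in the former yields one of \<open>v'\<close> in the latter, which contains none.\<close>
    obtain a' where a': "a' \<in> A" "a2 = c \<otimes> a'" using pc bad2(1) unfolding preserves_cuts_def by blast
    have cs: "c \<otimes> s2 \<in> carrier R - B" using pc bad2(2) unfolding preserves_cuts_def by auto
    obtain d t where dt: "d \<in> A" "t \<in> carrier R - B"
      and sub': "\<And>H. submodule H R M \<Longrightarrow> window H d t \<subseteq> window H a' (c \<otimes> s2) \<and> window H d t \<subseteq> window H a s"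
      using window_common_refinement[OF A B a'(1) as(1) cs as(2)] by blast
    obtain y where y: "y \<in> window L d t" "congruent_mod ?Q v y" using appr(1) dt unfolding approximable_def by blast
    obtain y' where y': "y' \<in> window L d t" "congruent_mod ?Q' v' y'" using appr' dt unfolding approximable_def by blast
    have yM: "y \<in> carrier M" "y' \<in> carrier M" using y y' cL(1) by (auto simp: window_def)
    have yas: "y \<in> window L a s" "y' \<in> window L a s" using y y' sub'[OF L] by auto
    obtain e where e: "e \<in> carrier R" "congruent_mod N x (e \<odot>\<^bsub>M\<^esub> y)"
      using approximations_proportional[OF Q rd us asc bad x yas(1) y(2)] by blast
    obtain f where f: "f \<in> carrier R" "congruent_mod N y' (f \<odot>\<^bsub>M\<^esub> x')"
      using approximations_proportional[OF Q' rd us asc bad' yas(2) y'(2) x'] by blast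
    have "congruent_mod N (c \<odot>\<^bsub>M\<^esub> y') (c \<odot>\<^bsub>M\<^esub> (f \<odot>\<^bsub>M\<^esub> x'))" by (rule congruent_smult[OF N 2(1) f(2)])
    also have "c \<odot>\<^bsub>M\<^esub> (f \<odot>\<^bsub>M\<^esub> x') = f \<odot>\<^bsub>M\<^esub> (c \<odot>\<^bsub>M\<^esub> x')" by (rule smult_left_commute[OF 2(1) f(1) xM(4)])
    finally have 3: "congruent_mod N (c \<odot>\<^bsub>M\<^esub> y') (f \<odot>\<^bsub>M\<^esub> (c \<odot>\<^bsub>M\<^esub> x'))" .
    have 4: "congruent_mod N (f \<odot>\<^bsub>M\<^esub> (c \<odot>\<^bsub>M\<^esub> x')) (f \<odot>\<^bsub>M\<^esub> (e \<odot>\<^bsub>M\<^esub> y))"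
      by (rule congruent_smult[OF N f(1) congruent_trans[OF N congruent_sym[OF N 2(2)] e(2)]])
    have 5: "congruent_mod N (c \<odot>\<^bsub>M\<^esub> y') ((f \<otimes> e) \<odot>\<^bsub>M\<^esub> y)"
      using congruent_trans[OF N 3 4] f e yM by (simp add: smult_assoc1)
    define h where "h = c \<odot>\<^bsub>M\<^esub> y' \<ominus>\<^bsub>M\<^esub> (f \<otimes> e) \<odot>\<^bsub>M\<^esub> y"
    have h: "h \<in> window N d t" "congruent_mod ?Q' (c \<odot>\<^bsub>M\<^esub> v') h"
      using key[OF h_def 5 y y'] f e 2 dt AR by auto
    have "h \<in> window N a' (c \<otimes> s2)" using h sub'[OF N] by blast
    then obtain z where z: "z \<in> N" "h = (c \<otimes> s2) \<odot>\<^bsub>M\<^esub> z" "a' \<odot>\<^bsub>M\<^esub> h = \<zero>\<^bsub>M\<^esub>" by (auto simp: window_def)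
    have zM: "z \<in> carrier M" using z cN by blast
    let ?g = "s2 \<odot>\<^bsub>M\<^esub> z"
    have hg: "h = c \<odot>\<^bsub>M\<^esub> ?g" using z 2 bad2 zM by (simp add: smult_assoc1)
    have "a2 \<odot>\<^bsub>M\<^esub> ?g = a' \<odot>\<^bsub>M\<^esub> h"
      unfolding hg a'(2) using a' AR 2 bad2 zM by (simp add: m_comm[of c] smult_assoc1)
    then have g: "?g \<in> window N a2 s2" using z(1,3) cN(6)[of s2 z] bad2(2) unfolding window_def by auto
    have "c \<odot>\<^bsub>M\<^esub> (v' \<ominus>\<^bsub>M\<^esub> ?g) \<in> ?Q'"
      using h(2) 2 zM bad2 v unfolding hg by (simp add: congruent_mod_def smult_diff_right)
    then have "v' \<ominus>\<^bsub>M\<^esub> ?g \<in> ?Q'"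
      using negligible_cancel[OF A B K(2) pc] v zM bad2 by simp
    then have "congruent_mod ?Q' v' ?g" using v zM bad2 by (simp add: congruent_mod_def)
    then show False using bad2 g by blast
  qed
qed

section \<open>Counting the factors of a given type\<close>

lemma relatively_divisible_restrict:
  assumes "relatively_divisible N (carrier M)" "submodule L R M" "N \<subseteq> L"
  shows "relatively_divisible N L"
  using assms submodule_closed(1)[OF assms(2)] unfolding relatively_divisible_def by blast

definition divisible_series :: "(nat \<Rightarrow> 'c set) \<Rightarrow> nat \<Rightarrow> bool" where
  "divisible_series S n \<longleftrightarrow> S 0 = {\<zero>\<^bsub>M\<^esub>} \<and> S n = carrier M \<and>
     (\<forall>k\<le>n. relatively_divisible (S k) (carrier M)) \<and>
     (\<forall>k\<in>{1..n}. S (k - 1) \<subseteq> S k \<and> uniserial_factor (S k) (S (k - 1)))"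

lemma divisible_series_step:
  assumes "divisible_series S n" "k \<in> {1..n}"
  shows "submodule (S k) R M" "submodule (S (k - 1)) R M" "S (k - 1) \<subseteq> S k"
    and "uniserial_factor (S k) (S (k - 1))" "relatively_divisible (S (k - 1)) (S k)"
    and "relatively_divisible (S k) (carrier M)" "relatively_divisible (S (k - 1)) (carrier M)"
proof -
  have le: "k \<le> n" "k - 1 \<le> n" using assms(2) by auto
  show rd: "relatively_divisible (S k) (carrier M)" "relatively_divisible (S (k - 1)) (carrier M)"
    using assms(1) le unfolding divisible_series_def by blast+
  show sub: "submodule (S k) R M" "submodule (S (k - 1)) R M"
    using rd unfolding relatively_divisible_def by blast+
  show incl: "S (k - 1) \<subseteq> S k" "uniserial_factor (S k) (S (k - 1))"
    using assms unfolding divisible_series_def by blast+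
  show "relatively_divisible (S (k - 1)) (S k)"
    by (rule relatively_divisible_restrict[OF rd(2) sub(1) incl(1)])
qed

lemma divisible_series_mono:
  assumes "divisible_series S n" "i \<le> j" "j \<le> n"
  shows "S i \<subseteq> S j"
  using assms(2,3)
proof (induction j rule: dec_induct)
  case (step j)
  then have "S j \<subseteq> S (Suc j)" using assms(1) unfolding divisible_series_def by force
  with step show ?case by simp
qed simp

text \<open>
  Each factor of \<open>T\<close> with the given type is sent to the first index of \<open>S\<close> from which a representing
  element can be approximated; the results of the previous section say that the factor of \<open>S\<close> at
  that index has the type and that the assignment is injective.
\<close>

lemma card_factors_of_type_le:
  assumes S: "divisible_series S n" and T: "divisible_series T m"
  shows "card {j \<in> {1..m}. \<exists>v. type_at (T j) (T (j - 1)) v A B}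
    \<le> card {k \<in> {1..n}. \<exists>w. type_at (S k) (S (k - 1)) w A B}" (is "card ?J \<le> card ?I")
proof -
  have "\<exists>v. \<forall>j\<in>?J. type_at (T j) (T (j - 1)) (v j) A B" by (rule bchoice) blast
  then obtain v where v: "\<And>j. j \<in> ?J \<Longrightarrow> type_at (T j) (T (j - 1)) (v j) A B" by blast
  define reach where "reach j k \<longleftrightarrow> approximable A B (negligible A B (T (j - 1))) (v j) (S k)" for j k
  define level where "level j = (LEAST k. reach j k)" for j
  have sn: "S 0 = {\<zero>\<^bsub>M\<^esub>}" "S n = carrier M" using S by (auto simp: divisible_series_def)
  have J: "proper_cut A \<and> proper_cut B \<and> v j \<in> T j \<and> v j \<in> carrier M \<and> level j \<in> {1..n} \<and>
      reach j (level j) \<and> \<not> reach j (level j - 1)" if j: "j \<in> ?J" for j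
  proof -
    have j': "j \<in> {1..m}" using j by simp
    note st = divisible_series_step[OF T j']
    note cuts = type_at_proper_cuts[OF st(1,2) v[OF j]]
    have vT: "v j \<in> T j" using v[OF j] by (simp add: type_at_def)
    have vM: "v j \<in> carrier M" by (rule submodule_closed(1)[OF st(1) vT])
    note Q = negligible_submodule[OF cuts st(2)]
    \<comment> \<open>Each single window condition lifts along \<open>M \<rightarrow> M/T\<^sub>j\<^sub>-\<^sub>1\<close>.\<close>
    have "reach j n"
      unfolding reach_def approximable_def sn
    proof (intro ballI)
      fix a s assume a: "a \<in> A" and s: "s \<in> carrier R - B"
      have av: "a \<in> carrier R" "a \<odot>\<^bsub>M\<^esub> v j \<in> T (j - 1)" using v[OF j] a by (auto simp: type_at_def)
      obtain z where z: "z \<in> T j" "congruent_mod (T (j - 1)) (v j) (s \<odot>\<^bsub>M\<^esub> z)"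
        using v[OF j] s unfolding type_at_def by blast
      obtain x where "x \<in> window (carrier M) a s" "congruent_mod (T (j - 1)) (v j) x"
        using window_lift[OF st(7) av(1) _ submodule_closed(1)[OF st(1) z(1)] z(2) av(2)] s by blast
      then show "\<exists>x\<in>window (carrier M) a s. congruent_mod (negligible A B (T (j - 1))) (v j) x"
        using congruent_mono negligible_contains[OF cuts st(2)] by blast
    qed
    then have reach: "reach j (level j)" and le: "level j \<le> n"
      unfolding level_def by (rule LeastI, rule Least_le)
    have "\<not> reach j 0"
    proof
      assume "reach j 0"
      moreover have "\<zero> \<in> A" "\<one> \<in> carrier R - B" using cuts by (auto simp: proper_cut_def)
      ultimately obtain x where "x \<in> window {\<zero>\<^bsub>M\<^esub>} \<zero> \<one>" "congruent_mod (negligible A B (T (j - 1))) (v j) x"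
        unfolding reach_def approximable_def sn by blast
      then have "v j \<in> negligible A B (T (j - 1))"
        using congruent_zero_iff[OF Q vM] by (auto simp: window_def)
      then show False using type_at_not_negligible[OF st(6,2,3,4) v[OF j]] by simp
    qed
    then have pos: "level j \<noteq> 0" using reach by metis
    then have "\<not> reach j (level j - 1)" using not_less_Least[of "level j - 1" "reach j"] unfolding level_def by simp
    then show ?thesis using cuts vT vM reach le pos by simp
  qed
  have img: "level ` ?J \<subseteq> ?I"
  proof (rule image_subsetI)
    fix j assume j: "j \<in> ?J"
    then have j': "j \<in> {1..m}" by simp
    from J[OF j] have cuts: "proper_cut A" "proper_cut B" and k: "level j \<in> {1..n}"
      and r: "reach j (level j)" "\<not> reach j (level j - 1)" by auto
    obtain a s where as: "a \<in> A" "s \<in> carrier R - B"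
      "\<not> (\<exists>y\<in>window (S (level j - 1)) a s. congruent_mod (negligible A B (T (j - 1))) (v j) y)"
      using r(2) unfolding reach_def approximable_def by blast
    obtain x where x: "x \<in> window (S (level j)) a s" "congruent_mod (negligible A B (T (j - 1))) (v j) x"
      using r(1) as(1,2) unfolding reach_def approximable_def by blast
    note sS = divisible_series_step[OF S k]
    show "level j \<in> ?I"
      using approximation_has_type[OF cuts divisible_series_step(2)[OF T j'] sS(5,4) as r(1)[unfolded reach_def] x] k
      by blast
  qed
  have less: "level i \<noteq> level j" if i: "i \<in> ?J" and j: "j \<in> ?J" and ij: "i < j" for i j
  proof
    assume eq: "level i = level j"
    have i': "i \<in> {1..m}" and j': "j \<in> {1..m}" using i j by auto
    have k: "level j \<in> {1..n}" and cuts: "proper_cut A" "proper_cut B" and vi: "v i \<in> T i"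
      and vj: "v j \<in> carrier M"
      and r: "reach i (level j)" "\<not> reach i (level j - 1)" "reach j (level j)" "\<not> reach j (level j - 1)"
      using J[OF i] J[OF j] unfolding eq by blast+
    have sub: "T i \<subseteq> T (j - 1)" "T (i - 1) \<subseteq> T (j - 1)"
      using divisible_series_mono[OF T] ij i' j' by auto
    note sS = divisible_series_step[OF S k]
    show False
      using approximation_levels_distinct[OF cuts divisible_series_step(2)[OF T i']
          divisible_series_step(2)[OF T j'] sub(2) subsetD[OF sub(1) vi] vj sS(5,4)
          r(1,2,3)[unfolded reach_def]] r(4)
      unfolding reach_def by blast
  qed
  have "inj_on level ?J"
  proof (rule inj_onI, rule ccontr)
    fix i j assume i: "i \<in> ?J" and j: "j \<in> ?J" and eq: "level i = level j" and "i \<noteq> j"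
    then consider "i < j" | "j < i" by linarith
    then show False using less[OF i j] less[OF j i] eq by cases simp_all
  qed
  then show ?thesis using card_inj_on_le[OF _ img] by simp
qed

section \<open>Countable generation\<close>

lemma submodule_generated_submodule:
  assumes "G \<subseteq> carrier M"
  shows "submodule (submodule_generated R M G) R M" "G \<subseteq> submodule_generated R M G"
proof -
  show "G \<subseteq> submodule_generated R M G" unfolding submodule_generated_def by blast
  have c: "carrier M \<in> {H. submodule H R M \<and> G \<subseteq> H}" using submodule_carrier assms by simp
  show "submodule (submodule_generated R M G) R M"
    unfolding submodule_generated_def
  proof (rule submodule_if_closed)
    show "\<Inter> {H. submodule H R M \<and> G \<subseteq> H} \<subseteq> carrier M" using c by blast
  qed (auto dest: submodule_closed)
qed

lemma submodule_generated_least: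
  "\<lbrakk>submodule H R M; G \<subseteq> H\<rbrakk> \<Longrightarrow> submodule_generated R M G \<subseteq> H"
  unfolding submodule_generated_def by blast

text \<open>
  When the generators are pairwise comparable modulo \<open>H\<close>, their multiples are closed under addition.
\<close>

lemma generated_multiple_of_generator:
  assumes H: "submodule H R M" and G: "G \<subseteq> carrier M" "G \<noteq> {}"
    and comp: "\<And>g h. \<lbrakk>g \<in> G; h \<in> G\<rbrakk> \<Longrightarrow>
      (\<exists>c\<in>carrier R. congruent_mod H g (c \<odot>\<^bsub>M\<^esub> h)) \<or> (\<exists>c\<in>carrier R. congruent_mod H h (c \<odot>\<^bsub>M\<^esub> g))"
    and x: "x \<in> submodule_generated R M G"
  shows "\<exists>g\<in>G. \<exists>c\<in>carrier R. congruent_mod H x (c \<odot>\<^bsub>M\<^esub> g)"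
proof -
  let ?P = "{x \<in> carrier M. \<exists>g\<in>G. \<exists>c\<in>carrier R. congruent_mod H x (c \<odot>\<^bsub>M\<^esub> g)}"
  have GM: "g \<in> carrier M" if "g \<in> G" for g using that G by blast
  have mul: "congruent_mod H x ((a \<otimes> c) \<odot>\<^bsub>M\<^esub> h)"
    if "congruent_mod H x (a \<odot>\<^bsub>M\<^esub> g)" "congruent_mod H g (c \<odot>\<^bsub>M\<^esub> h)" "a \<in> carrier R" "c \<in> carrier R" "h \<in> G"
    for x a g c h
    using congruent_trans[OF H that(1) congruent_smult[OF H that(3,2)]] that GM by (simp add: smult_assoc1)
  have "submodule ?P R M"
  proof (rule submodule_if_closed)
    obtain g where g: "g \<in> G" using G by blast
    then have "congruent_mod H \<zero>\<^bsub>M\<^esub> (\<zero> \<odot>\<^bsub>M\<^esub> g)" using GM congruent_refl[OF H] by simp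
    then show "\<zero>\<^bsub>M\<^esub> \<in> ?P" using g by blast
    fix x y assume x: "x \<in> ?P" and y: "y \<in> ?P"
    obtain g a where g: "g \<in> G" "a \<in> carrier R" "congruent_mod H x (a \<odot>\<^bsub>M\<^esub> g)" using x by blast
    obtain h b where h: "h \<in> G" "b \<in> carrier R" "congruent_mod H y (b \<odot>\<^bsub>M\<^esub> h)" using y by blast
    have "\<exists>k\<in>G. \<exists>a\<in>carrier R. \<exists>b\<in>carrier R. congruent_mod H x (a \<odot>\<^bsub>M\<^esub> k) \<and> congruent_mod H y (b \<odot>\<^bsub>M\<^esub> k)"
      using comp[OF g(1) h(1)] mul[OF g(3) _ g(2) _ h(1)] mul[OF h(3) _ h(2) _ g(1)] g h m_closed by meson
    then obtain k a b where k: "k \<in> G" "a \<in> carrier R" "b \<in> carrier R"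
      "congruent_mod H x (a \<odot>\<^bsub>M\<^esub> k)" "congruent_mod H y (b \<odot>\<^bsub>M\<^esub> k)" by blast
    have "congruent_mod H (x \<oplus>\<^bsub>M\<^esub> y) ((a \<oplus> b) \<odot>\<^bsub>M\<^esub> k)"
      using congruent_add[OF H k(4,5)] k GM by (simp add: smult_l_distr)
    then show "x \<oplus>\<^bsub>M\<^esub> y \<in> ?P" using x y k by blast
  next
    fix r x assume r: "r \<in> carrier R" and x: "x \<in> ?P"
    obtain g a where g: "g \<in> G" "a \<in> carrier R" "congruent_mod H x (a \<odot>\<^bsub>M\<^esub> g)" using x by blast
    have "congruent_mod H (r \<odot>\<^bsub>M\<^esub> x) ((r \<otimes> a) \<odot>\<^bsub>M\<^esub> g)"
      using congruent_smult[OF H r g(3)] r g GM by (simp add: smult_assoc1)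
    then show "r \<odot>\<^bsub>M\<^esub> x \<in> ?P" using x r g by blast
  qed blast
  moreover have "G \<subseteq> ?P"
  proof
    fix g assume g: "g \<in> G"
    then have "congruent_mod H g (\<one> \<odot>\<^bsub>M\<^esub> g)" using GM congruent_refl[OF H] by simp
    then show "g \<in> ?P" using g GM by blast
  qed
  ultimately show ?thesis using submodule_generated_least x by blast
qed

definition countably_generated_by :: "'c set \<Rightarrow> bool" where
  "countably_generated_by L \<longleftrightarrow> (\<exists>G. countable G \<and> G \<subseteq> L \<and> submodule_generated R M G = L)"

lemma countable_generators_with_zero:
  assumes L: "submodule L R M" and "countably_generated_by L"
  shows "\<exists>G. countable G \<and> G \<subseteq> L \<and> \<zero>\<^bsub>M\<^esub> \<in> G \<and> submodule_generated R M G = L"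
proof -
  obtain G where G: "countable G" "G \<subseteq> L" "submodule_generated R M G = L"
    using assms(2) unfolding countably_generated_by_def by blast
  have sub: "insert \<zero>\<^bsub>M\<^esub> G \<subseteq> L" using G submodule_closed(2)[OF L] by blast
  have "insert \<zero>\<^bsub>M\<^esub> G \<subseteq> carrier M" using sub submodule_closed(1)[OF L] by blast
  note gen = submodule_generated_submodule[OF this]
  have "submodule_generated R M (insert \<zero>\<^bsub>M\<^esub> G) = L"
    using submodule_generated_least[OF L sub] submodule_generated_least[OF gen(1), of G] gen(2) G(3) by blast
  then show ?thesis using G sub by blast
qed

lemma countable_chain_mod:
  assumes L: "submodule L R M" and N: "submodule N R M"
    and us: "uniserial_factor L N" and cg: "countably_generated_by L"
  shows "\<exists>g :: nat \<Rightarrow> 'c. (\<forall>i. g i \<in> L) \<and> (\<forall>x\<in>L. \<exists>i. \<exists>c\<in>carrier R. congruent_mod N x (c \<odot>\<^bsub>M\<^esub> g i))"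
proof -
  obtain G where G: "countable G" "G \<subseteq> L" "\<zero>\<^bsub>M\<^esub> \<in> G" "submodule_generated R M G = L"
    using countable_generators_with_zero[OF L cg] by blast
  have GM: "G \<subseteq> carrier M" "G \<noteq> {}" using G submodule_closed(1)[OF L] by blast+
  have "\<exists>g\<in>G. \<exists>c\<in>carrier R. congruent_mod N x (c \<odot>\<^bsub>M\<^esub> g)" if "x \<in> L" for x
    by (rule generated_multiple_of_generator[OF N GM])
      (use us G(2,4) that in \<open>auto simp: uniserial_factor_def\<close>)
  moreover have "range (from_nat_into G) = G" using G GM by (simp add: range_from_nat_into)
  ultimately show ?thesis using G(2) by (intro exI[of _ "from_nat_into G"]) (metis rangeE range_eqI subsetD)
qed

text \<open>
  Let \<open>G\<close> be a countable generating set of \<open>L\<close> containing \<open>0\<close>. Whenever \<open>g \<equiv> ch\<close> modulo \<open>N\<close> for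
  \<open>g, h \<in> G\<close>, put one difference \<open>g - ch\<close> into \<open>D\<close>, and let \<open>N\<^sub>0\<close> be the submodule generated by the
  countable set \<open>D\<close>. Then any two elements of \<open>L\<close> are comparable already modulo \<open>N\<^sub>0\<close>, and every
  element of \<open>N\<close> is congruent modulo \<open>N\<^sub>0\<close> to some \<open>ag\<close> with \<open>g \<in> G\<close>. Relative divisibility gives
  \<open>ag = ay\<close> with \<open>y \<in> N\<close>. Unless \<open>g \<in> N\<close>, comparability gives \<open>y \<equiv> fg\<close> with \<open>f\<close> a non-unit, and
  \<open>a(1 - f)g \<in> N\<^sub>0\<close> yields \<open>ag \<in> N\<^sub>0\<close>. So \<open>N = N\<^sub>0\<close>, even if the annihilator of the class of \<open>g\<close> in
  \<open>L/N\<close> is not countably generated.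
\<close>

lemma countably_generated_kernel:
  assumes rd: "relatively_divisible N L" and us: "uniserial_factor L N" and cg: "countably_generated_by L"
  shows "countably_generated_by N"
proof -
  have N: "submodule N R M" and L: "submodule L R M" and NL: "N \<subseteq> L"
    using rd by (auto simp: relatively_divisible_def)
  note cN = submodule_closed[OF N]
  obtain G where G: "countable G" "G \<subseteq> L" "\<zero>\<^bsub>M\<^esub> \<in> G" "submodule_generated R M G = L"
    using countable_generators_with_zero[OF L cg] by blast
  have GM: "G \<subseteq> carrier M" "G \<noteq> {}" using G submodule_closed(1)[OF L] by blast+
  have GMe: "g \<in> carrier M" if "g \<in> G" for g using that GM by blast
  define rel where "rel g h c \<longleftrightarrow> c \<in> carrier R \<and> congruent_mod N g (c \<odot>\<^bsub>M\<^esub> h)" for g h c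
  define coef where "coef g h = (SOME c. rel g h c)" for g h
  define D where "D = (\<lambda>(g, h). g \<ominus>\<^bsub>M\<^esub> coef g h \<odot>\<^bsub>M\<^esub> h) ` {(g, h) \<in> G \<times> G. \<exists>c. rel g h c}"
  have coef: "rel g h (coef g h)" if "rel g h c" for g h c
    unfolding coef_def by (rule someI[of _ c]) (rule that)
  have DN: "D \<subseteq> N" unfolding D_def using coef by (auto simp: rel_def congruent_mod_def)
  have DM: "D \<subseteq> carrier M" using DN cN(1) by blast
  let ?N0 = "submodule_generated R M D"
  note N0 = submodule_generated_submodule(1)[OF DM]
  note cN0 = submodule_closed[OF N0]
  have N0N: "?N0 \<subseteq> N" by (rule submodule_generated_least[OF N DN])
  have rel0: "\<exists>c\<in>carrier R. congruent_mod ?N0 g (c \<odot>\<^bsub>M\<^esub> h)" if "g \<in> G" "h \<in> G" "rel g h c" for g h c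
  proof -
    have "g \<ominus>\<^bsub>M\<^esub> coef g h \<odot>\<^bsub>M\<^esub> h \<in> ?N0"
      using submodule_generated_submodule(2)[OF DM] that unfolding D_def by blast
    then show ?thesis using coef[OF that(3)] that GMe unfolding rel_def
      by (intro bexI[of _ "coef g h"]) (auto simp: congruent_mod_def)
  qed
  have comp: "(\<exists>c\<in>carrier R. congruent_mod ?N0 g (c \<odot>\<^bsub>M\<^esub> h)) \<or> (\<exists>c\<in>carrier R. congruent_mod ?N0 h (c \<odot>\<^bsub>M\<^esub> g))"
    if gh: "g \<in> G" "h \<in> G" for g h
  proof -
    have "(\<exists>c. rel g h c) \<or> (\<exists>c. rel h g c)"
      using us gh G(2) unfolding uniserial_factor_def rel_def by blast
    then show ?thesis using rel0 gh by blast
  qed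
  have mult: "\<exists>g\<in>G. \<exists>c\<in>carrier R. congruent_mod ?N0 x (c \<odot>\<^bsub>M\<^esub> g)" if "x \<in> L" for x
    by (rule generated_multiple_of_generator[OF N0 GM comp]) (use G(4) that in auto)
  have gN: "g \<in> ?N0" if g: "g \<in> G" "g \<in> N" for g
  proof -
    \<comment> \<open>The presence of \<open>0\<close> in \<open>G\<close> puts \<open>g\<close> itself into \<open>D\<close>.\<close>
    have "rel g \<zero>\<^bsub>M\<^esub> \<one>" using g GMe congruent_zero_iff[OF N] by (simp add: rel_def)
    from rel0[OF g(1) G(3) this] show ?thesis using congruent_zero_iff[OF N0] GMe[OF g(1)] by auto
  qed
  have "x \<in> ?N0" if x: "x \<in> N" for x
  proof -
    obtain g a where g: "g \<in> G" "a \<in> carrier R" "congruent_mod ?N0 x (a \<odot>\<^bsub>M\<^esub> g)" using mult x NL by blast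
    have ag: "a \<odot>\<^bsub>M\<^esub> g \<in> N" using congruent_mem_iff[OF N congruent_mono[OF g(3) N0N]] x by simp
    have "a \<odot>\<^bsub>M\<^esub> g \<in> ?N0"
    proof (cases "g \<in> N")
      case True then show ?thesis using cN0(6)[OF g(2) gN[OF g(1)]] by simp
    next
      case False
      obtain y where y: "y \<in> N" "a \<odot>\<^bsub>M\<^esub> g = a \<odot>\<^bsub>M\<^esub> y"
        using rd g ag G(2) unfolding relatively_divisible_def by blast
      obtain h b where h: "h \<in> G" "b \<in> carrier R" "congruent_mod ?N0 y (b \<odot>\<^bsub>M\<^esub> h)" using mult y NL by blast
      have gM: "g \<in> carrier M" and hM: "h \<in> carrier M" using g h GMe by auto
      have notmult: False if "c \<in> carrier R" "congruent_mod ?N0 g (c \<odot>\<^bsub>M\<^esub> y)" for c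
        using congruent_mem_iff[OF N congruent_mono[OF that(2) N0N]] False cN(6)[OF that(1) y(1)] by simp
      have "\<exists>f\<in>carrier R. congruent_mod ?N0 y (f \<odot>\<^bsub>M\<^esub> g)"
      proof (rule disjE[OF comp[OF g(1) h(1)]])
        assume "\<exists>c\<in>carrier R. congruent_mod ?N0 h (c \<odot>\<^bsub>M\<^esub> g)"
        then obtain c where c: "c \<in> carrier R" "congruent_mod ?N0 h (c \<odot>\<^bsub>M\<^esub> g)" by blast
        have "congruent_mod ?N0 y ((b \<otimes> c) \<odot>\<^bsub>M\<^esub> g)"
          using congruent_trans[OF N0 h(3) congruent_smult[OF N0 h(2) c(2)]] h c gM by (simp add: smult_assoc1)
        then show ?thesis using h c by blast
      next
        assume "\<exists>c\<in>carrier R. congruent_mod ?N0 g (c \<odot>\<^bsub>M\<^esub> h)"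
        then obtain c where c: "c \<in> carrier R" "congruent_mod ?N0 g (c \<odot>\<^bsub>M\<^esub> h)" by blast
        show ?thesis
        proof (rule disjE[OF divides_total[OF c(1) h(2)]])
          assume "\<exists>e\<in>carrier R. c = b \<otimes> e"
          then obtain e where e: "e \<in> carrier R" "c = b \<otimes> e" by blast
          have "c \<odot>\<^bsub>M\<^esub> h = e \<odot>\<^bsub>M\<^esub> (b \<odot>\<^bsub>M\<^esub> h)" using e h hM by (simp add: m_comm[of b] smult_assoc1)
          then have "congruent_mod ?N0 g (e \<odot>\<^bsub>M\<^esub> y)"
            using congruent_trans[OF N0 c(2)] congruent_sym[OF N0 congruent_smult[OF N0 e(1) h(3)]] by simp
          then show ?thesis using notmult e by blast
        next
          assume "\<exists>e\<in>carrier R. b = c \<otimes> e"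
          then obtain e where e: "e \<in> carrier R" "b = c \<otimes> e" by blast
          have "b \<odot>\<^bsub>M\<^esub> h = e \<odot>\<^bsub>M\<^esub> (c \<odot>\<^bsub>M\<^esub> h)" using e c hM by (simp add: m_comm[of c] smult_assoc1)
          then have "congruent_mod ?N0 y (e \<odot>\<^bsub>M\<^esub> g)"
            using congruent_trans[OF N0 h(3)] congruent_sym[OF N0 congruent_smult[OF N0 e(1) c(2)]] by simp
          then show ?thesis using e by blast
        qed
      qed
      then obtain f where f: "f \<in> carrier R" "congruent_mod ?N0 y (f \<odot>\<^bsub>M\<^esub> g)" by blast
      have "f \<notin> Units R" using congruent_unit_solve[OF N0 _ f(2) gM] notmult[of "inv f"] by auto
      then have u: "\<one> \<ominus> f \<in> Units R" using unit_or_one_minus_unit f by blast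
      have "congruent_mod ?N0 (a \<odot>\<^bsub>M\<^esub> g) (a \<odot>\<^bsub>M\<^esub> (f \<odot>\<^bsub>M\<^esub> g))"
        unfolding y(2) by (rule congruent_smult[OF N0 g(2) f(2)])
      then have "a \<odot>\<^bsub>M\<^esub> (g \<ominus>\<^bsub>M\<^esub> f \<odot>\<^bsub>M\<^esub> g) \<in> ?N0"
        using g f gM by (simp add: congruent_mod_def smult_diff_right)
      also have "a \<odot>\<^bsub>M\<^esub> (g \<ominus>\<^bsub>M\<^esub> f \<odot>\<^bsub>M\<^esub> g) = (\<one> \<ominus> f) \<odot>\<^bsub>M\<^esub> (a \<odot>\<^bsub>M\<^esub> g)"
        using smult_diff_left[of \<one> f g] smult_left_commute[of a "\<one> \<ominus> f" g] g f gM by simp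
      finally show ?thesis using unit_smult_mem_iff[OF N0 u] g gM by simp
    qed
    then show ?thesis using congruent_mem_iff[OF N0 g(3)] by simp
  qed
  then have "?N0 = N" using N0N by blast
  moreover have "countable D"
    unfolding D_def by (rule countable_image, rule countable_subset[of _ "G \<times> G"]) (use G in auto)
  ultimately show ?thesis using DN unfolding countably_generated_by_def by blast
qed

end

section \<open>Uniserial modules with a common type\<close>

definition element_type :: "('a, 'r) ring_scheme \<Rightarrow> ('a, 'b, 'm) module_scheme \<Rightarrow> 'b \<Rightarrow> 'a set \<times> 'a set" where
  "element_type R U u =
     ({r \<in> carrier R. r \<odot>\<^bsub>U\<^esub> u = \<zero>\<^bsub>U\<^esub>}, {r \<in> carrier R. \<forall>z\<in>carrier U. u \<noteq> r \<odot>\<^bsub>U\<^esub> z})"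

definition types :: "('a, 'r) ring_scheme \<Rightarrow> ('a, 'b, 'm) module_scheme \<Rightarrow> ('a set \<times> 'a set) set" where
  "types R U = element_type R U ` (carrier U - {\<zero>\<^bsub>U\<^esub>})"

lemma types_isomorphic:
  assumes U: "module R U" and V: "module R V" and iso: "module_isomorphic R U V"
  shows "types R U = types R V"
proof -
  interpret U: module R U by fact
  interpret V: module R V by fact
  obtain f where f: "f \<in> module_hom R U V" and bij: "bij_betw f (carrier U) (carrier V)"
    using iso unfolding module_isomorphic_def by blast
  note fh = module_homD[OF f]
  have img: "f ` carrier U = carrier V" and inj: "inj_on f (carrier U)" using bij by (auto simp: bij_betw_def)
  have f0: "f \<zero>\<^bsub>U\<^esub> = \<zero>\<^bsub>V\<^esub>"
    using fh(3)[of "\<zero>\<^bsub>R\<^esub>" "\<zero>\<^bsub>U\<^esub>"] fh(1)[of "\<zero>\<^bsub>U\<^esub>"] by simp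
  have eq0: "f x = \<zero>\<^bsub>V\<^esub> \<longleftrightarrow> x = \<zero>\<^bsub>U\<^esub>" if "x \<in> carrier U" for x
    using inj_on_eq_iff[OF inj that U.zero_closed] f0 by simp
  have et: "element_type R V (f u) = element_type R U u" if u: "u \<in> carrier U" for u
  proof -
    have "r \<odot>\<^bsub>V\<^esub> f u = \<zero>\<^bsub>V\<^esub> \<longleftrightarrow> r \<odot>\<^bsub>U\<^esub> u = \<zero>\<^bsub>U\<^esub>" if "r \<in> carrier R" for r
      using eq0[of "r \<odot>\<^bsub>U\<^esub> u"] fh(3) that u by simp
    moreover have "(\<forall>z\<in>carrier V. f u \<noteq> r \<odot>\<^bsub>V\<^esub> z) \<longleftrightarrow> (\<forall>z\<in>carrier U. u \<noteq> r \<odot>\<^bsub>U\<^esub> z)"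
      if r: "r \<in> carrier R" for r
    proof -
      have "f u = r \<odot>\<^bsub>V\<^esub> f z \<longleftrightarrow> u = r \<odot>\<^bsub>U\<^esub> z" if "z \<in> carrier U" for z
        using inj_on_eq_iff[OF inj u, of "r \<odot>\<^bsub>U\<^esub> z"] fh(3)[OF r that] r that by simp
      then show ?thesis unfolding img[symmetric] by simp
    qed
    ultimately show ?thesis unfolding element_type_def by auto
  qed
  have "carrier V - {\<zero>\<^bsub>V\<^esub>} = f ` (carrier U - {\<zero>\<^bsub>U\<^esub>})" using img eq0 by auto
  then show ?thesis unfolding types_def using et by (auto simp: image_image)
qed

context valuation_module begin

lemma diff_zero_iff:
  assumes "x \<in> carrier M" "y \<in> carrier M"
  shows "x \<ominus>\<^bsub>M\<^esub> y = \<zero>\<^bsub>M\<^esub> \<longleftrightarrow> x = y"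
  using assms M.minus_equality[of x "\<ominus>\<^bsub>M\<^esub> y"] by (auto simp: M.minus_eq M.r_neg)

text \<open>
  If \<open>rq = 0\<close> and \<open>tq \<noteq> 0\<close>, then \<open>r\<close> is a multiple of \<open>t\<close>; and if \<open>tq = trz \<noteq> 0\<close>, then \<open>q\<close> is a
  multiple of \<open>rz\<close>, since \<open>rz = cq\<close> is possible only with a unit \<open>c\<close>. Consequently, elements of
  equal type that are divided by the same scalar still have equal type, which is what the
  back-and-forth construction rests on.
\<close>

lemma element_type_quotient:
  assumes comp: "\<And>x y. \<lbrakk>x \<in> carrier M; y \<in> carrier M\<rbrakk> \<Longrightarrow>
      (\<exists>c\<in>carrier R. x = c \<odot>\<^bsub>M\<^esub> y) \<or> (\<exists>c\<in>carrier R. y = c \<odot>\<^bsub>M\<^esub> x)"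
    and t: "t \<in> carrier R" and q: "q \<in> carrier M" and nz: "t \<odot>\<^bsub>M\<^esub> q \<noteq> \<zero>\<^bsub>M\<^esub>"
  shows "element_type R M q =
    ({r \<in> carrier R. \<exists>e\<in>fst (element_type R M (t \<odot>\<^bsub>M\<^esub> q)). r = t \<otimes> e},
     {r \<in> carrier R. t \<otimes> r \<in> snd (element_type R M (t \<odot>\<^bsub>M\<^esub> q))})"
proof -
  have ann: "r \<odot>\<^bsub>M\<^esub> q = \<zero>\<^bsub>M\<^esub> \<longleftrightarrow> (\<exists>e\<in>carrier R. e \<odot>\<^bsub>M\<^esub> (t \<odot>\<^bsub>M\<^esub> q) = \<zero>\<^bsub>M\<^esub> \<and> r = t \<otimes> e)" (is "?L \<longleftrightarrow> ?R")
    if r: "r \<in> carrier R" for r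
  proof
    assume L: ?L
    have "t \<noteq> r \<otimes> c" if "c \<in> carrier R" for c
    proof
      assume "t = r \<otimes> c"
      then have "t \<odot>\<^bsub>M\<^esub> q = c \<odot>\<^bsub>M\<^esub> (r \<odot>\<^bsub>M\<^esub> q)" using that r q by (simp add: m_comm[of r] smult_assoc1)
      then show False using nz L that by simp
    qed
    then obtain e where e: "e \<in> carrier R" "r = t \<otimes> e" using divides_total[OF r t] by blast
    have "e \<odot>\<^bsub>M\<^esub> (t \<odot>\<^bsub>M\<^esub> q) = r \<odot>\<^bsub>M\<^esub> q" using e t q by (simp add: m_comm[of t] smult_assoc1)
    then show ?R using L e by auto
  next
    assume ?R
    then obtain e where e: "e \<in> carrier R" "r = t \<otimes> e" "e \<odot>\<^bsub>M\<^esub> (t \<odot>\<^bsub>M\<^esub> q) = \<zero>\<^bsub>M\<^esub>" by blast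
    then show ?L using t q by (simp add: m_comm[of t] smult_assoc1)
  qed
  have div: "(\<exists>z\<in>carrier M. q = r \<odot>\<^bsub>M\<^esub> z) \<longleftrightarrow> (\<exists>z\<in>carrier M. t \<odot>\<^bsub>M\<^esub> q = (t \<otimes> r) \<odot>\<^bsub>M\<^esub> z)" (is "?L \<longleftrightarrow> ?R")
    if r: "r \<in> carrier R" for r
  proof
    assume ?L
    then show ?R using r t by (auto simp: smult_assoc1)
  next
    assume ?R
    then obtain z where z: "z \<in> carrier M" "t \<odot>\<^bsub>M\<^esub> q = t \<odot>\<^bsub>M\<^esub> (r \<odot>\<^bsub>M\<^esub> z)" using r t by (auto simp: smult_assoc1)
    have rz: "r \<odot>\<^bsub>M\<^esub> z \<in> carrier M" using r z by simp
    consider (1) c where "c \<in> carrier R" "q = c \<odot>\<^bsub>M\<^esub> (r \<odot>\<^bsub>M\<^esub> z)"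
      | (2) c where "c \<in> carrier R" "r \<odot>\<^bsub>M\<^esub> z = c \<odot>\<^bsub>M\<^esub> q" using comp[OF q rz] by blast
    then show ?L
    proof cases
      case 1
      then show ?thesis using r z by (intro bexI[of _ "c \<odot>\<^bsub>M\<^esub> z"]) (auto simp: smult_left_commute)
    next
      case 2
      have "(\<one> \<ominus> c) \<odot>\<^bsub>M\<^esub> (t \<odot>\<^bsub>M\<^esub> q) = t \<odot>\<^bsub>M\<^esub> q \<ominus>\<^bsub>M\<^esub> c \<odot>\<^bsub>M\<^esub> (t \<odot>\<^bsub>M\<^esub> q)"
        using smult_diff_left[of \<one> c "t \<odot>\<^bsub>M\<^esub> q"] 2 t q by simp
      also have "c \<odot>\<^bsub>M\<^esub> (t \<odot>\<^bsub>M\<^esub> q) = t \<odot>\<^bsub>M\<^esub> q"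
        using smult_left_commute[OF 2(1) t q] z(2) by (simp only: 2(2))
      finally have zero: "(\<one> \<ominus> c) \<odot>\<^bsub>M\<^esub> (t \<odot>\<^bsub>M\<^esub> q) = \<zero>\<^bsub>M\<^esub>" using t q by (simp add: M.minus_eq M.r_neg)
      have sz: "submodule {\<zero>\<^bsub>M\<^esub>} R M" by (rule submodule_if_closed) auto
      have "\<one> \<ominus> c \<notin> Units R"
        using unit_smult_mem_iff[OF sz, of "\<one> \<ominus> c" "t \<odot>\<^bsub>M\<^esub> q"] zero nz t q by auto
      then have u: "c \<in> Units R" using unit_or_one_minus_unit 2 by blast
      have "q = inv c \<odot>\<^bsub>M\<^esub> (c \<odot>\<^bsub>M\<^esub> q)" using u q by (simp flip: smult_assoc1 add: Units_closed)
      also have "\<dots> = r \<odot>\<^bsub>M\<^esub> (inv c \<odot>\<^bsub>M\<^esub> z)" unfolding 2(2)[symmetric] using u r z by (simp add: smult_left_commute)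
      finally show ?thesis using u z by (intro bexI[of _ "inv c \<odot>\<^bsub>M\<^esub> z"]) auto
    qed
  qed
  have ndiv: "(\<forall>z\<in>carrier M. q \<noteq> r \<odot>\<^bsub>M\<^esub> z) \<longleftrightarrow> (\<forall>z\<in>carrier M. t \<odot>\<^bsub>M\<^esub> q \<noteq> (t \<otimes> r) \<odot>\<^bsub>M\<^esub> z)"
    if "r \<in> carrier R" for r using div[OF that] by blast
  show ?thesis
    unfolding element_type_def fst_conv snd_conv prod.inject
  proof (intro conjI Collect_cong)
    show "(r \<in> carrier R \<and> r \<odot>\<^bsub>M\<^esub> q = \<zero>\<^bsub>M\<^esub>) =
      (r \<in> carrier R \<and> (\<exists>e\<in>{r \<in> carrier R. r \<odot>\<^bsub>M\<^esub> (t \<odot>\<^bsub>M\<^esub> q) = \<zero>\<^bsub>M\<^esub>}. r = t \<otimes> e))" for r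
      using ann by blast
    show "(r \<in> carrier R \<and> (\<forall>z\<in>carrier M. q \<noteq> r \<odot>\<^bsub>M\<^esub> z)) =
      (r \<in> carrier R \<and> t \<otimes> r \<in> {r \<in> carrier R. \<forall>z\<in>carrier M. t \<odot>\<^bsub>M\<^esub> q \<noteq> r \<odot>\<^bsub>M\<^esub> z})" for r
      using ndiv t by auto
  qed
qed

end

lemma same_type_extend:
  assumes U: "valuation_module R U" and V: "valuation_module R V"
    and compU: "\<And>x y. \<lbrakk>x \<in> carrier U; y \<in> carrier U\<rbrakk> \<Longrightarrow>
      (\<exists>c\<in>carrier R. x = c \<odot>\<^bsub>U\<^esub> y) \<or> (\<exists>c\<in>carrier R. y = c \<odot>\<^bsub>U\<^esub> x)"
    and compV: "\<And>x y. \<lbrakk>x \<in> carrier V; y \<in> carrier V\<rbrakk> \<Longrightarrow>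
      (\<exists>c\<in>carrier R. x = c \<odot>\<^bsub>V\<^esub> y) \<or> (\<exists>c\<in>carrier R. y = c \<odot>\<^bsub>V\<^esub> x)"
    and p: "p \<in> carrier U - {\<zero>\<^bsub>U\<^esub>}" and q: "q \<in> carrier V - {\<zero>\<^bsub>V\<^esub>}"
    and eq: "element_type R U p = element_type R V q" and x: "x \<in> carrier U"
  shows "\<exists>p'\<in>carrier U - {\<zero>\<^bsub>U\<^esub>}. \<exists>q'\<in>carrier V - {\<zero>\<^bsub>V\<^esub>}. \<exists>t\<in>carrier R.
    p = t \<odot>\<^bsub>U\<^esub> p' \<and> q = t \<odot>\<^bsub>V\<^esub> q' \<and> element_type R U p' = element_type R V q' \<and> (\<exists>c\<in>carrier R. x = c \<odot>\<^bsub>U\<^esub> p')"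
proof -
  interpret U: valuation_module R U by fact
  interpret V: valuation_module R V by fact
  consider (1) c where "c \<in> carrier R" "x = c \<odot>\<^bsub>U\<^esub> p" | (2) t where "t \<in> carrier R" "p = t \<odot>\<^bsub>U\<^esub> x"
    using compU[OF x, of p] p by blast
  then show ?thesis
  proof cases
    case 1
    then show ?thesis using p q eq
      by (intro bexI[of _ p] bexI[of _ q] bexI[of _ "\<one>\<^bsub>R\<^esub>"]) auto
  next
    case 2
    then have "t \<notin> snd (element_type R U p)" using x by (auto simp: element_type_def)
    then have "t \<notin> snd (element_type R V q)" using eq by simp
    then obtain q' where q': "q' \<in> carrier V" "q = t \<odot>\<^bsub>V\<^esub> q'" using 2(1) by (auto simp: element_type_def)
    have nz: "t \<odot>\<^bsub>U\<^esub> x \<noteq> \<zero>\<^bsub>U\<^esub>" "t \<odot>\<^bsub>V\<^esub> q' \<noteq> \<zero>\<^bsub>V\<^esub>" using p q 2(2) q'(2) by auto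
    have "element_type R U x = element_type R V q'"
      using U.element_type_quotient[OF compU 2(1) x nz(1)] V.element_type_quotient[OF compV 2(1) q'(1) nz(2)]
        eq unfolding 2(2) q'(2) by simp
    moreover have "x \<noteq> \<zero>\<^bsub>U\<^esub>" "q' \<noteq> \<zero>\<^bsub>V\<^esub>" using p q 2 q'(2) by auto
    moreover have "\<exists>c\<in>carrier R. x = c \<odot>\<^bsub>U\<^esub> x" using x by (intro bexI[of _ "\<one>\<^bsub>R\<^esub>"]) auto
    ultimately show ?thesis using 2 x q' by blast
  qed
qed

text \<open>
  Starting from elements of equal type, choose sequences \<open>p\<^sub>i\<close> in \<open>U\<close> and \<open>q\<^sub>i\<close> in \<open>V\<close> with
  \<open>p\<^sub>i = t\<^sub>i p\<^sub>i\<^sub>+\<^sub>1\<close> and \<open>q\<^sub>i = t\<^sub>i q\<^sub>i\<^sub>+\<^sub>1\<close> for the same scalars, absorbing one generator of each module at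
  every step. Their annihilators agree, so \<open>c p\<^sub>i \<mapsto> c q\<^sub>i\<close> is a well-defined isomorphism.
\<close>

lemma isomorphic_if_common_type:
  assumes U: "valuation_module R U" and V: "valuation_module R V"
    and compU: "\<And>x y. \<lbrakk>x \<in> carrier U; y \<in> carrier U\<rbrakk> \<Longrightarrow>
      (\<exists>c\<in>carrier R. x = c \<odot>\<^bsub>U\<^esub> y) \<or> (\<exists>c\<in>carrier R. y = c \<odot>\<^bsub>U\<^esub> x)"
    and compV: "\<And>x y. \<lbrakk>x \<in> carrier V; y \<in> carrier V\<rbrakk> \<Longrightarrow>
      (\<exists>c\<in>carrier R. x = c \<odot>\<^bsub>V\<^esub> y) \<or> (\<exists>c\<in>carrier R. y = c \<odot>\<^bsub>V\<^esub> x)"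
    and genU: "\<And>i::nat. g i \<in> carrier U" "\<And>x. x \<in> carrier U \<Longrightarrow> \<exists>i. \<exists>c\<in>carrier R. x = c \<odot>\<^bsub>U\<^esub> g i"
    and genV: "\<And>i::nat. h i \<in> carrier V" "\<And>x. x \<in> carrier V \<Longrightarrow> \<exists>i. \<exists>c\<in>carrier R. x = c \<odot>\<^bsub>V\<^esub> h i"
    and common: "\<tau> \<in> types R U" "\<tau> \<in> types R V"
  shows "module_isomorphic R U V"
proof -
  interpret U: valuation_module R U by fact
  interpret V: valuation_module R V by fact
  define ok where "ok = (\<lambda>(p, q). p \<in> carrier U - {\<zero>\<^bsub>U\<^esub>} \<and> q \<in> carrier V - {\<zero>\<^bsub>V\<^esub>} \<and>
    element_type R U p = element_type R V q)"
  define step where "step i = (\<lambda>(p, q) (p', q'). (\<exists>t\<in>carrier R. p = t \<odot>\<^bsub>U\<^esub> p' \<and> q = t \<odot>\<^bsub>V\<^esub> q') \<and>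
    (\<exists>c\<in>carrier R. g i = c \<odot>\<^bsub>U\<^esub> p') \<and> (\<exists>c\<in>carrier R. h i = c \<odot>\<^bsub>V\<^esub> q'))" for i
  have "\<exists>y. ok y \<and> step i x y" if x: "ok x" for x i
  proof -
    obtain p q where pq: "x = (p, q)" by (cases x)
    obtain p1 q1 t1 c1 where 1: "p1 \<in> carrier U - {\<zero>\<^bsub>U\<^esub>}" "q1 \<in> carrier V - {\<zero>\<^bsub>V\<^esub>}" "t1 \<in> carrier R"
      "p = t1 \<odot>\<^bsub>U\<^esub> p1" "q = t1 \<odot>\<^bsub>V\<^esub> q1" "element_type R U p1 = element_type R V q1"
      "c1 \<in> carrier R" "g i = c1 \<odot>\<^bsub>U\<^esub> p1"
      using same_type_extend[OF U V compU compV _ _ _ genU(1), of p q i] x unfolding ok_def pq by blast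
    obtain p2 q2 t2 c2 where 2: "p2 \<in> carrier U - {\<zero>\<^bsub>U\<^esub>}" "q2 \<in> carrier V - {\<zero>\<^bsub>V\<^esub>}" "t2 \<in> carrier R"
      "p1 = t2 \<odot>\<^bsub>U\<^esub> p2" "q1 = t2 \<odot>\<^bsub>V\<^esub> q2" "element_type R V q2 = element_type R U p2"
      "c2 \<in> carrier R" "h i = c2 \<odot>\<^bsub>V\<^esub> q2"
      using same_type_extend[OF V U compV compU 1(2,1) 1(6)[symmetric] genV(1)[of i]] by blast
    have "p = (t1 \<otimes>\<^bsub>R\<^esub> t2) \<odot>\<^bsub>U\<^esub> p2" "q = (t1 \<otimes>\<^bsub>R\<^esub> t2) \<odot>\<^bsub>V\<^esub> q2" "g i = (c1 \<otimes>\<^bsub>R\<^esub> t2) \<odot>\<^bsub>U\<^esub> p2"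
      using 1 2 by (simp_all add: U.smult_assoc1 V.smult_assoc1)
    moreover have "t1 \<otimes>\<^bsub>R\<^esub> t2 \<in> carrier R" "c1 \<otimes>\<^bsub>R\<^esub> t2 \<in> carrier R" using 1 2 by auto
    ultimately have "step i x (p2, q2)" unfolding step_def pq using 2(7,8) by blast
    moreover have "ok (p2, q2)" using 2 by (simp add: ok_def)
    ultimately show ?thesis by blast
  qed
  moreover have "\<exists>x. ok x"
  proof -
    obtain p where "\<tau> = element_type R U p" "p \<in> carrier U - {\<zero>\<^bsub>U\<^esub>}"
      using common(1) unfolding types_def by (rule imageE)
    moreover obtain q where "\<tau> = element_type R V q" "q \<in> carrier V - {\<zero>\<^bsub>V\<^esub>}"
      using common(2) unfolding types_def by (rule imageE)
    ultimately have "ok (p, q)" by (simp add: ok_def)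
    then show ?thesis by blast
  qed
  ultimately have "\<exists>f. \<forall>n. ok (f n) \<and> step n (f n) (f (Suc n))"
    by (intro dependent_nat_choice) auto
  then obtain f where f: "\<And>n. ok (f n)" "\<And>n. step n (f n) (f (Suc n))" by blast
  define p where "p n = fst (f n)" for n
  define q where "q n = snd (f n)" for n
  have pc: "p n \<in> carrier U" and qc: "q n \<in> carrier V" and et: "element_type R U (p n) = element_type R V (q n)" for n
    using f(1)[of n] by (auto simp: ok_def p_def q_def split: prod.splits)
  have st: "\<exists>t\<in>carrier R. p n = t \<odot>\<^bsub>U\<^esub> p (Suc n) \<and> q n = t \<odot>\<^bsub>V\<^esub> q (Suc n)"
    and gp: "\<exists>c\<in>carrier R. g n = c \<odot>\<^bsub>U\<^esub> p (Suc n)" and hq: "\<exists>c\<in>carrier R. h n = c \<odot>\<^bsub>V\<^esub> q (Suc n)" for n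
    using f(2)[of n] by (auto simp: step_def p_def q_def split: prod.splits)
  have up: "\<exists>t\<in>carrier R. p i = t \<odot>\<^bsub>U\<^esub> p j \<and> q i = t \<odot>\<^bsub>V\<^esub> q j" if "i \<le> j" for i j
    using that
  proof (induction j rule: dec_induct)
    case base
    show ?case using pc qc by (intro bexI[of _ "\<one>\<^bsub>R\<^esub>"]) auto
  next
    case (step j)
    then obtain t s where "t \<in> carrier R" "p i = t \<odot>\<^bsub>U\<^esub> p j" "q i = t \<odot>\<^bsub>V\<^esub> q j"
      "s \<in> carrier R" "p j = s \<odot>\<^bsub>U\<^esub> p (Suc j)" "q j = s \<odot>\<^bsub>V\<^esub> q (Suc j)" using st[of j] by blast
    then show ?case using pc qc
      by (intro bexI[of _ "t \<otimes>\<^bsub>R\<^esub> s"]) (auto simp: U.smult_assoc1 V.smult_assoc1)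
  qed
  define rel where "rel x y \<longleftrightarrow> (\<exists>i. \<exists>c\<in>carrier R. x = c \<odot>\<^bsub>U\<^esub> p i \<and> y = c \<odot>\<^bsub>V\<^esub> q i)" for x y
  have relc: "x \<in> carrier U" "y \<in> carrier V" if "rel x y" for x y
    using that pc qc unfolding rel_def by auto
  have totU: "\<exists>y. rel x y" if x: "x \<in> carrier U" for x
  proof -
    obtain i c where c: "c \<in> carrier R" "x = c \<odot>\<^bsub>U\<^esub> g i" using genU(2)[OF x] by blast
    obtain d where d: "d \<in> carrier R" "g i = d \<odot>\<^bsub>U\<^esub> p (Suc i)" using gp by blast
    have "x = (c \<otimes>\<^bsub>R\<^esub> d) \<odot>\<^bsub>U\<^esub> p (Suc i)" using c d pc by (simp add: U.smult_assoc1)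
    moreover have "c \<otimes>\<^bsub>R\<^esub> d \<in> carrier R" using c d by simp
    ultimately show ?thesis unfolding rel_def by blast
  qed
  have totV: "\<exists>x. rel x y" if y: "y \<in> carrier V" for y
  proof -
    obtain i c where c: "c \<in> carrier R" "y = c \<odot>\<^bsub>V\<^esub> h i" using genV(2)[OF y] by blast
    obtain d where d: "d \<in> carrier R" "h i = d \<odot>\<^bsub>V\<^esub> q (Suc i)" using hq by blast
    have "y = (c \<otimes>\<^bsub>R\<^esub> d) \<odot>\<^bsub>V\<^esub> q (Suc i)" using c d qc by (simp add: V.smult_assoc1)
    moreover have "c \<otimes>\<^bsub>R\<^esub> d \<in> carrier R" using c d by simp
    ultimately show ?thesis unfolding rel_def by blast
  qed
  have lift: "\<exists>d\<in>carrier R. x = d \<odot>\<^bsub>U\<^esub> p j \<and> y = d \<odot>\<^bsub>V\<^esub> q j"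
    if c: "c \<in> carrier R" "x = c \<odot>\<^bsub>U\<^esub> p i" "y = c \<odot>\<^bsub>V\<^esub> q i" "i \<le> j" for x y c i j
  proof -
    obtain t where t: "t \<in> carrier R" "p i = t \<odot>\<^bsub>U\<^esub> p j" "q i = t \<odot>\<^bsub>V\<^esub> q j" using up[OF c(4)] by blast
    then show ?thesis using c pc qc
      by (intro bexI[of _ "c \<otimes>\<^bsub>R\<^esub> t"]) (auto simp: U.smult_assoc1 V.smult_assoc1)
  qed
  have common_index: "\<exists>k. \<exists>c\<in>carrier R. \<exists>d\<in>carrier R. x = c \<odot>\<^bsub>U\<^esub> p k \<and> y = c \<odot>\<^bsub>V\<^esub> q k \<and> x' = d \<odot>\<^bsub>U\<^esub> p k \<and> y' = d \<odot>\<^bsub>V\<^esub> q k"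
    if xy: "rel x y" and xy': "rel x' y'" for x y x' y'
  proof -
    obtain i c where c: "c \<in> carrier R" "x = c \<odot>\<^bsub>U\<^esub> p i" "y = c \<odot>\<^bsub>V\<^esub> q i" using xy unfolding rel_def by blast
    obtain j d where d: "d \<in> carrier R" "x' = d \<odot>\<^bsub>U\<^esub> p j" "y' = d \<odot>\<^bsub>V\<^esub> q j" using xy' unfolding rel_def by blast
    show ?thesis using lift[OF c, of "max i j"] lift[OF d, of "max i j"] by (intro exI[of _ "max i j"]) auto
  qed
  have minus: "c \<odot>\<^bsub>U\<^esub> p k = d \<odot>\<^bsub>U\<^esub> p k \<longleftrightarrow> c \<odot>\<^bsub>V\<^esub> q k = d \<odot>\<^bsub>V\<^esub> q k" if cd: "c \<in> carrier R" "d \<in> carrier R" for c d k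
  proof -
    have "c \<odot>\<^bsub>U\<^esub> p k = d \<odot>\<^bsub>U\<^esub> p k \<longleftrightarrow> (c \<ominus>\<^bsub>R\<^esub> d) \<odot>\<^bsub>U\<^esub> p k = \<zero>\<^bsub>U\<^esub>"
      using cd pc[of k] by (simp add: U.smult_diff_left U.diff_zero_iff)
    also have "\<dots> \<longleftrightarrow> (c \<ominus>\<^bsub>R\<^esub> d) \<odot>\<^bsub>V\<^esub> q k = \<zero>\<^bsub>V\<^esub>"
      using et[of k] cd by (auto simp: element_type_def)
    also have "\<dots> \<longleftrightarrow> c \<odot>\<^bsub>V\<^esub> q k = d \<odot>\<^bsub>V\<^esub> q k"
      using cd qc[of k] by (simp add: V.smult_diff_left V.diff_zero_iff)
    finally show ?thesis .
  qed
  have eqiff: "x = x' \<longleftrightarrow> y = y'" if "rel x y" "rel x' y'" for x y x' y'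
    using common_index[OF that] minus by blast
  define F where "F x = (SOME y. rel x y)" for x
  have F: "rel x (F x)" if "x \<in> carrier U" for x unfolding F_def by (rule someI_ex[OF totU[OF that]])
  have FI: "F x = y" if "rel x y" for x y using eqiff[OF that F[OF relc(1)[OF that]]] by simp
  have "F \<in> module_hom R U V"
  proof (rule module_homI)
    show "F x \<in> carrier V" if "x \<in> carrier U" for x using relc F that by blast
    show "F (x \<oplus>\<^bsub>U\<^esub> y) = F x \<oplus>\<^bsub>V\<^esub> F y" if xy: "x \<in> carrier U" "y \<in> carrier U" for x y
    proof (rule FI)
      obtain k c d where c: "c \<in> carrier R" "d \<in> carrier R" "x = c \<odot>\<^bsub>U\<^esub> p k" "F x = c \<odot>\<^bsub>V\<^esub> q k"
        "y = d \<odot>\<^bsub>U\<^esub> p k" "F y = d \<odot>\<^bsub>V\<^esub> q k" using common_index[OF F[OF xy(1)] F[OF xy(2)]] by blast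
      then show "rel (x \<oplus>\<^bsub>U\<^esub> y) (F x \<oplus>\<^bsub>V\<^esub> F y)" unfolding rel_def using pc qc
        by (intro exI[of _ k] bexI[of _ "c \<oplus>\<^bsub>R\<^esub> d"]) (auto simp: U.smult_l_distr V.smult_l_distr)
    qed
    show "F (r \<odot>\<^bsub>U\<^esub> x) = r \<odot>\<^bsub>V\<^esub> F x" if r: "r \<in> carrier R" and x: "x \<in> carrier U" for r x
    proof (rule FI)
      obtain k c where c: "c \<in> carrier R" "x = c \<odot>\<^bsub>U\<^esub> p k" "F x = c \<odot>\<^bsub>V\<^esub> q k" using F[OF x] unfolding rel_def by blast
      then show "rel (r \<odot>\<^bsub>U\<^esub> x) (r \<odot>\<^bsub>V\<^esub> F x)" unfolding rel_def using pc qc r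
        by (intro exI[of _ k] bexI[of _ "r \<otimes>\<^bsub>R\<^esub> c"]) (auto simp: U.smult_assoc1 V.smult_assoc1)
    qed
  qed
  moreover have "bij_betw F (carrier U) (carrier V)"
  proof (rule bij_betw_imageI)
    show "inj_on F (carrier U)"
    proof (rule inj_onI)
      fix x y assume "x \<in> carrier U" "y \<in> carrier U" "F x = F y"
      then show "x = y" using eqiff[OF F F] by blast
    qed
    have "y \<in> F ` carrier U" if y: "y \<in> carrier V" for y
    proof -
      obtain x where "rel x y" using totV[OF y] by blast
      then show ?thesis using FI relc(1) by (metis imageI)
    qed
    then show "F ` carrier U = carrier V" using relc(2) F by blast
  qed
  ultimately show ?thesis unfolding module_isomorphic_def by blast
qed

section \<open>Pure submodules are relatively divisible\<close>

lemma quotient_coset_eq_iff: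
  assumes M: "module R M" and F: "submodule F R M" and x: "x \<in> carrier M" and y: "y \<in> carrier M"
  shows "F +>\<^bsub>M\<^esub> x = F +>\<^bsub>M\<^esub> y \<longleftrightarrow> (\<exists>h\<in>F. x = h \<oplus>\<^bsub>M\<^esub> y)"
proof -
  interpret M: module R M by fact
  interpret F: submodule F R M by fact
  interpret F: abelian_subgroup F M
    using M.a_comm_group F.subgroup_axioms
    by (intro abelian_subgroupI3 additive_subgroup.intro M.abelian_group_axioms)
  have mem: "x \<in> F +>\<^bsub>M\<^esub> y \<longleftrightarrow> (\<exists>h\<in>F. x = h \<oplus>\<^bsub>M\<^esub> y)" by (auto simp: a_r_coset_def r_coset_def)
  show ?thesis
    using F.a_rcos_self[OF x] F.a_repr_independence'[OF _ y] mem by blast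
qed

lemma submodule_restrict:
  assumes M: "module R M" and L: "submodule L R M" and N: "submodule N R M" and "N \<subseteq> L"
  shows "submodule N R (M\<lparr>carrier := L\<rparr>)"
proof -
  interpret L: module R "M\<lparr>carrier := L\<rparr>" by (rule submodule_carrier_module[OF M L])
  note NE = module.submoduleE[OF M N]
  show ?thesis
  proof (rule L.submoduleI)
    show "\<zero>\<^bsub>M\<lparr>carrier := L\<rparr>\<^esub> \<in> N" using subgroup.one_closed[OF submodule.axioms(1)[OF N]] by simp
    fix a assume a: "a \<in> N"
    then have aL: "a \<in> carrier (M\<lparr>carrier := L\<rparr>)" using assms(4) by auto
    have "\<ominus>\<^bsub>M\<lparr>carrier := L\<rparr>\<^esub> a = (\<ominus>\<^bsub>R\<^esub> \<one>\<^bsub>R\<^esub>) \<odot>\<^bsub>M\<lparr>carrier := L\<rparr>\<^esub> a"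
      using L.smult_l_minus[OF L.R.one_closed aL] L.smult_one[OF aL] by simp
    then show "\<ominus>\<^bsub>M\<lparr>carrier := L\<rparr>\<^esub> a \<in> N" using NE(4)[OF _ a, of "\<ominus>\<^bsub>R\<^esub> \<one>\<^bsub>R\<^esub>"] by simp
  qed (use assms(4) NE in auto)
qed

lemma multiples_submodule:
  assumes M: "module R M" and r: "r \<in> carrier R"
  shows "submodule ((\<lambda>x. r \<odot>\<^bsub>M\<^esub> x) ` carrier M) R M"
proof -
  interpret M: module R M by fact
  show ?thesis
  proof (rule M.submoduleI)
    show "\<zero>\<^bsub>M\<^esub> \<in> (\<lambda>x. r \<odot>\<^bsub>M\<^esub> x) ` carrier M" using r by (intro image_eqI[of _ _ "\<zero>\<^bsub>M\<^esub>"]) auto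
    fix a assume "a \<in> (\<lambda>x. r \<odot>\<^bsub>M\<^esub> x) ` carrier M"
    then obtain x where x: "x \<in> carrier M" "a = r \<odot>\<^bsub>M\<^esub> x" by blast
    then show "\<ominus>\<^bsub>M\<^esub> a \<in> (\<lambda>x. r \<odot>\<^bsub>M\<^esub> x) ` carrier M"
      using r by (intro image_eqI[of _ _ "\<ominus>\<^bsub>M\<^esub> x"]) (auto simp: M.smult_r_minus)
    show "c \<odot>\<^bsub>M\<^esub> a \<in> (\<lambda>x. r \<odot>\<^bsub>M\<^esub> x) ` carrier M" if "c \<in> carrier R" for c
      using that r x by (intro image_eqI[of _ _ "c \<odot>\<^bsub>M\<^esub> x"]) (auto simp flip: M.smult_assoc1 simp: M.m_comm)
    fix b assume "b \<in> (\<lambda>x. r \<odot>\<^bsub>M\<^esub> x) ` carrier M"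
    then obtain y where y: "y \<in> carrier M" "b = r \<odot>\<^bsub>M\<^esub> y" by blast
    then show "a \<oplus>\<^bsub>M\<^esub> b \<in> (\<lambda>x. r \<odot>\<^bsub>M\<^esub> x) ` carrier M"
      using r x by (intro image_eqI[of _ _ "x \<oplus>\<^bsub>M\<^esub> y"]) (auto simp: M.smult_r_distr)
  qed (use r in auto)
qed

lemma regular_module_simps [simp]:
  "carrier (regular_module R) = carrier R" "\<zero>\<^bsub>regular_module R\<^esub> = \<zero>\<^bsub>R\<^esub>"
  "x \<oplus>\<^bsub>regular_module R\<^esub> y = x \<oplus>\<^bsub>R\<^esub> y" "r \<odot>\<^bsub>regular_module R\<^esub> x = r \<otimes>\<^bsub>R\<^esub> x"
  by (simp_all add: regular_module_def)

lemma regular_module_module: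
  assumes "cring R" shows "module R (regular_module R)"
proof -
  interpret cring R by fact
  show ?thesis
  proof (rule moduleI)
    show "abelian_group (regular_module R)"
    proof (rule abelian_groupI)
      show "\<exists>y\<in>carrier (regular_module R). y \<oplus>\<^bsub>regular_module R\<^esub> x = \<zero>\<^bsub>regular_module R\<^esub>"
        if "x \<in> carrier (regular_module R)" for x
        using that by (intro bexI[of _ "\<ominus>\<^bsub>R\<^esub> x"]) (auto simp: l_neg)
    qed (auto simp: a_ac)
  qed (auto simp: assms l_distr r_distr m_assoc)
qed

text \<open>
  Tensor with \<open>R/rR\<close>. In \<open>M \<otimes> R/rR\<close> the element \<open>ry \<otimes> 1 = y \<otimes> r\<close> vanishes, hence by purity also in
  \<open>F \<otimes> R/rR\<close>. The homomorphism from the latter to \<open>F/rF\<close> that sends \<open>x \<otimes> t\<close> to the class of \<open>tx\<close>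
  then shows \<open>ry \<in> rF\<close>.
\<close>

lemma pure_submodule_divisible:
  fixes R :: "('a, 'r) ring_scheme" and M :: "('a, 'b, 'm) module_scheme"
  assumes M: "module R M" and pure: "pure_submodule R M F"
    and r: "r \<in> carrier R" and y: "y \<in> carrier M" "r \<odot>\<^bsub>M\<^esub> y \<in> F"
  shows "\<exists>z\<in>F. r \<odot>\<^bsub>M\<^esub> y = r \<odot>\<^bsub>M\<^esub> z"
proof -
  interpret M: module R M by fact
  have F: "submodule F R M" using pure by (simp add: pure_submodule_def)
  note FE = module.submoduleE[OF M F]
  let ?RR = "regular_module R" and ?I = "(\<lambda>t. r \<odot>\<^bsub>regular_module R\<^esub> t) ` carrier (regular_module R)"
  let ?N = "quotient_module ?RR ?I" and ?p = "\<lambda>t. ?I +>\<^bsub>?RR\<^esub> t"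
  have RR: "module R ?RR" by (rule regular_module_module[OF M.R.is_cring])
  have I: "submodule ?I R ?RR" by (rule multiples_submodule[OF RR r])
  note N = quotient_module_module[OF RR I] and p = module_homD[OF quotient_module_proj[OF RR I]]
  let ?F = "M\<lparr>carrier := F\<rparr>"
  have FM: "module R ?F" by (rule submodule_carrier_module[OF M F])
  let ?J = "(\<lambda>x. r \<odot>\<^bsub>?F\<^esub> x) ` carrier ?F"
  have J: "submodule ?J R ?F" by (rule multiples_submodule[OF FM r])
  let ?Q = "quotient_module ?F ?J" and ?q = "\<lambda>x. ?J +>\<^bsub>?F\<^esub> x"
  note Q = quotient_module_module[OF FM J] and q = module_homD[OF quotient_module_proj[OF FM J]]
  interpret N: module R ?N by (rule N)
  interpret FF: module R ?F by (rule FM)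
  interpret Q: module R ?Q by (rule Q)
  have psurj: "\<exists>t\<in>carrier R. n = ?p t" if "n \<in> carrier ?N" for n
    using that quotient_module_surj[OF RR I] by auto
  let ?S = "F \<times> carrier ?N"
  \<comment> \<open>The bilinear map behind that homomorphism, and its extension \<open>h\<close> to the free abelian group.\<close>
  define \<beta> where "\<beta> = (\<lambda>(x, n). ?q ((SOME t. t \<in> carrier R \<and> n = ?p t) \<odot>\<^bsub>M\<^esub> x))"
  have \<beta>: "\<beta> (x, ?p t) = ?q (t \<odot>\<^bsub>M\<^esub> x)" if x: "x \<in> F" and t: "t \<in> carrier R" for x t
  proof -
    let ?s = "SOME s. s \<in> carrier R \<and> ?p t = ?p s"
    have s: "?s \<in> carrier R" "?p t = ?p ?s" using someI[of "\<lambda>s. s \<in> carrier R \<and> ?p t = ?p s" t] t by auto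
    have "\<exists>h\<in>?I. ?s = h \<oplus>\<^bsub>?RR\<^esub> t"
      using quotient_coset_eq_iff[OF RR I, of ?s t] s t by simp
    then obtain e where e: "e \<in> carrier R" "?s = r \<otimes>\<^bsub>R\<^esub> e \<oplus>\<^bsub>R\<^esub> t" by auto
    have xM: "x \<in> carrier M" using x FE(1) by blast
    have "?s \<odot>\<^bsub>M\<^esub> x = r \<odot>\<^bsub>M\<^esub> (e \<odot>\<^bsub>M\<^esub> x) \<oplus>\<^bsub>M\<^esub> t \<odot>\<^bsub>M\<^esub> x"
      unfolding e(2) using e(1) r t xM by (simp add: M.smult_l_distr M.smult_assoc1)
    moreover have "r \<odot>\<^bsub>M\<^esub> (e \<odot>\<^bsub>M\<^esub> x) \<in> ?J" using FE(4)[OF e(1) x] by simp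
    moreover have "?s \<odot>\<^bsub>M\<^esub> x \<in> F" "t \<odot>\<^bsub>M\<^esub> x \<in> F" using FE(4) s t x by auto
    ultimately have "?q (?s \<odot>\<^bsub>M\<^esub> x) = ?q (t \<odot>\<^bsub>M\<^esub> x)"
      using quotient_coset_eq_iff[OF FM J, of "?s \<odot>\<^bsub>M\<^esub> x" "t \<odot>\<^bsub>M\<^esub> x"] by auto
    then show ?thesis by (simp add: \<beta>_def)
  qed
  have "\<beta> ` ?S \<subseteq> carrier (add_monoid ?Q)"
  proof (rule image_subsetI)
    fix z assume "z \<in> ?S"
    then obtain x n t where "z = (x, n)" "x \<in> F" "t \<in> carrier R" "n = ?p t" using psurj by blast
    then show "\<beta> z \<in> carrier (add_monoid ?Q)" using \<beta> q(1) FE(4) by simp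
  qed
  then obtain h where h: "h \<in> hom (free_Abelian_group ?S) (add_monoid ?Q)" "\<And>x. x \<in> ?S \<Longrightarrow> h (frag_of x) = \<beta> x"
    using comm_group.free_Abelian_group_universal[OF Q.a_comm_group] by metis
  have hc: "h a \<in> carrier ?Q" if "Poly_Mapping.keys a \<subseteq> ?S" for a
    using hom_in_carrier[OF h(1)] that by simp
  have hadd: "h (a + b) = h a \<oplus>\<^bsub>?Q\<^esub> h b" if "Poly_Mapping.keys a \<subseteq> ?S" "Poly_Mapping.keys b \<subseteq> ?S" for a b
    using hom_mult[OF h(1), of a b] that by simp
  have cancel: "u = \<zero>\<^bsub>?Q\<^esub>" if "w = u \<oplus>\<^bsub>?Q\<^esub> w" "u \<in> carrier ?Q" "w \<in> carrier ?Q" for u w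
    using Q.M.add.right_cancel[of w u "\<zero>\<^bsub>?Q\<^esub>"] that by (metis Q.M.l_zero Q.M.zero_closed)
  have h0: "h 0 = \<zero>\<^bsub>?Q\<^esub>"
    using cancel[of "h 0" "h 0"] hadd[of 0 0] hc[of 0] by simp
  have hneg: "h (- a) = \<zero>\<^bsub>?Q\<^esub>" if a: "Poly_Mapping.keys a \<subseteq> ?S" "h a = \<zero>\<^bsub>?Q\<^esub>" for a
  proof -
    have k: "Poly_Mapping.keys (- a) \<subseteq> ?S" using a(1) by (simp add: keys_minus)
    have "\<zero>\<^bsub>?Q\<^esub> = \<zero>\<^bsub>?Q\<^esub> \<oplus>\<^bsub>?Q\<^esub> h (- a)" using hadd[OF a(1) k] h0 a(2) by simp
    also have "\<dots> = h (- a)" by (rule Q.M.l_zero[OF hc[OF k]])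
    finally show ?thesis ..
  qed
  have hdiff: "h a = h b \<Longrightarrow> h (a - b) = \<zero>\<^bsub>?Q\<^esub>" if "Poly_Mapping.keys a \<subseteq> ?S" "Poly_Mapping.keys b \<subseteq> ?S" for a b
  proof -
    assume "h a = h b"
    then have "h b = h (a - b) \<oplus>\<^bsub>?Q\<^esub> h b" using hadd[of "a - b" b] keys_diff2[OF that] that by simp
    then show ?thesis by (rule cancel[OF _ hc[OF keys_diff2[OF that]] hc[OF that(2)]])
  qed
  have hgen: "h g = \<zero>\<^bsub>?Q\<^esub>" if g: "g \<in> tensor_gens R ?F ?N" for g
  proof -
    have kf: "Poly_Mapping.keys (frag_of z) \<subseteq> ?S" if "z \<in> ?S" for z using that by (simp add: keys_frag_of)
    have diff2: "h (frag_of a - frag_of b - frag_of c) = \<zero>\<^bsub>?Q\<^esub>"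
      if "a \<in> ?S" "b \<in> ?S" "c \<in> ?S" "\<beta> a = \<beta> b \<oplus>\<^bsub>?Q\<^esub> \<beta> c" for a b c
    proof -
      have k: "Poly_Mapping.keys (frag_of b + frag_of c) \<subseteq> ?S"
        using keys_add[of "frag_of b" "frag_of c"] kf that by blast
      have "h (frag_of a) = h (frag_of b + frag_of c)" using hadd[OF kf kf] h(2) that by simp
      from hdiff[OF kf[OF that(1)] k this] show ?thesis by (simp add: diff_diff_eq)
    qed
    show ?thesis using g unfolding tensor_gens_def
    proof (elim UnE CollectE exE conjE)
      fix x y n assume g: "g = frag_of (x \<oplus>\<^bsub>?F\<^esub> y, n) - frag_of (x, n) - frag_of (y, n)"
        and m: "x \<in> carrier ?F" "y \<in> carrier ?F" "n \<in> carrier ?N"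
      obtain t where t: "t \<in> carrier R" "n = ?p t" using psurj m by blast
      have xy: "x \<in> F" "y \<in> F" "x \<oplus>\<^bsub>M\<^esub> y \<in> F" "t \<odot>\<^bsub>M\<^esub> x \<in> F" "t \<odot>\<^bsub>M\<^esub> y \<in> F" "x \<in> carrier M" "y \<in> carrier M"
        using m FE t by auto
      have "\<beta> (x \<oplus>\<^bsub>M\<^esub> y, n) = \<beta> (x, n) \<oplus>\<^bsub>?Q\<^esub> \<beta> (y, n)"
        using \<beta> t xy q(2)[of "t \<odot>\<^bsub>M\<^esub> x" "t \<odot>\<^bsub>M\<^esub> y"] by (simp add: M.smult_r_distr)
      then show ?thesis using diff2[of "(x \<oplus>\<^bsub>M\<^esub> y, n)" "(x, n)" "(y, n)"] g xy m by simp
    next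
      fix x n n' assume g: "g = frag_of (x, n \<oplus>\<^bsub>?N\<^esub> n') - frag_of (x, n) - frag_of (x, n')"
        and m: "x \<in> carrier ?F" "n \<in> carrier ?N" "n' \<in> carrier ?N"
      obtain t t' where t: "t \<in> carrier R" "n = ?p t" "t' \<in> carrier R" "n' = ?p t'" using psurj m by metis
      have x: "x \<in> F" "x \<in> carrier M" "t \<odot>\<^bsub>M\<^esub> x \<in> F" "t' \<odot>\<^bsub>M\<^esub> x \<in> F" using m FE t by auto
      have "n \<oplus>\<^bsub>?N\<^esub> n' = ?p (t \<oplus>\<^bsub>R\<^esub> t')" using p(2)[of t t'] t by simp
      then have "\<beta> (x, n \<oplus>\<^bsub>?N\<^esub> n') = \<beta> (x, n) \<oplus>\<^bsub>?Q\<^esub> \<beta> (x, n')"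
        using \<beta> t x q(2)[of "t \<odot>\<^bsub>M\<^esub> x" "t' \<odot>\<^bsub>M\<^esub> x"] by (simp add: M.smult_l_distr)
      moreover have "(x, n \<oplus>\<^bsub>?N\<^esub> n') \<in> ?S" "(x, n) \<in> ?S" "(x, n') \<in> ?S"
        using x(1) m(2,3) N.M.a_closed[OF m(2,3)] by blast+
      ultimately show ?thesis unfolding g by (intro diff2)
    next
      fix s x n assume g: "g = frag_of (s \<odot>\<^bsub>?F\<^esub> x, n) - frag_of (x, s \<odot>\<^bsub>?N\<^esub> n)"
        and m: "s \<in> carrier R" "x \<in> carrier ?F" "n \<in> carrier ?N"
      obtain t where t: "t \<in> carrier R" "n = ?p t" using psurj m by blast
      have x: "x \<in> F" "x \<in> carrier M" "s \<odot>\<^bsub>M\<^esub> x \<in> F" using m FE by auto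
      have "s \<odot>\<^bsub>?N\<^esub> n = ?p (s \<otimes>\<^bsub>R\<^esub> t)" using p(3)[of s t] t m by simp
      then have "\<beta> (s \<odot>\<^bsub>M\<^esub> x, n) = \<beta> (x, s \<odot>\<^bsub>?N\<^esub> n)"
        using \<beta> t x m by (simp add: M.m_comm[of s] M.smult_assoc1)
      moreover have "(s \<odot>\<^bsub>M\<^esub> x, n) \<in> ?S" "(x, s \<odot>\<^bsub>?N\<^esub> n) \<in> ?S"
        using x m(3) N.smult_closed[OF m(1,3)] by blast+
      ultimately show ?thesis using hdiff[OF kf kf] h(2) unfolding g by simp
    qed
  qed
  have hrel: "Poly_Mapping.keys c \<subseteq> ?S \<and> h c = \<zero>\<^bsub>?Q\<^esub>" if "c \<in> tensor_rels R ?F ?N" for c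
  proof (rule tensor_rels_induct[OF FM N that])
    have gk: "Poly_Mapping.keys g \<subseteq> ?S" if "g \<in> tensor_gens R ?F ?N" for g
      using tensor_gens_keys[OF FM N] that by auto
    show "Poly_Mapping.keys 0 \<subseteq> ?S \<and> h 0 = \<zero>\<^bsub>?Q\<^esub>" using h0 by simp
    show "Poly_Mapping.keys g \<subseteq> ?S \<and> h g = \<zero>\<^bsub>?Q\<^esub>" "Poly_Mapping.keys (- g) \<subseteq> ?S \<and> h (- g) = \<zero>\<^bsub>?Q\<^esub>"
      if "g \<in> tensor_gens R ?F ?N" for g using gk[OF that] hgen[OF that] hneg by (simp_all add: keys_minus)
    show "Poly_Mapping.keys (a + b) \<subseteq> ?S \<and> h (a + b) = \<zero>\<^bsub>?Q\<^esub>"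
      if "Poly_Mapping.keys a \<subseteq> ?S \<and> h a = \<zero>\<^bsub>?Q\<^esub>" "Poly_Mapping.keys b \<subseteq> ?S \<and> h b = \<zero>\<^bsub>?Q\<^esub>" for a b
    proof
      show "Poly_Mapping.keys (a + b) \<subseteq> ?S" using that keys_add[of a b] by blast
      show "h (a + b) = \<zero>\<^bsub>?Q\<^esub>"
        using that hadd[of a b] Q.M.l_zero[OF Q.M.zero_closed] by simp
    qed
  qed
  let ?c = "frag_of (r \<odot>\<^bsub>M\<^esub> y, ?p \<one>\<^bsub>R\<^esub>)"
  have p1: "?p \<one>\<^bsub>R\<^esub> \<in> carrier ?N" using p(1) by simp
  have c: "Poly_Mapping.keys ?c \<subseteq> ?S" using y p1 by (simp add: keys_frag_of)
  have "?c \<in> tensor_rels R M ?N"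
  proof -
    note cl = tensor_rels_closed[OF M N]
    have "r \<in> ?I" using r by (intro image_eqI[of _ _ "\<one>\<^bsub>R\<^esub>"]) auto
    then have "\<exists>h\<in>?I. r = h \<oplus>\<^bsub>?RR\<^esub> \<zero>\<^bsub>R\<^esub>" using r by (intro bexI[of _ r]) auto
    then have "?p r = ?p \<zero>\<^bsub>R\<^esub>"
      using quotient_coset_eq_iff[OF RR I, of r "\<zero>\<^bsub>R\<^esub>"] r by simp
    also have "\<dots> = \<zero>\<^bsub>R\<^esub> \<odot>\<^bsub>?N\<^esub> ?p \<zero>\<^bsub>R\<^esub>" using p(3)[of "\<zero>\<^bsub>R\<^esub>" "\<zero>\<^bsub>R\<^esub>"] by simp
    also have "\<dots> = \<zero>\<^bsub>?N\<^esub>" by (rule N.smult_l_null, rule p(1)) simp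
    finally have z: "r \<odot>\<^bsub>?N\<^esub> ?p \<one>\<^bsub>R\<^esub> = \<zero>\<^bsub>?N\<^esub>" using p(3)[of r "\<one>\<^bsub>R\<^esub>"] r by simp
    have "frag_of (y, \<zero>\<^bsub>?N\<^esub> \<oplus>\<^bsub>?N\<^esub> \<zero>\<^bsub>?N\<^esub>) - frag_of (y, \<zero>\<^bsub>?N\<^esub>) - frag_of (y, \<zero>\<^bsub>?N\<^esub>) \<in> tensor_gens R M ?N"
      unfolding tensor_gens_def using y N.M.zero_closed by blast
    from cl(3)[OF cl(6)[OF this]] have 1: "frag_of (y, \<zero>\<^bsub>?N\<^esub>) \<in> tensor_rels R M ?N"
      by (simp only: N.M.l_zero[OF N.M.zero_closed]) simp
    have "?c - frag_of (y, r \<odot>\<^bsub>?N\<^esub> ?p \<one>\<^bsub>R\<^esub>) \<in> tensor_gens R M ?N"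
      unfolding tensor_gens_def using y r p1 by blast
    from cl(4)[OF cl(6)[OF this[unfolded z]] 1] show ?thesis by (simp only: diff_add_cancel)
  qed
  then have "?c \<in> tensor_rels R ?F ?N"
    using pure_submodule_tensor_exact[OF M pure N] c unfolding tensor_exact_iff[OF M F N] by blast
  then have "h ?c = \<zero>\<^bsub>?Q\<^esub>" using hrel by blast
  moreover have "(r \<odot>\<^bsub>M\<^esub> y, ?p \<one>\<^bsub>R\<^esub>) \<in> ?S" using y(2) p1 by blast
  ultimately have "\<beta> (r \<odot>\<^bsub>M\<^esub> y, ?p \<one>\<^bsub>R\<^esub>) = \<zero>\<^bsub>?Q\<^esub>" using h(2) by simp
  then have "?q (r \<odot>\<^bsub>M\<^esub> y) = \<zero>\<^bsub>?Q\<^esub>" using \<beta>[OF y(2), of "\<one>\<^bsub>R\<^esub>"] r y by simp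
  also have "\<dots> = \<zero>\<^bsub>R\<^esub> \<odot>\<^bsub>?Q\<^esub> ?q \<zero>\<^bsub>M\<^esub>"
    by (rule Q.smult_l_null[symmetric], rule q(1)) (use FF.M.zero_closed in simp)
  also have "\<dots> = ?q \<zero>\<^bsub>M\<^esub>" using q(3)[of "\<zero>\<^bsub>R\<^esub>" "\<zero>\<^bsub>M\<^esub>"] FF.M.zero_closed by simp
  finally obtain x where "x \<in> F" "r \<odot>\<^bsub>M\<^esub> y = r \<odot>\<^bsub>M\<^esub> x \<oplus>\<^bsub>M\<^esub> \<zero>\<^bsub>M\<^esub>"
    using quotient_coset_eq_iff[OF FM J, of "r \<odot>\<^bsub>M\<^esub> y" "\<zero>\<^bsub>M\<^esub>"] y(2) FF.M.zero_closed by auto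
  then show ?thesis using FE(1) r by (intro bexI[of _ x]) auto
qed

section \<open>The factors of a series\<close>

lemma uniserial_comparable:
  assumes U: "uniserial R U" and x: "x \<in> carrier U" and y: "y \<in> carrier U"
  shows "(\<exists>c\<in>carrier R. x = c \<odot>\<^bsub>U\<^esub> y) \<or> (\<exists>c\<in>carrier R. y = c \<odot>\<^bsub>U\<^esub> x)"
proof -
  interpret module R U using U by (simp add: uniserial_def)
  let ?C = "\<lambda>u. (\<lambda>c. c \<odot>\<^bsub>U\<^esub> u) ` carrier R"
  have sub: "submodule (?C u) R U" if u: "u \<in> carrier U" for u
  proof (rule submoduleI)
    show "\<zero>\<^bsub>U\<^esub> \<in> ?C u" using u by (intro image_eqI[of _ _ "\<zero>\<^bsub>R\<^esub>"]) auto
    fix a assume "a \<in> ?C u"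
    then obtain c where c: "c \<in> carrier R" "a = c \<odot>\<^bsub>U\<^esub> u" by blast
    then show "\<ominus>\<^bsub>U\<^esub> a \<in> ?C u" using u by (intro image_eqI[of _ _ "\<ominus>\<^bsub>R\<^esub> c"]) (auto simp: smult_l_minus)
    show "r \<odot>\<^bsub>U\<^esub> a \<in> ?C u" if "r \<in> carrier R" for r
      using that u c by (intro image_eqI[of _ _ "r \<otimes>\<^bsub>R\<^esub> c"]) (auto simp: smult_assoc1)
    fix b assume "b \<in> ?C u"
    then obtain d where "d \<in> carrier R" "b = d \<odot>\<^bsub>U\<^esub> u" by blast
    then show "a \<oplus>\<^bsub>U\<^esub> b \<in> ?C u"
      using u c by (intro image_eqI[of _ _ "c \<oplus>\<^bsub>R\<^esub> d"]) (auto simp: smult_l_distr)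
  qed (use u in auto)
  have self: "u \<in> ?C u" if "u \<in> carrier U" for u using that by (intro image_eqI[of _ _ "\<one>\<^bsub>R\<^esub>"]) auto
  have "?C x \<subseteq> ?C y \<or> ?C y \<subseteq> ?C x" using U sub[OF x] sub[OF y] unfolding uniserial_def by blast
  then show ?thesis using self[OF x] self[OF y] by blast
qed

lemma valuation_module_of_valuation_ring:
  assumes R: "valuation_ring R" and M: "module R M"
  shows "valuation_module R M"
proof -
  interpret module R M by fact
  show ?thesis
  proof
    show "(\<exists>c\<in>carrier R. a = b \<otimes>\<^bsub>R\<^esub> c) \<or> (\<exists>c\<in>carrier R. b = a \<otimes>\<^bsub>R\<^esub> c)"
      if "a \<in> carrier R" "b \<in> carrier R" for a b
      using uniserial_comparable[of R "regular_module R" a b] R that m_comm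
      by (auto simp: valuation_ring_def)
  qed
qed

text \<open>
  \<open>F\<close> and \<open>G\<close> assign to each factor its set of types. Since these sets are equal or disjoint, the
  number of factors with a given set of types is the number of factors with any one type in it.
\<close>

lemma image_mset_eq_if_type_counts_agree:
  fixes F :: "'i \<Rightarrow> 't set" and G :: "'j \<Rightarrow> 't set"
  assumes I: "finite I" and J: "finite J"
    and ne: "\<And>i. i \<in> I \<Longrightarrow> F i \<noteq> {}" "\<And>j. j \<in> J \<Longrightarrow> G j \<noteq> {}"
    and FF: "\<And>i i'. \<lbrakk>i \<in> I; i' \<in> I; F i \<inter> F i' \<noteq> {}\<rbrakk> \<Longrightarrow> F i = F i'"
    and FG: "\<And>i j. \<lbrakk>i \<in> I; j \<in> J; F i \<inter> G j \<noteq> {}\<rbrakk> \<Longrightarrow> F i = G j"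
    and GG: "\<And>j j'. \<lbrakk>j \<in> J; j' \<in> J; G j \<inter> G j' \<noteq> {}\<rbrakk> \<Longrightarrow> G j = G j'"
    and card: "\<And>\<tau>. card {i \<in> I. \<tau> \<in> F i} = card {j \<in> J. \<tau> \<in> G j}"
  shows "image_mset F (mset_set I) = image_mset G (mset_set J)"
proof (rule multiset_eqI)
  fix W
  have fibre: "F -` {W} \<inter> I = {i \<in> I. F i = W}" "G -` {W} \<inter> J = {j \<in> J. G j = W}" by auto
  have "card {i \<in> I. F i = W} = card {j \<in> J. G j = W}"
  proof (cases "(\<exists>i\<in>I. F i = W) \<or> (\<exists>j\<in>J. G j = W)")
    case True
    then obtain \<tau> where \<tau>: "\<tau> \<in> W" using ne by blast
    have "{i \<in> I. F i = W} = {i \<in> I. \<tau> \<in> F i}" "{j \<in> J. G j = W} = {j \<in> J. \<tau> \<in> G j}"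
      using True \<tau> FF FG GG by blast+
    then show ?thesis using card by simp
  next
    case False
    then have "{i \<in> I. F i = W} = {}" "{j \<in> J. G j = W} = {}" by auto
    then show ?thesis by (simp only: card.empty)
  qed
  then show "count (image_mset F (mset_set I)) W = count (image_mset G (mset_set J)) W"
    using I J by (simp add: count_image_mset fibre)
qed

context valuation_module begin

lemma
  assumes L: "submodule L R M" and N: "submodule N R M" and NL: "N \<subseteq> L"
  defines "p \<equiv> \<lambda>x. N +>\<^bsub>M\<lparr>carrier := L\<rparr>\<^esub> x" and "U \<equiv> quotient_module (M\<lparr>carrier := L\<rparr>) N"
  shows factor_proj: "p \<in> module_hom R (M\<lparr>carrier := L\<rparr>) U"
    and factor_surj: "p ` L = carrier U"
    and factor_eq_iff: "\<lbrakk>x \<in> L; y \<in> L\<rbrakk> \<Longrightarrow> p x = p y \<longleftrightarrow> congruent_mod N x y"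
    and factor_zero_iff: "x \<in> L \<Longrightarrow> p x = \<zero>\<^bsub>U\<^esub> \<longleftrightarrow> x \<in> N"
proof -
  have LM: "module R (M\<lparr>carrier := L\<rparr>)" by (rule submodule_carrier_module[OF module_axioms L])
  have NL': "submodule N R (M\<lparr>carrier := L\<rparr>)" by (rule submodule_restrict[OF module_axioms L N NL])
  note cL = submodule_closed[OF L] and cN = submodule_closed[OF N]
  have U: "module R U" unfolding U_def by (rule quotient_module_module[OF LM NL'])
  show p: "p \<in> module_hom R (M\<lparr>carrier := L\<rparr>) U" unfolding U_def p_def by (rule quotient_module_proj[OF LM NL'])
  show "p ` L = carrier U" using quotient_module_surj[OF LM NL'] unfolding U_def p_def by simp
  show eq: "p x = p y \<longleftrightarrow> congruent_mod N x y" if "x \<in> L" "y \<in> L" for x y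
  proof -
    have xy: "x \<in> carrier M" "y \<in> carrier M" using that cL(1) by auto
    have "p x = p y \<longleftrightarrow> (\<exists>h\<in>N. x = h \<oplus>\<^bsub>M\<^esub> y)"
      using quotient_coset_eq_iff[OF LM NL'] that unfolding p_def by simp
    also have "\<dots> \<longleftrightarrow> congruent_mod N x y"
    proof
      assume "\<exists>h\<in>N. x = h \<oplus>\<^bsub>M\<^esub> y"
      then obtain h where h: "h \<in> N" "x = h \<oplus>\<^bsub>M\<^esub> y" by blast
      then have "x \<ominus>\<^bsub>M\<^esub> y = h" using cN(1) xy by (simp add: M.minus_eq M.a_assoc M.r_neg)
      then show "congruent_mod N x y" using h xy by (simp add: congruent_mod_def)
    next
      assume c: "congruent_mod N x y"
      have "x = (x \<ominus>\<^bsub>M\<^esub> y) \<oplus>\<^bsub>M\<^esub> y" using xy by (simp add: M.minus_eq M.a_assoc M.l_neg)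
      then show "\<exists>h\<in>N. x = h \<oplus>\<^bsub>M\<^esub> y" using c unfolding congruent_mod_def by blast
    qed
    finally show ?thesis .
  qed
  interpret U: module R U by (rule U)
  have "p \<zero>\<^bsub>M\<^esub> = \<zero>\<^bsub>U\<^esub>"
    using module_homD(3)[OF p, of \<zero> "\<zero>\<^bsub>M\<^esub>"] module_homD(1)[OF p, of "\<zero>\<^bsub>M\<^esub>"] cL(2) by simp
  then show "p x = \<zero>\<^bsub>U\<^esub> \<longleftrightarrow> x \<in> N" if "x \<in> L" for x
    using eq[OF that cL(2)] congruent_zero_iff[OF N] cL(1)[OF that] by simp
qed

lemma uniserial_factor_if_uniserial:
  assumes L: "submodule L R M" and N: "submodule N R M" and NL: "N \<subseteq> L"
    and us: "uniserial R (quotient_module (M\<lparr>carrier := L\<rparr>) N)"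
  shows "uniserial_factor L N"
  unfolding uniserial_factor_def
proof (intro ballI)
  fix x y assume xy: "x \<in> L" "y \<in> L"
  let ?U = "quotient_module (M\<lparr>carrier := L\<rparr>) N" and ?p = "\<lambda>x. N +>\<^bsub>M\<lparr>carrier := L\<rparr>\<^esub> x"
  note ph = module_homD[OF factor_proj[OF L N NL]] and eq = factor_eq_iff[OF L N NL]
  have key: "congruent_mod N u (c \<odot>\<^bsub>M\<^esub> v)" if "c \<in> carrier R" "u \<in> L" "v \<in> L" "?p u = c \<odot>\<^bsub>?U\<^esub> ?p v" for c u v
    using ph(3)[of c v] eq[of u "c \<odot>\<^bsub>M\<^esub> v"] submodule_closed(6)[OF L that(1,3)] that by simp
  have "(\<exists>c\<in>carrier R. ?p x = c \<odot>\<^bsub>?U\<^esub> ?p y) \<or> (\<exists>c\<in>carrier R. ?p y = c \<odot>\<^bsub>?U\<^esub> ?p x)"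
    by (rule uniserial_comparable[OF us]) (use ph(1) xy in auto)
  then show "(\<exists>c\<in>carrier R. congruent_mod N x (c \<odot>\<^bsub>M\<^esub> y)) \<or> (\<exists>c\<in>carrier R. congruent_mod N y (c \<odot>\<^bsub>M\<^esub> x))"
    using key[OF _ xy] key[OF _ xy(2,1)] by blast
qed

lemma types_factor_iff:
  assumes L: "submodule L R M" and N: "submodule N R M" and NL: "N \<subseteq> L"
  shows "(A, B) \<in> types R (quotient_module (M\<lparr>carrier := L\<rparr>) N) \<longleftrightarrow> (\<exists>w. type_at L N w A B)"
proof -
  let ?U = "quotient_module (M\<lparr>carrier := L\<rparr>) N" and ?p = "\<lambda>x. N +>\<^bsub>M\<lparr>carrier := L\<rparr>\<^esub> x"
  note ph = module_homD[OF factor_proj[OF L N NL]] and eq = factor_eq_iff[OF L N NL]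
    and zero = factor_zero_iff[OF L N NL] and surj = factor_surj[OF L N NL]
  note cL = submodule_closed[OF L]
  have sm: "c \<odot>\<^bsub>?U\<^esub> ?p u = ?p (c \<odot>\<^bsub>M\<^esub> u)" if "c \<in> carrier R" "u \<in> L" for c u using ph(3) that by simp
  have et: "element_type R ?U (?p w) = ({r \<in> carrier R. r \<odot>\<^bsub>M\<^esub> w \<in> N},
      {r \<in> carrier R. \<forall>z\<in>L. \<not> congruent_mod N w (r \<odot>\<^bsub>M\<^esub> z)})" if w: "w \<in> L" for w
  proof -
    have "r \<odot>\<^bsub>?U\<^esub> ?p w = \<zero>\<^bsub>?U\<^esub> \<longleftrightarrow> r \<odot>\<^bsub>M\<^esub> w \<in> N" if "r \<in> carrier R" for r
      using sm[OF that w] zero[OF cL(6)[OF that w]] by simp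
    moreover have "(\<forall>z\<in>carrier ?U. ?p w \<noteq> r \<odot>\<^bsub>?U\<^esub> z) \<longleftrightarrow> (\<forall>z\<in>L. \<not> congruent_mod N w (r \<odot>\<^bsub>M\<^esub> z))"
      if r: "r \<in> carrier R" for r
    proof -
      have "?p w = r \<odot>\<^bsub>?U\<^esub> ?p z \<longleftrightarrow> congruent_mod N w (r \<odot>\<^bsub>M\<^esub> z)" if "z \<in> L" for z
        using sm[OF r that] eq[OF w cL(6)[OF r that]] by simp
      then show ?thesis unfolding surj[symmetric] by blast
    qed
    ultimately show ?thesis unfolding element_type_def prod.inject by (intro conjI Collect_cong) blast+
  qed
  have "(A, B) \<in> types R ?U \<longleftrightarrow> (\<exists>w\<in>L. ?p w \<noteq> \<zero>\<^bsub>?U\<^esub> \<and> (A, B) = element_type R ?U (?p w))"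
    unfolding types_def surj[symmetric] by blast
  also have "\<dots> \<longleftrightarrow> (\<exists>w. type_at L N w A B)"
    unfolding type_at_def using et zero by auto
  finally show ?thesis .
qed

lemma factor_countable_chain:
  assumes L: "submodule L R M" and N: "submodule N R M" and NL: "N \<subseteq> L"
    and us: "uniserial_factor L N" and cg: "countably_generated_by L"
  shows "\<exists>g :: nat \<Rightarrow> 'c set. (\<forall>i. g i \<in> carrier (quotient_module (M\<lparr>carrier := L\<rparr>) N)) \<and>
    (\<forall>u\<in>carrier (quotient_module (M\<lparr>carrier := L\<rparr>) N). \<exists>i. \<exists>c\<in>carrier R.
       u = c \<odot>\<^bsub>quotient_module (M\<lparr>carrier := L\<rparr>) N\<^esub> g i)"
proof -
  let ?U = "quotient_module (M\<lparr>carrier := L\<rparr>) N" and ?p = "\<lambda>x. N +>\<^bsub>M\<lparr>carrier := L\<rparr>\<^esub> x"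
  note ph = module_homD[OF factor_proj[OF L N NL]] and eq = factor_eq_iff[OF L N NL]
    and surj = factor_surj[OF L N NL]
  obtain g :: "nat \<Rightarrow> 'c" where g: "\<And>i. g i \<in> L"
    "\<And>x. x \<in> L \<Longrightarrow> \<exists>i. \<exists>c\<in>carrier R. congruent_mod N x (c \<odot>\<^bsub>M\<^esub> g i)"
    using countable_chain_mod[OF L N us cg] by blast
  have "\<exists>i. \<exists>c\<in>carrier R. u = c \<odot>\<^bsub>?U\<^esub> ?p (g i)" if u: "u \<in> carrier ?U" for u
  proof -
    obtain x where x: "x \<in> L" "u = ?p x" using u surj by blast
    obtain i c where c: "c \<in> carrier R" "congruent_mod N x (c \<odot>\<^bsub>M\<^esub> g i)" using g(2)[OF x(1)] by blast
    have "?p x = ?p (c \<odot>\<^bsub>M\<^esub> g i)" using eq[OF x(1) submodule_closed(6)[OF L c(1) g(1)]] c(2) by simp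
    also have "\<dots> = c \<odot>\<^bsub>?U\<^esub> ?p (g i)" using ph(3)[of c "g i"] c(1) g(1) by simp
    finally show ?thesis using x(2) c(1) by blast
  qed
  moreover have "?p (g i) \<in> carrier ?U" for i using g(1) surj by blast
  ultimately show ?thesis by (intro exI[of _ "\<lambda>i. ?p (g i)"]) blast
qed

lemma divisible_series_if_pure_composition_series:
  assumes "pure_composition_series R M S n"
  shows "divisible_series S n"
proof -
  have rd: "relatively_divisible (S k) (carrier M)" if "k \<le> n" for k
  proof -
    have pure: "pure_submodule R M (S k)" using assms that by (simp add: pure_composition_series_def)
    then have S: "submodule (S k) R M" by (simp add: pure_submodule_def)
    then show ?thesis
      using pure_submodule_divisible[OF module_axioms pure] submodule_carrier submodule_closed(1)[OF S]
      unfolding relatively_divisible_def by blast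
  qed
  have "S (k - 1) \<subseteq> S k \<and> uniserial_factor (S k) (S (k - 1))" if k: "k \<in> {1..n}" for k
  proof -
    have sub: "submodule (S k) R M" "submodule (S (k - 1)) R M"
      using rd[of k] rd[of "k - 1"] k by (auto simp: relatively_divisible_def)
    have "S (k - 1) \<subseteq> S k" "uniserial R (series_factor M S k)"
      using assms k by (auto simp: pure_composition_series_def)
    then show ?thesis using uniserial_factor_if_uniserial[OF sub] by (simp add: series_factor_def)
  qed
  then show ?thesis using rd assms unfolding divisible_series_def pure_composition_series_def by blast
qed

text \<open>
  The induction runs downwards from \<open>M\<close>, each term being the kernel of the projection of its
  successor to a uniserial factor.
\<close>

lemma countably_generated_by_series:
  assumes S: "divisible_series S n" and cg: "countably_generated_by (carrier M)" and "k \<le> n"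
  shows "countably_generated_by (S k)"
  using assms(3)
proof (induction k rule: inc_induct)
  case base
  then show ?case using S cg by (simp add: divisible_series_def)
next
  case (step k)
  then have k: "Suc k \<in> {1..n}" by simp
  show ?case using countably_generated_kernel[OF divisible_series_step(5,4)[OF S k]] step.IH by simp
qed

end

section \<open>Uniqueness of pure-composition series\<close>

definition countably_uniserial :: "('a, 'r) ring_scheme \<Rightarrow> ('a, 'b, 'm) module_scheme \<Rightarrow> bool" where
  "countably_uniserial R V \<longleftrightarrow> module R V \<and>
    (\<forall>x\<in>carrier V. \<forall>y\<in>carrier V. (\<exists>c\<in>carrier R. x = c \<odot>\<^bsub>V\<^esub> y) \<or> (\<exists>c\<in>carrier R. y = c \<odot>\<^bsub>V\<^esub> x)) \<and>
    (\<exists>g :: nat \<Rightarrow> 'b. (\<forall>i. g i \<in> carrier V) \<and> (\<forall>x\<in>carrier V. \<exists>i. \<exists>c\<in>carrier R. x = c \<odot>\<^bsub>V\<^esub> g i))"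

lemma isomorphic_if_countably_uniserial:
  fixes R :: "('a, 'r) ring_scheme" and U :: "('a, 'b, 'm) module_scheme" and V :: "('a, 'd, 'n) module_scheme"
  assumes R: "valuation_ring R" and U: "countably_uniserial R U" and V: "countably_uniserial R V"
    and ne: "types R U \<inter> types R V \<noteq> {}"
  shows "module_isomorphic R U V"
proof -
  obtain g :: "nat \<Rightarrow> 'b" where g: "\<And>i. g i \<in> carrier U"
    "\<And>x. x \<in> carrier U \<Longrightarrow> \<exists>i. \<exists>c\<in>carrier R. x = c \<odot>\<^bsub>U\<^esub> g i"
    using U unfolding countably_uniserial_def by blast
  obtain h :: "nat \<Rightarrow> 'd" where h: "\<And>i. h i \<in> carrier V"
    "\<And>x. x \<in> carrier V \<Longrightarrow> \<exists>i. \<exists>c\<in>carrier R. x = c \<odot>\<^bsub>V\<^esub> h i"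
    using V unfolding countably_uniserial_def by blast
  obtain \<tau> where \<tau>: "\<tau> \<in> types R U" "\<tau> \<in> types R V" using ne by blast
  have mod: "module R U" "module R V" using U V by (simp_all add: countably_uniserial_def)
  show ?thesis
  proof (rule isomorphic_if_common_type[OF valuation_module_of_valuation_ring[OF R mod(1)]
        valuation_module_of_valuation_ring[OF R mod(2)] _ _ g h \<tau>])
    show "(\<exists>c\<in>carrier R. x = c \<odot>\<^bsub>U\<^esub> y) \<or> (\<exists>c\<in>carrier R. y = c \<odot>\<^bsub>U\<^esub> x)"
      if "x \<in> carrier U" "y \<in> carrier U" for x y
      using U that unfolding countably_uniserial_def by blast
    show "(\<exists>c\<in>carrier R. x = c \<odot>\<^bsub>V\<^esub> y) \<or> (\<exists>c\<in>carrier R. y = c \<odot>\<^bsub>V\<^esub> x)"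
      if "x \<in> carrier V" "y \<in> carrier V" for x y
      using V that unfolding countably_uniserial_def by blast
  qed
qed

theorem corollary3p4:
  fixes R :: "('a, 'r) ring_scheme" and M :: "('a, 'b, 'm) module_scheme"
    and S T :: "nat \<Rightarrow> 'b set" and n m :: nat
  assumes "valuation_ring R" and "module R M"
    and "polyserial R M" and "countably_generated R M"
    and "pure_composition_series R M S n" and "pure_composition_series R M T m"
  shows "isomorphic_series R M S n T m"
proof -
  interpret valuation_module R M by (rule valuation_module_of_valuation_ring[OF assms(1,2)])
  note dS = divisible_series_if_pure_composition_series[OF assms(5)]
    and dT = divisible_series_if_pure_composition_series[OF assms(6)]
  have cg: "countably_generated_by (carrier M)"
    using assms(4) unfolding countably_generated_def countably_generated_by_def .
  note iso = isomorphic_if_countably_uniserial[OF assms(1)]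
  have same: "types R U = types R V"
    if "countably_uniserial R U" "countably_uniserial R V" "types R U \<inter> types R V \<noteq> {}"
    for U V :: "('a, 'b set) module"
    using types_isomorphic[OF _ _ iso[OF that]] that(1,2) by (simp add: countably_uniserial_def)
  have factor: "countably_uniserial R (series_factor M W k) \<and> types R (series_factor M W k) \<noteq> {} \<and>
      (\<forall>A B. (A, B) \<in> types R (series_factor M W k) \<longleftrightarrow> (\<exists>w. type_at (W k) (W (k - 1)) w A B))"
    if pcs: "pure_composition_series R M W l" and k: "k \<in> {1..l}" for W l k
  proof -
    note dW = divisible_series_if_pure_composition_series[OF pcs]
    note st = divisible_series_step[OF dW k]
    have us: "uniserial R (series_factor M W k)" and strict: "W (k - 1) \<subset> W k"
      using pcs k by (auto simp: pure_composition_series_def)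
    have cgk: "countably_generated_by (W k)" using countably_generated_by_series[OF dW cg] k by simp
    have good: "countably_uniserial R (series_factor M W k)"
      unfolding countably_uniserial_def using us uniserial_comparable[OF us] factor_countable_chain[OF st(1-4) cgk]
      by (auto simp: uniserial_def series_factor_def)
    obtain w where w: "w \<in> W k" "w \<notin> W (k - 1)" using strict by blast
    have ex: "\<exists>A B. type_at (W k) (W (k - 1)) w A B" using w unfolding type_at_def by blast
    have iff: "(A, B) \<in> types R (series_factor M W k) \<longleftrightarrow> (\<exists>w. type_at (W k) (W (k - 1)) w A B)" for A B
      unfolding series_factor_def by (rule types_factor_iff[OF st(1-3)])
    show ?thesis using good iff ex by blast
  qed
  note fS = factor[OF assms(5)] and fT = factor[OF assms(6)]
  let ?F = "\<lambda>k. types R (series_factor M S k)" and ?G = "\<lambda>k. types R (series_factor M T k)"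
  have card: "card {k \<in> {1..n}. \<tau> \<in> ?F k} = card {k \<in> {1..m}. \<tau> \<in> ?G k}" for \<tau>
  proof -
    obtain A B where \<tau>: "\<tau> = (A, B)" by (cases \<tau>)
    have "{k \<in> {1..n}. \<tau> \<in> ?F k} = {k \<in> {1..n}. \<exists>w. type_at (S k) (S (k - 1)) w A B}"
      "{k \<in> {1..m}. \<tau> \<in> ?G k} = {k \<in> {1..m}. \<exists>w. type_at (T k) (T (k - 1)) w A B}"
      using fS fT unfolding \<tau> by blast+
    then show ?thesis
      using card_factors_of_type_le[OF dS dT, of A B] card_factors_of_type_le[OF dT dS, of A B] by simp
  qed
  have mset: "image_mset ?F (mset_set {1..n}) = image_mset ?G (mset_set {1..m})"
  proof (rule image_mset_eq_if_type_counts_agree[OF _ _ _ _ _ _ _ card])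
    show "?F i = ?F i'" if "i \<in> {1..n}" "i' \<in> {1..n}" "?F i \<inter> ?F i' \<noteq> {}" for i i'
      using same[OF _ _ that(3)] fS that(1,2) by blast
    show "?F i = ?G j" if "i \<in> {1..n}" "j \<in> {1..m}" "?F i \<inter> ?G j \<noteq> {}" for i j
      using same[OF _ _ that(3)] fS fT that(1,2) by blast
    show "?G j = ?G j'" if "j \<in> {1..m}" "j' \<in> {1..m}" "?G j \<inter> ?G j' \<noteq> {}" for j j'
      using same[OF _ _ that(3)] fT that(1,2) by blast
  qed (use fS fT in simp_all)
  then have "size (image_mset ?F (mset_set {1..n})) = size (image_mset ?G (mset_set {1..m}))" by simp
  then have nm: "m = n" by simp
  have "\<exists>\<sigma>. \<sigma> permutes {1..n} \<and> (\<forall>k\<in>{1..n}. ?F k = ?G (\<sigma> k))"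
    by (rule image_mset_eq_implies_permutes[OF finite_atLeastAtMost mset[unfolded nm]]) (intro exI conjI)
  then obtain \<sigma> where \<sigma>: "\<sigma> permutes {1..n}" "\<forall>k\<in>{1..n}. ?F k = ?G (\<sigma> k)"
    by (elim exE conjE)
  have "module_isomorphic R (series_factor M S k) (series_factor M T (\<sigma> k))" if k: "k \<in> {1..n}" for k
  proof (rule iso)
    have "\<sigma> k \<in> {1..m}" using k nm permutes_in_image[OF \<sigma>(1)] by simp
    then show "countably_uniserial R (series_factor M T (\<sigma> k))" using fT by blast
    show "countably_uniserial R (series_factor M S k)" "?F k \<inter> ?G (\<sigma> k) \<noteq> {}" using fS[OF k] bspec[OF \<sigma>(2) k] by simp_all
  qed
  then show ?thesis unfolding isomorphic_series_def using nm \<sigma>(1) by blast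
qed

end
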